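(* Let $(M^3,g,K)$ be an initial data set, and let $\eta$ be a nontrivial Killing vector field on $(M^3,g)$. Assume that $K$ is invariant under $\eta$. If $\Sigma^2$ is a closed stable MOTS in $(M^3,g,K)$ that is invariant under $\eta$, then $$\int_{\Sigma\setminus\{\eta=0\}}|X^\eta|^2f^2\le\int_\Sigma\big(|\nabla f|^2+Qf^2\big)$$ for every axisymmetric (i.e. $\eta$-invariant) smooth function $f$ on $\Sigma^2$, where $X^\eta=\dfrac{\langle X,\eta\rangle}{\langle\eta,\eta\rangle}\,\eta$ is the projection of $X$ onto $\eta$.
   Context: All manifolds are orientable and connected, and all data are smooth. An initial data set $(M^3,g,K)$ is a three-dimensional Riemannian manifold $(M^3,g)$ with a symmetric $(0,2)$-tensor $K$. Put $\tau=\operatorname{tr}_gK$, $\mu=\frac12(R-|K|^2+\tau^2)$ and $J=\operatorname{div}(K-\tau g)$, where $R$ is the scalar curvature of $g$. For a closed connected surface $\Sigma^2\subset M$ with chosen (outward) unit normal $\nu$, let $\langle\,,\rangle$ be the induced metric, $\kappa_\Sigma$ its Gaussian curvature, $A$ the second fundamental form with $H=\operatorname{tr}A=\operatorname{div}_\Sigma\nu$, $\chi^{+}=K|_\Sigma+A$, and $\theta^{+}=\operatorname{tr}\chi^{+}=\operatorname{tr}_\Sigma K+H$. $X$ is the tangential vector field on $\Sigma$ metrically dual to $K(\nu,\cdot)|_\Sigma$. $\Sigma$ is a MOTS if $\theta^+\equiv0$. The MOTS stability operator is $$L\phi=-\Delta\phi+2\langle X,\nabla\phi\rangle+(Q-|X|^2+\operatorname{div}X)\phi,\qquad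 Q=\kappa_\Sigma-(\mu+J(\nu))-\tfrac12|\chi^+|^2,$$ with $\Delta,\nabla,\operatorname{div}$ taken on $\Sigma$. $L$ has a real eigenvalue $\lambda_1(L)$, the principal eigenvalue, with $\operatorname{Re}\lambda\ge\lambda_1(L)$ for all eigenvalues $\lambda$ of $L$; its eigenspace is one-dimensional and spanned by a positive smooth function. A MOTS is stable if $\lambda_1(L)\ge0$ (equivalently, there is a positive smooth $\phi$ on $\Sigma$ with $L\phi\ge0$). A tensor or function $S$ is invariant under $\eta$ if $\mathcal L_\eta S=0$; a surface is invariant under $\eta$ if the flow of $\eta$ maps it onto itself. *)

theory Defs
  imports "HOL-Analysis.Analysis"
begin

section \<open>Smooth maps between Euclidean spaces\<close>

primrec Ck_on :: "nat \<Rightarrow> 'b::euclidean_space set \<Rightarrow> ('b \<Rightarrow> 'c::real_normed_vector) \<Rightarrow> bool" where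
  "Ck_on 0 U f \<longleftrightarrow> continuous_on U f"
| "Ck_on (Suc k) U f \<longleftrightarrow> (\<forall>x\<in>U. f differentiable (at x)) \<and>
     (\<forall>v. Ck_on k U (\<lambda>x. frechet_derivative f (at x) v))"

text \<open>Only used for open sets.\<close>

definition smooth_on :: "'b::euclidean_space set \<Rightarrow> ('b \<Rightarrow> 'c::real_normed_vector) \<Rightarrow> bool" where
  "smooth_on U f \<longleftrightarrow> (\<forall>k. Ck_on k U f)"


section \<open>Manifolds\<close>

text \<open>A manifold is a set in a second countable Hausdorff space, with the subspace topology,
  together with a smooth atlas, which need not be maximal. A chart is a domain together
  with a coordinate map.\<close>

type_synonym ('a, 'n) chart = "'a set \<times> ('a \<Rightarrow> real ^ 'n)"

definition cdom :: "('a, 'n) chart \<Rightarrow> 'a set" where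
  "cdom c = fst c"

definition cmap :: "('a, 'n) chart \<Rightarrow> 'a \<Rightarrow> real ^ 'n" where
  "cmap c = snd c"

definition cinv :: "('a, 'n) chart \<Rightarrow> real ^ 'n \<Rightarrow> 'a" where
  "cinv c = inv_into (cdom c) (cmap c)"

definition is_chart :: "'a::topological_space set \<Rightarrow> ('a, 'n::finite) chart \<Rightarrow> bool" where
  "is_chart M c \<longleftrightarrow> openin (top_of_set M) (cdom c) \<and> open (cmap c ` cdom c) \<and>
     homeomorphism (cdom c) (cmap c ` cdom c) (cmap c) (cinv c)"

definition smooth_in_chart ::
  "('a, 'n::finite) chart \<Rightarrow> 'a set \<Rightarrow> ('a \<Rightarrow> 'v::real_normed_vector) \<Rightarrow> bool" where
  "smooth_in_chart c W f \<longleftrightarrow> smooth_on (cmap c ` (W \<inter> cdom c)) (f \<circ> cinv c)"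

definition smooth_atlas :: "'a::topological_space set \<Rightarrow> ('a, 'n::finite) chart set \<Rightarrow> bool" where
  "smooth_atlas M \<A> \<longleftrightarrow> (\<forall>c\<in>\<A>. is_chart M c) \<and> (\<Union>c\<in>\<A>. cdom c) = M \<and>
     (\<forall>c\<in>\<A>. \<forall>d\<in>\<A>. smooth_in_chart c (cdom d) (cmap d))"

text \<open>The \<open>i\<close>-th coordinate derivative at \<open>p\<close> in the chart \<open>c\<close>.\<close>

definition pd :: "('a, 'n::finite) chart \<Rightarrow> 'n \<Rightarrow> ('a \<Rightarrow> real) \<Rightarrow> 'a \<Rightarrow> real" where
  "pd c i f p = frechet_derivative (f \<circ> cinv c) (at (cmap c p)) (axis i 1)"

text \<open>The charts \<open>c\<close> and \<open>d\<close> may belong to different manifolds: if \<open>c\<close> is a chart of a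
  submanifold and \<open>d\<close> a chart of the ambient manifold, this is the matrix of the differential
  of the inclusion, whose columns are the coordinate vectors of \<open>c\<close> expressed in \<open>d\<close>.\<close>

definition jac :: "('a, 'm::finite) chart \<Rightarrow> ('a, 'n::finite) chart \<Rightarrow> 'a \<Rightarrow> real ^ 'm ^ 'n" where
  "jac c d p = (\<chi> k i. pd c i (\<lambda>q. cmap d q $ k) p)"

definition orientable_manifold :: "'a::topological_space set \<Rightarrow> ('a, 'n::finite) chart set \<Rightarrow> bool" where
  "orientable_manifold M \<A> \<longleftrightarrow> (\<exists>\<B>. smooth_atlas M \<B> \<and> smooth_atlas M (\<A> \<union> \<B>) \<and>
     (\<forall>b\<in>\<B>. \<forall>d\<in>\<B>. \<forall>p\<in>cdom b \<inter> cdom d. det (jac b d p) > 0))"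

definition smooth_manifold ::
  "'a::{second_countable_topology, t2_space} set \<Rightarrow> ('a, 'n::finite) chart set \<Rightarrow> bool" where
  "smooth_manifold M \<A> \<longleftrightarrow> M \<noteq> {} \<and> connected M \<and> smooth_atlas M \<A> \<and> orientable_manifold M \<A>"

definition chart_at :: "('a, 'n) chart set \<Rightarrow> 'a \<Rightarrow> ('a, 'n) chart" where
  "chart_at \<A> p = (SOME c. c \<in> \<A> \<and> p \<in> cdom c)"

definition smooth_fun ::
  "('a, 'n::finite) chart set \<Rightarrow> ('a \<Rightarrow> 'v::real_normed_vector) \<Rightarrow> bool" where
  "smooth_fun \<A> f \<longleftrightarrow> (\<forall>c\<in>\<A>. smooth_in_chart c (cdom c) f)"


section \<open>Tensor fields\<close>

text \<open>Vector fields and \<open>(0,2)\<close>-tensor fields are given by their components in every chart,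
  subject to the transformation law.\<close>

type_synonym ('a, 'n) vfield = "('a, 'n) chart \<Rightarrow> 'a \<Rightarrow> real ^ 'n"
type_synonym ('a, 'n) tensor2 = "('a, 'n) chart \<Rightarrow> 'a \<Rightarrow> real ^ 'n ^ 'n"

text \<open>Smooth sections over \<open>S\<close> (a submanifold with atlas \<open>\<B>\<close>) of the tangent bundle of the
  manifold with atlas \<open>\<A>\<close>.\<close>

definition smooth_vfield_along ::
  "('a, 'm::finite) chart set \<Rightarrow> ('a, 'n::finite) chart set \<Rightarrow> 'a set \<Rightarrow> ('a, 'n) vfield \<Rightarrow> bool" where
  "smooth_vfield_along \<B> \<A> S V \<longleftrightarrow>
     (\<forall>c\<in>\<B>. \<forall>C\<in>\<A>. smooth_in_chart c (cdom C) (V C)) \<and>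
     (\<forall>C\<in>\<A>. \<forall>D\<in>\<A>. \<forall>p\<in>S \<inter> cdom C \<inter> cdom D. V D p = jac C D p *v V C p)"

definition smooth_vfield :: "'a set \<Rightarrow> ('a, 'n::finite) chart set \<Rightarrow> ('a, 'n) vfield \<Rightarrow> bool" where
  "smooth_vfield M \<A> V \<longleftrightarrow> smooth_vfield_along \<A> \<A> M V"

definition smooth_sym_tensor2 :: "('a, 'n::finite) chart set \<Rightarrow> ('a, 'n) tensor2 \<Rightarrow> bool" where
  "smooth_sym_tensor2 \<A> T \<longleftrightarrow>
     (\<forall>c\<in>\<A>. smooth_in_chart c (cdom c) (T c) \<and> (\<forall>p\<in>cdom c. transpose (T c p) = T c p)) \<and>
     (\<forall>c\<in>\<A>. \<forall>d\<in>\<A>. \<forall>p\<in>cdom c \<inter> cdom d.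
        T c p = transpose (jac c d p) ** T d p ** jac c d p)"

definition bil :: "real ^ 'n ^ 'n \<Rightarrow> real ^ 'n \<Rightarrow> real ^ 'n \<Rightarrow> real" where
  "bil T v w = v \<bullet> (T *v w)"

definition riemannian_metric :: "('a, 'n::finite) chart set \<Rightarrow> ('a, 'n) tensor2 \<Rightarrow> bool" where
  "riemannian_metric \<A> g \<longleftrightarrow> smooth_sym_tensor2 \<A> g \<and>
     (\<forall>c\<in>\<A>. \<forall>p\<in>cdom c. \<forall>v. v \<noteq> 0 \<longrightarrow> bil (g c p) v v > 0)"

definition initial_data_set ::
  "'a::{second_countable_topology, t2_space} set \<Rightarrow> ('a, 3) chart set \<Rightarrow>
   ('a, 3) tensor2 \<Rightarrow> ('a, 3) tensor2 \<Rightarrow> bool" where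
  "initial_data_set M \<A> g K \<longleftrightarrow>
     smooth_manifold M \<A> \<and> riemannian_metric \<A> g \<and> smooth_sym_tensor2 \<A> K"

text \<open>\<open>(L\<^sub>V T)\<^sub>i\<^sub>j = V\<^sup>k \<partial>\<^sub>k T\<^sub>i\<^sub>j + T\<^sub>k\<^sub>j \<partial>\<^sub>i V\<^sup>k + T\<^sub>i\<^sub>k \<partial>\<^sub>j V\<^sup>k\<close>\<close>

definition lie_tensor2 :: "('a, 'n::finite) vfield \<Rightarrow> ('a, 'n) tensor2 \<Rightarrow> ('a, 'n) tensor2" where
  "lie_tensor2 V T c p = (\<chi> i j. \<Sum>k\<in>UNIV.
       V c p $ k * pd c k (\<lambda>q. T c q $ i $ j) p
     + T c p $ k $ j * pd c i (\<lambda>q. V c q $ k) p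
     + T c p $ i $ k * pd c j (\<lambda>q. V c q $ k) p)"

definition lie_fun ::
  "('a, 'n::finite) vfield \<Rightarrow> ('a \<Rightarrow> real) \<Rightarrow> ('a, 'n) chart \<Rightarrow> 'a \<Rightarrow> real" where
  "lie_fun V f c p = (\<Sum>k\<in>UNIV. V c p $ k * pd c k f p)"

definition invariant_tensor2 ::
  "('a, 'n::finite) chart set \<Rightarrow> ('a, 'n) vfield \<Rightarrow> ('a, 'n) tensor2 \<Rightarrow> bool" where
  "invariant_tensor2 \<A> V T \<longleftrightarrow> (\<forall>c\<in>\<A>. \<forall>p\<in>cdom c. lie_tensor2 V T c p = 0)"

definition invariant_fun ::
  "('a, 'n::finite) chart set \<Rightarrow> ('a, 'n) vfield \<Rightarrow> ('a \<Rightarrow> real) \<Rightarrow> bool" where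
  "invariant_fun \<A> V f \<longleftrightarrow> (\<forall>c\<in>\<A>. \<forall>p\<in>cdom c. lie_fun V f c p = 0)"

definition killing_field ::
  "'a set \<Rightarrow> ('a, 'n::finite) chart set \<Rightarrow> ('a, 'n) tensor2 \<Rightarrow> ('a, 'n) vfield \<Rightarrow> bool" where
  "killing_field M \<A> g V \<longleftrightarrow> smooth_vfield M \<A> V \<and> invariant_tensor2 \<A> V g"

definition vanishes_at ::
  "('a, 'n::finite) chart set \<Rightarrow> ('a, 'n) vfield \<Rightarrow> 'a \<Rightarrow> bool" where
  "vanishes_at \<A> V p \<longleftrightarrow> (\<forall>C\<in>\<A>. p \<in> cdom C \<longrightarrow> V C p = 0)"

definition integral_curve ::
  "'a::topological_space set \<Rightarrow> ('a, 'n::finite) chart set \<Rightarrow> ('a, 'n) vfield \<Rightarrow>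
   real set \<Rightarrow> (real \<Rightarrow> 'a) \<Rightarrow> bool" where
  "integral_curve M \<A> V I \<gamma> \<longleftrightarrow> open I \<and> is_interval I \<and> continuous_on I \<gamma> \<and> \<gamma> ` I \<subseteq> M \<and>
     (\<forall>t\<in>I. \<forall>C\<in>\<A>. \<gamma> t \<in> cdom C \<longrightarrow>
        ((cmap C \<circ> \<gamma>) has_vector_derivative V C (\<gamma> t)) (at t))"

text \<open>The image of \<open>W\<close> under the time-\<open>t\<close> map of the (possibly incomplete) flow of \<open>V\<close>.\<close>

definition flow_image ::
  "'a::topological_space set \<Rightarrow> ('a, 'n::finite) chart set \<Rightarrow> ('a, 'n) vfield \<Rightarrow>
   real \<Rightarrow> 'a set \<Rightarrow> 'a set" where
  "flow_image M \<A> V t W =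
     {\<gamma> t | \<gamma> I. integral_curve M \<A> V I \<gamma> \<and> 0 \<in> I \<and> t \<in> I \<and> \<gamma> 0 \<in> W}"

text \<open>Using this for \<open>t\<close> and \<open>-t\<close> shows that the flow is defined on \<open>S\<close> for all times.\<close>

definition invariant_set ::
  "'a::topological_space set \<Rightarrow> ('a, 'n::finite) chart set \<Rightarrow> ('a, 'n) vfield \<Rightarrow> 'a set \<Rightarrow> bool" where
  "invariant_set M \<A> V S \<longleftrightarrow> (\<forall>t. flow_image M \<A> V t S = S)"


section \<open>Riemannian geometry in a chart\<close>

definition ginv :: "('a, 'n::finite) tensor2 \<Rightarrow> ('a, 'n) tensor2" where
  "ginv g c p = matrix_inv (g c p)"

definition tr_g ::
  "('a, 'n::finite) tensor2 \<Rightarrow> ('a, 'n) tensor2 \<Rightarrow> ('a, 'n) chart \<Rightarrow> 'a \<Rightarrow> real" where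
  "tr_g g T c p = (\<Sum>i\<in>UNIV. \<Sum>j\<in>UNIV. ginv g c p $ i $ j * T c p $ i $ j)"

definition normsq_g ::
  "('a, 'n::finite) tensor2 \<Rightarrow> ('a, 'n) tensor2 \<Rightarrow> ('a, 'n) chart \<Rightarrow> 'a \<Rightarrow> real" where
  "normsq_g g T c p = (\<Sum>i\<in>UNIV. \<Sum>j\<in>UNIV. \<Sum>k\<in>UNIV. \<Sum>l\<in>UNIV.
     ginv g c p $ i $ k * ginv g c p $ j $ l * T c p $ i $ j * T c p $ k $ l)"

text \<open>\<open>\<Gamma>\<^sup>k\<^sub>i\<^sub>j\<close>\<close>

definition christoffel ::
  "('a, 'n::finite) tensor2 \<Rightarrow> ('a, 'n) chart \<Rightarrow> 'n \<Rightarrow> 'n \<Rightarrow> 'n \<Rightarrow> 'a \<Rightarrow> real" where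
  "christoffel g c k i j p = 1/2 * (\<Sum>l\<in>UNIV. ginv g c p $ k $ l *
     (pd c i (\<lambda>q. g c q $ j $ l) p + pd c j (\<lambda>q. g c q $ i $ l) p - pd c l (\<lambda>q. g c q $ i $ j) p))"

text \<open>\<open>R\<^sup>l\<^sub>k\<^sub>i\<^sub>j\<close>, with the convention
  \<open>R(\<partial>\<^sub>i, \<partial>\<^sub>j) \<partial>\<^sub>k = (\<nabla>\<^sub>i \<nabla>\<^sub>j - \<nabla>\<^sub>j \<nabla>\<^sub>i) \<partial>\<^sub>k = R\<^sup>l\<^sub>k\<^sub>i\<^sub>j \<partial>\<^sub>l\<close>.\<close>

definition riemann ::
  "('a, 'n::finite) tensor2 \<Rightarrow> ('a, 'n) chart \<Rightarrow> 'n \<Rightarrow> 'n \<Rightarrow> 'n \<Rightarrow> 'n \<Rightarrow> 'a \<Rightarrow> real" where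
  "riemann g c l k i j p =
     pd c i (christoffel g c l j k) p - pd c j (christoffel g c l i k) p
     + (\<Sum>m\<in>UNIV. christoffel g c l i m p * christoffel g c m j k p
                - christoffel g c l j m p * christoffel g c m i k p)"

definition scalar_curvature ::
  "('a, 'n::finite) tensor2 \<Rightarrow> ('a, 'n) chart \<Rightarrow> 'a \<Rightarrow> real" where
  "scalar_curvature g c p =
     (\<Sum>j\<in>UNIV. \<Sum>k\<in>UNIV. ginv g c p $ j $ k * (\<Sum>i\<in>UNIV. riemann g c i k i j p))"

text \<open>\<open>\<langle>R(\<partial>\<^sub>1, \<partial>\<^sub>2) \<partial>\<^sub>2, \<partial>\<^sub>1\<rangle> / det h\<close>\<close>

definition gauss_curvature :: "('a, 2) tensor2 \<Rightarrow> ('a, 2) chart \<Rightarrow> 'a \<Rightarrow> real" where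
  "gauss_curvature h c p =
     (\<Sum>l\<in>UNIV. h c p $ 1 $ l * riemann h c l 2 1 2 p) / det (h c p)"

text \<open>\<open>(\<nabla>\<^sub>i T)\<^sub>j\<^sub>l\<close>\<close>

definition cov_deriv2 ::
  "('a, 'n::finite) tensor2 \<Rightarrow> ('a, 'n) tensor2 \<Rightarrow> ('a, 'n) chart \<Rightarrow> 'n \<Rightarrow> 'n \<Rightarrow> 'n \<Rightarrow> 'a \<Rightarrow> real" where
  "cov_deriv2 g T c i j l p = pd c i (\<lambda>q. T c q $ j $ l) p
     - (\<Sum>m\<in>UNIV. christoffel g c m i j p * T c p $ m $ l)
     - (\<Sum>m\<in>UNIV. christoffel g c m i l p * T c p $ j $ m)"

text \<open>The covector \<open>(div T)\<^sub>j = g\<^sup>i\<^sup>k (\<nabla>\<^sub>i T)\<^sub>k\<^sub>j\<close>.\<close>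

definition div_tensor2 ::
  "('a, 'n::finite) tensor2 \<Rightarrow> ('a, 'n) tensor2 \<Rightarrow> ('a, 'n) chart \<Rightarrow> 'a \<Rightarrow> real ^ 'n" where
  "div_tensor2 g T c p =
     (\<chi> j. \<Sum>i\<in>UNIV. \<Sum>k\<in>UNIV. ginv g c p $ i $ k * cov_deriv2 g T c i k j p)"

definition div_vfield ::
  "('a, 'n::finite) tensor2 \<Rightarrow> ('a, 'n) vfield \<Rightarrow> ('a, 'n) chart \<Rightarrow> 'a \<Rightarrow> real" where
  "div_vfield g V c p = (\<Sum>i\<in>UNIV. pd c i (\<lambda>q. V c q $ i) p
     + (\<Sum>j\<in>UNIV. christoffel g c i i j p * V c p $ j))"

definition grad :: "('a, 'n::finite) tensor2 \<Rightarrow> ('a \<Rightarrow> real) \<Rightarrow> ('a, 'n) vfield" where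
  "grad g f c p = ginv g c p *v (\<chi> i. pd c i f p)"

definition laplacian ::
  "('a, 'n::finite) tensor2 \<Rightarrow> ('a \<Rightarrow> real) \<Rightarrow> ('a, 'n) chart \<Rightarrow> 'a \<Rightarrow> real" where
  "laplacian g f c p = div_vfield g (grad g f) c p"

definition normsq_vec ::
  "('a, 'n::finite) tensor2 \<Rightarrow> ('a, 'n) vfield \<Rightarrow> ('a, 'n) chart \<Rightarrow> 'a \<Rightarrow> real" where
  "normsq_vec g V c p = bil (g c p) (V c p) (V c p)"

text \<open>The Riemannian measure: the unique Borel measure on \<open>M\<close> that in every chart is
  \<open>sqrt (det g) dx\<close>.\<close>

definition riemannian_measure ::
  "'a::topological_space set \<Rightarrow> ('a, 'n::finite) chart set \<Rightarrow> ('a, 'n) tensor2 \<Rightarrow> 'a measure" where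
  "riemannian_measure M \<A> g = (THE N. sets N = sets (restrict_space borel M) \<and>
     (\<forall>c\<in>\<A>. \<forall>E\<in>sets N. E \<subseteq> cdom c \<longrightarrow>
        emeasure N E =
          (\<integral>\<^sup>+x\<in>cmap c ` E. ennreal (sqrt (det (g c (cinv c x)))) \<partial>lborel)))"


section \<open>Surfaces in an initial data set\<close>

text \<open>A closed surface is an embedded compact submanifold: since \<open>S\<close> carries the subspace
  topology, it suffices that the inclusion is a smooth immersion.\<close>

definition closed_surface ::
  "'a::{second_countable_topology, t2_space} set \<Rightarrow> ('a, 3) chart set \<Rightarrow>
   'a set \<Rightarrow> ('a, 2) chart set \<Rightarrow> bool" where
  "closed_surface M \<A> S \<B> \<longleftrightarrow> smooth_manifold S \<B> \<and> compact S \<and> S \<subseteq> M \<and>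
     (\<forall>c\<in>\<B>. \<forall>C\<in>\<A>. smooth_in_chart c (cdom C) (cmap C) \<and>
        (\<forall>p\<in>cdom c \<inter> cdom C. inj ((*v) (jac c C p))))"

definition unit_normal ::
  "('a, 3) chart set \<Rightarrow> ('a, 3) tensor2 \<Rightarrow> 'a set \<Rightarrow> ('a, 2) chart set \<Rightarrow> ('a, 3) vfield \<Rightarrow> bool" where
  "unit_normal \<A> g S \<B> \<nu> \<longleftrightarrow> smooth_vfield_along \<B> \<A> S \<nu> \<and>
     (\<forall>C\<in>\<A>. \<forall>p\<in>S \<inter> cdom C. bil (g C p) (\<nu> C p) (\<nu> C p) = 1 \<and>
        (\<forall>c\<in>\<B>. p \<in> cdom c \<longrightarrow> (\<forall>a. bil (g C p) (\<nu> C p) (column a (jac c C p)) = 0)))"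

text \<open>In the following, \<open>chart_at\<close> picks an ambient chart around the given point; the values do
  not depend on that choice.\<close>

definition pullback2 :: "('a, 3) chart set \<Rightarrow> ('a, 3) tensor2 \<Rightarrow> ('a, 2) tensor2" where
  "pullback2 \<A> T c p = (let C = chart_at \<A> p in
     transpose (jac c C p) ** T C p ** jac c C p)"

text \<open>The tangent vector field on the surface that is dual, with respect to the induced metric,
  to the restriction of \<open>T(V, \<cdot>)\<close>.\<close>

definition tangent_dual ::
  "('a, 3) chart set \<Rightarrow> ('a, 3) tensor2 \<Rightarrow> ('a, 3) tensor2 \<Rightarrow> ('a, 3) vfield \<Rightarrow> ('a, 2) vfield" where
  "tangent_dual \<A> g T V c p = (let C = chart_at \<A> p in
     ginv (pullback2 \<A> g) c p *v (\<chi> a. bil (T C p) (V C p) (column a (jac c C p))))"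

text \<open>For \<open>V\<close> tangent to the surface this is \<open>V\<close> itself, in the charts of the surface.\<close>

definition tangent_part ::
  "('a, 3) chart set \<Rightarrow> ('a, 3) tensor2 \<Rightarrow> ('a, 3) vfield \<Rightarrow> ('a, 2) vfield" where
  "tangent_part \<A> g V = tangent_dual \<A> g g V"

definition vec_X ::
  "('a, 3) chart set \<Rightarrow> ('a, 3) tensor2 \<Rightarrow> ('a, 3) tensor2 \<Rightarrow> ('a, 3) vfield \<Rightarrow> ('a, 2) vfield" where
  "vec_X \<A> g K \<nu> = tangent_dual \<A> g K \<nu>"

text \<open>\<open>\<nabla>\<^sub>a \<nu>\<close> in the ambient chart \<open>C\<close>, where \<open>a\<close> is a coordinate direction of the chart \<open>c\<close> of
  the surface.\<close>

definition cov_deriv_along ::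
  "('a, 3) tensor2 \<Rightarrow> ('a, 3) vfield \<Rightarrow> ('a, 2) chart \<Rightarrow> ('a, 3) chart \<Rightarrow> 2 \<Rightarrow> 'a \<Rightarrow> real ^ 3" where
  "cov_deriv_along g \<nu> c C a p = (\<chi> i. pd c a (\<lambda>q. \<nu> C q $ i) p
     + (\<Sum>j\<in>UNIV. \<Sum>k\<in>UNIV. christoffel g C i j k p * jac c C p $ j $ a * \<nu> C p $ k))"

text \<open>\<open>A(v, w) = \<langle>\<nabla>\<^sub>v \<nu>, w\<rangle>\<close>, so that \<open>tr A = div\<^sub>\<Sigma> \<nu>\<close>.\<close>

definition second_ff ::
  "('a, 3) chart set \<Rightarrow> ('a, 3) tensor2 \<Rightarrow> ('a, 3) vfield \<Rightarrow> ('a, 2) tensor2" where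
  "second_ff \<A> g \<nu> c p = (let C = chart_at \<A> p in
     \<chi> a b. bil (g C p) (cov_deriv_along g \<nu> c C a p) (column b (jac c C p)))"

definition chi_plus ::
  "('a, 3) chart set \<Rightarrow> ('a, 3) tensor2 \<Rightarrow> ('a, 3) tensor2 \<Rightarrow> ('a, 3) vfield \<Rightarrow> ('a, 2) tensor2" where
  "chi_plus \<A> g K \<nu> c p = pullback2 \<A> K c p + second_ff \<A> g \<nu> c p"

definition theta_plus ::
  "('a, 3) chart set \<Rightarrow> ('a, 3) tensor2 \<Rightarrow> ('a, 3) tensor2 \<Rightarrow> ('a, 3) vfield \<Rightarrow>
   ('a, 2) chart \<Rightarrow> 'a \<Rightarrow> real" where
  "theta_plus \<A> g K \<nu> = tr_g (pullback2 \<A> g) (chi_plus \<A> g K \<nu>)"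

definition energy_density ::
  "('a, 3) tensor2 \<Rightarrow> ('a, 3) tensor2 \<Rightarrow> ('a, 3) chart \<Rightarrow> 'a \<Rightarrow> real" where
  "energy_density g K C p =
     1/2 * (scalar_curvature g C p - normsq_g g K C p + (tr_g g K C p)\<^sup>2)"

definition momentum_density ::
  "('a, 3) tensor2 \<Rightarrow> ('a, 3) tensor2 \<Rightarrow> ('a, 3) chart \<Rightarrow> 'a \<Rightarrow> real ^ 3" where
  "momentum_density g K = div_tensor2 g (\<lambda>C q. K C q - tr_g g K C q *\<^sub>R g C q)"

definition mots_Q ::
  "('a, 3) chart set \<Rightarrow> ('a, 3) tensor2 \<Rightarrow> ('a, 3) tensor2 \<Rightarrow> ('a, 3) vfield \<Rightarrow>
   ('a, 2) chart \<Rightarrow> 'a \<Rightarrow> real" where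
  "mots_Q \<A> g K \<nu> c p = (let C = chart_at \<A> p; h = pullback2 \<A> g in
     gauss_curvature h c p
     - (energy_density g K C p + momentum_density g K C p \<bullet> \<nu> C p)
     - 1/2 * normsq_g h (chi_plus \<A> g K \<nu>) c p)"

definition stability_operator ::
  "('a, 3) chart set \<Rightarrow> ('a, 3) tensor2 \<Rightarrow> ('a, 3) tensor2 \<Rightarrow> ('a, 2) chart set \<Rightarrow> ('a, 3) vfield \<Rightarrow>
   ('a \<Rightarrow> real) \<Rightarrow> 'a \<Rightarrow> real" where
  "stability_operator \<A> g K \<B> \<nu> \<phi> p =
     (let c = chart_at \<B> p; h = pullback2 \<A> g; X = vec_X \<A> g K \<nu> in
       - laplacian h \<phi> c p + 2 * bil (h c p) (X c p) (grad h \<phi> c p)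
       + (mots_Q \<A> g K \<nu> c p - normsq_vec h X c p + div_vfield h X c p) * \<phi> p)"

definition mots ::
  "('a::{second_countable_topology, t2_space}) set \<Rightarrow> ('a, 3) chart set \<Rightarrow>
   ('a, 3) tensor2 \<Rightarrow> ('a, 3) tensor2 \<Rightarrow> 'a set \<Rightarrow> ('a, 2) chart set \<Rightarrow> ('a, 3) vfield \<Rightarrow> bool" where
  "mots M \<A> g K S \<B> \<nu> \<longleftrightarrow> closed_surface M \<A> S \<B> \<and> unit_normal \<A> g S \<B> \<nu> \<and>
     (\<forall>c\<in>\<B>. \<forall>p\<in>cdom c. theta_plus \<A> g K \<nu> c p = 0)"


section \<open>Principal eigenvalue and stability\<close>

definition complexify :: "(('a \<Rightarrow> real) \<Rightarrow> 'a \<Rightarrow> real) \<Rightarrow> ('a \<Rightarrow> complex) \<Rightarrow> 'a \<Rightarrow> complex" where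
  "complexify L u p = Complex (L (\<lambda>q. Re (u q)) p) (L (\<lambda>q. Im (u q)) p)"

definition eigenspace ::
  "'a set \<Rightarrow> ('a, 'n::finite) chart set \<Rightarrow> (('a \<Rightarrow> real) \<Rightarrow> 'a \<Rightarrow> real) \<Rightarrow> complex \<Rightarrow>
   ('a \<Rightarrow> complex) set" where
  "eigenspace S \<B> L z = {u. smooth_fun \<B> u \<and> (\<forall>p\<in>S. complexify L u p = z * u p)}"

definition eigenvalue ::
  "'a set \<Rightarrow> ('a, 'n::finite) chart set \<Rightarrow> (('a \<Rightarrow> real) \<Rightarrow> 'a \<Rightarrow> real) \<Rightarrow> complex \<Rightarrow> bool" where
  "eigenvalue S \<B> L z \<longleftrightarrow> (\<exists>u\<in>eigenspace S \<B> L z. \<exists>p\<in>S. u p \<noteq> 0)"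

text \<open>The real eigenvalue with \<open>\<mu> \<le> Re z\<close> for all eigenvalues \<open>z\<close>, whose eigenspace is
  one-dimensional (as a space of functions on \<open>S\<close>) and spanned by a positive function. The first
  two clauses determine \<open>\<mu>\<close>; for the stability operator of a closed surface such a \<open>\<mu>\<close>
  always exists.\<close>

definition principal_eigenvalue ::
  "'a set \<Rightarrow> ('a, 'n::finite) chart set \<Rightarrow> (('a \<Rightarrow> real) \<Rightarrow> 'a \<Rightarrow> real) \<Rightarrow> real \<Rightarrow> bool" where
  "principal_eigenvalue S \<B> L \<mu> \<longleftrightarrow> eigenvalue S \<B> L (of_real \<mu>) \<and>
     (\<forall>z. eigenvalue S \<B> L z \<longrightarrow> \<mu> \<le> Re z) \<and>
     (\<exists>\<phi>::'a \<Rightarrow> real. smooth_fun \<B> \<phi> \<and> (\<forall>p\<in>S. \<phi> p > 0) \<and>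
        (\<lambda>p. of_real (\<phi> p)) \<in> eigenspace S \<B> L (of_real \<mu>) \<and>
        (\<forall>u\<in>eigenspace S \<B> L (of_real \<mu>). \<exists>z. \<forall>p\<in>S. u p = z * of_real (\<phi> p)))"

definition stable_mots ::
  "('a::{second_countable_topology, t2_space}) set \<Rightarrow> ('a, 3) chart set \<Rightarrow>
   ('a, 3) tensor2 \<Rightarrow> ('a, 3) tensor2 \<Rightarrow> 'a set \<Rightarrow> ('a, 2) chart set \<Rightarrow> ('a, 3) vfield \<Rightarrow> bool" where
  "stable_mots M \<A> g K S \<B> \<nu> \<longleftrightarrow> mots M \<A> g K S \<B> \<nu> \<and>
     (\<exists>\<mu>\<ge>0. principal_eigenvalue S \<B> (stability_operator \<A> g K \<B> \<nu>) \<mu>)"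


section \<open>Quantities in the integral inequality\<close>

text \<open>The projection of \<open>X\<close> onto \<open>\<xi>\<close>.\<close>

definition proj_vec ::
  "('a, 'n::finite) tensor2 \<Rightarrow> ('a, 'n) vfield \<Rightarrow> ('a, 'n) vfield \<Rightarrow> ('a, 'n) vfield" where
  "proj_vec h \<xi> X c p =
     (bil (h c p) (X c p) (\<xi> c p) / bil (h c p) (\<xi> c p) (\<xi> c p)) *\<^sub>R \<xi> c p"

end

theory Submission
  imports Defs
begin

text \<open>Let \<open>\<phi> > 0\<close> be a principal eigenfunction, \<open>L \<phi> = \<mu> \<phi>\<close> with \<open>\<mu> \<ge> 0\<close>, and put \<open>u = ln \<phi>\<close> and
  \<open>Y = X - \<nabla>u\<close>. Dividing the eigenvalue equation by \<open>\<phi>\<close> and completing the square gives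
  \<open>Q = \<mu> - div Y + |Y|\<^sup>2\<close> (lemma \<open>riccati_identity\<close>). Multiplication by \<open>f\<^sup>2\<close> then yields

    \<open>|\<nabla>f|\<^sup>2 + Q f\<^sup>2 = \<mu> f\<^sup>2 - div (f\<^sup>2 Y) + |\<nabla>f + f Y|\<^sup>2\<close>.

  Since \<open>Y\<close> and \<open>f\<close> are smooth, this also shows that the integrand on the left is continuous.

  Let \<open>\<xi>\<close> be the restriction of \<open>\<eta>\<close> to the surface. Since \<open>\<nabla>f\<close> is orthogonal to \<open>\<xi>\<close>, the inner
  product of \<open>\<nabla>f + f Y\<close> with \<open>\<xi>\<close> is \<open>f (\<langle>X, \<xi>\<rangle> - \<xi>(u))\<close>, and the Cauchy--Schwarz inequality gives,
  for every \<open>\<epsilon> > 0\<close>,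

    \<open>|\<nabla>f + f Y|\<^sup>2 \<ge> f\<^sup>2 \<langle>X, \<xi>\<rangle>\<^sup>2 / (|\<xi>|\<^sup>2 + \<epsilon>) - 2 w \<xi>(u)\<close>,  where  \<open>w = f\<^sup>2 \<langle>X, \<xi>\<rangle> / (|\<xi>|\<^sup>2 + \<epsilon>)\<close>.

  The weight \<open>w\<close> is constant along \<open>\<xi>\<close>, and \<open>\<xi>\<close> is divergence free, so \<open>2 w \<xi>(u) = div (2 w u \<xi>)\<close>.
  Thus the unknown derivative \<open>\<xi>(u)\<close> disappears on integration (lemma
  \<open>integral_inequality_regularized\<close>), and \<open>\<epsilon> \<longlongrightarrow> 0\<close> gives the claim (lemma \<open>integral_inequality\<close>).

  The symmetry enters through four facts. The field \<open>\<eta>\<close> is tangent to the surface, because an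
  integral curve through a point of the surface stays in it (lemma \<open>invariant_set_tangent\<close>). Its
  restriction \<open>\<xi>\<close> is a Killing field of the induced metric and therefore divergence free (lemma
  \<open>div_\<xi>\<close>). The unit normal \<open>\<nu>\<close> commutes with \<open>\<eta>\<close> (lemma \<open>\<nu>_commutes\<close>). Hence
  \<open>\<langle>X, \<xi>\<rangle> = K(\<nu>, \<eta>)\<close> and \<open>|\<xi>|\<^sup>2 = g(\<eta>, \<eta>)\<close> are invariant, as contractions of invariant tensors
  with fields that commute with \<open>\<eta>\<close> (lemma \<open>lie_fun_invariant_bil\<close>).

  The analysis behind this is the divergence theorem on a closed surface, and before it the fact
  that the chart densities \<open>sqrt (det h)\<close> glue to a unique measure.\<close>

section \<open>Calculus of k times continuously differentiable maps\<close>

lemma has_derivative_cong_open: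
  assumes "(f has_derivative D) (at x)" "open U" "x \<in> U" "\<And>y. y \<in> U \<Longrightarrow> f y = g y"
  shows "(g has_derivative D) (at x)"
  using has_derivative_transform_within_open[of f D x UNIV U g] assms by auto

lemma Ck_on_cong:
  assumes "open U" "\<And>x. x \<in> U \<Longrightarrow> f x = g x" "Ck_on k U f"
  shows "Ck_on k U g"
  using assms(2,3)
proof (induction k arbitrary: f g)
  case 0
  then show ?case using continuous_on_cong[of U U f g] by simp
next
  case (Suc k)
  have D: "(g has_derivative frechet_derivative f (at x)) (at x)" if "x \<in> U" for x
    using has_derivative_cong_open[of f _ x U g] Suc.prems that assms(1)
    by (simp add: frechet_derivative_works)
  then have eq: "frechet_derivative f (at x) v = frechet_derivative g (at x) v" if "x \<in> U" for x v
    by (simp add: frechet_derivative_at[OF D[OF that]])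
  have "Ck_on k U (\<lambda>x. frechet_derivative g (at x) v)" for v
    using Suc.IH[of "\<lambda>x. frechet_derivative f (at x) v"] eq Suc.prems(2) by auto
  then show ?case using D by (auto simp: differentiable_def)
qed

lemma Ck_on_SucI:
  assumes "open U" "\<And>x. x \<in> U \<Longrightarrow> (f has_derivative f' x) (at x)" "\<And>v. Ck_on k U (\<lambda>x. f' x v)"
  shows "Ck_on (Suc k) U f"
proof -
  have "Ck_on k U (\<lambda>x. frechet_derivative f (at x) v)" for v
    by (rule Ck_on_cong[OF assms(1) _ assms(3)[of v]]) (simp add: frechet_derivative_at[OF assms(2)])
  then show ?thesis using assms(2) by (auto simp: differentiable_def)
qed

lemma Ck_on_has_derivative:
  "Ck_on (Suc k) U f \<Longrightarrow> x \<in> U \<Longrightarrow> (f has_derivative frechet_derivative f (at x)) (at x)"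
  by (simp add: frechet_derivative_works)

lemma Ck_on_SucD: "Ck_on (Suc k) U f \<Longrightarrow> Ck_on k U f"
proof (induction k arbitrary: f)
  case 0
  then show ?case
    by (auto intro!: continuous_at_imp_continuous_on differentiable_imp_continuous_within)
next
  case (Suc k)
  then show ?case by (metis Ck_on.simps(2))
qed

lemma Ck_on_mono: "Ck_on k U f \<Longrightarrow> j \<le> k \<Longrightarrow> Ck_on j U f"
  by (induction k) (auto simp: le_Suc_eq dest: Ck_on_SucD simp del: Ck_on.simps)

lemma Ck_on_imp_continuous_on: "Ck_on k U f \<Longrightarrow> continuous_on U f"
  using Ck_on_mono[of k U f 0] by simp

lemma Ck_on_local:
  assumes "\<And>x. x \<in> U \<Longrightarrow> \<exists>V. open V \<and> x \<in> V \<and> Ck_on k V f"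
  shows "Ck_on k U f"
  using assms
proof (induction k arbitrary: f)
  case 0
  have "isCont f x" if x: "x \<in> U" for x
  proof -
    obtain V where "open V" "x \<in> V" "continuous_on V f" using 0[OF x] by auto
    then show ?thesis by (simp add: continuous_on_eq_continuous_at)
  qed
  then show ?case unfolding Ck_on.simps by (intro continuous_at_imp_continuous_on ballI)
next
  case (Suc k)
  have "f differentiable (at x)" if "x \<in> U" for x
    using Suc.prems[OF that] by auto
  moreover have "Ck_on k U (\<lambda>x. frechet_derivative f (at x) v)" for v
    by (rule Suc.IH) (use Suc.prems in fastforce)
  ultimately show ?case by simp
qed

lemma Ck_on_const: "Ck_on k U (\<lambda>x. c)"
proof (induction k arbitrary: c)
  case (Suc k)
  have "frechet_derivative (\<lambda>x. c) (at x) = (\<lambda>_. 0)" for x :: 'a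
    by (simp add: frechet_derivative_const)
  with Suc show ?case by simp
qed simp

lemma Ck_on_bounded_linear:
  assumes "bounded_linear f" shows "Ck_on k U f"
proof (cases k)
  case 0
  then show ?thesis using assms by (simp add: linear_continuous_on)
next
  case (Suc n)
  have "(f has_derivative f) (at x)" for x using assms by (rule bounded_linear_imp_has_derivative)
  then have "frechet_derivative f (at x) = f" "f differentiable (at x)" for x
    by (simp_all add: frechet_derivative_at[symmetric] differentiable_def) blast
  then show ?thesis using Suc by (simp add: Ck_on_const)
qed

lemma Ck_on_bounded_linear_comp:
  assumes "bounded_linear l" "open U" "Ck_on k U f"
  shows "Ck_on k U (\<lambda>x. l (f x))"
  using assms(3)
proof (induction k arbitrary: f)
  case 0
  then show ?case
    by (auto intro: bounded_linear.continuous_on[OF assms(1)])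
next
  case (Suc k)
  show ?case
  proof (rule Ck_on_SucI[OF assms(2)])
    show "((\<lambda>x. l (f x)) has_derivative (\<lambda>v. l (frechet_derivative f (at x) v))) (at x)" if "x \<in> U" for x
      by (rule bounded_linear.has_derivative[OF assms(1) Ck_on_has_derivative[OF Suc.prems that]])
  qed (use Suc in auto)
qed

lemma Ck_on_add:
  assumes "open U" "Ck_on k U f" "Ck_on k U g"
  shows "Ck_on k U (\<lambda>x. f x + g x)"
  using assms(2,3)
proof (induction k arbitrary: f g)
  case 0
  then show ?case by (auto intro: continuous_on_add)
next
  case (Suc k)
  show ?case
    by (rule Ck_on_SucI[OF assms(1) has_derivative_add[OF Ck_on_has_derivative Ck_on_has_derivative]])
      (use Suc in \<open>auto\<close>)
qed

lemma Ck_on_bilinear: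
  assumes "bounded_bilinear pr" "open U" "Ck_on k U f" "Ck_on k U g"
  shows "Ck_on k U (\<lambda>x. pr (f x) (g x))"
  using assms(3,4)
proof (induction k arbitrary: f g)
  case 0
  then show ?case by (auto intro: bounded_bilinear.continuous_on[OF assms(1)])
next
  case (Suc k)
  show ?case
  proof (rule Ck_on_SucI[OF assms(2)
        bounded_bilinear.FDERIV[OF assms(1) Ck_on_has_derivative Ck_on_has_derivative]])
    fix v
    have "Ck_on k U f" "Ck_on k U g" using Suc.prems by (auto dest: Ck_on_SucD simp del: Ck_on.simps)
    with Suc show "Ck_on k U (\<lambda>x. pr (f x) (frechet_derivative g (at x) v) +
        pr (frechet_derivative f (at x) v) (g x))"
      by (intro Ck_on_add[OF assms(2)] Suc.IH) auto
  qed (use Suc in auto)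
qed

lemmas Ck_on_mult = Ck_on_bilinear[OF bounded_bilinear_mult]
lemmas Ck_on_scaleR = Ck_on_bilinear[OF bounded_bilinear_scaleR]

lemma Ck_on_diff:
  assumes "open U" "Ck_on k U f" "Ck_on k U g"
  shows "Ck_on k U (\<lambda>x. f x - g x)"
  using Ck_on_add[OF assms(1,2) Ck_on_bounded_linear_comp[OF bounded_linear_minus[OF bounded_linear_ident] assms(1,3)]]
  by simp

lemma Ck_on_sum:
  assumes "open U" "\<And>i. i \<in> I \<Longrightarrow> Ck_on k U (f i)"
  shows "Ck_on k U (\<lambda>x. \<Sum>i\<in>I. f i x)"
  using assms(2) by (induction I rule: infinite_finite_induct) (auto intro: Ck_on_const Ck_on_add[OF assms(1)])

lemma bounded_linear_axis: "bounded_linear (axis i :: 'v::real_normed_vector \<Rightarrow> 'v ^ 'n)"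
proof (rule bounded_linear_intro[of _ 1])
  fix x :: 'v
  have "norm (axis i x :: 'v ^ 'n) \<le> (\<Sum>j\<in>UNIV. norm ((axis i x :: 'v ^ 'n) $ j))"
    unfolding norm_vec_def by (rule L2_set_le_sum) simp
  also have "\<dots> = norm x"
    by (simp add: axis_def if_distrib[of norm] cong: if_cong)
  finally show "norm (axis i x :: 'v ^ 'n) \<le> norm x * 1" by simp
qed (auto simp: vec_eq_iff axis_def)

lemma Ck_on_vec_iff:
  fixes f :: "'b::euclidean_space \<Rightarrow> 'v::real_normed_vector ^ 'n"
  assumes "open U"
  shows "Ck_on k U f \<longleftrightarrow> (\<forall>i. Ck_on k U (\<lambda>x. f x $ i))"
proof
  assume "\<forall>i. Ck_on k U (\<lambda>x. f x $ i)"
  then have "Ck_on k U (\<lambda>x. \<Sum>i\<in>UNIV. axis i (f x $ i))"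
    by (intro Ck_on_sum[OF assms] Ck_on_bounded_linear_comp[OF bounded_linear_axis assms]) auto
  moreover have "(\<Sum>i\<in>UNIV. axis i (f x $ i)) = f x" for x
    by (simp add: vec_eq_iff axis_def if_distrib cong: if_cong)
  ultimately show "Ck_on k U f" by simp
qed (auto intro: Ck_on_bounded_linear_comp[OF bounded_linear_vec_nth assms])

lemma Ck_on_comp:
  fixes G :: "'b::euclidean_space \<Rightarrow> 'c::euclidean_space" and f :: "'c \<Rightarrow> 'd::real_normed_vector"
  assumes "open U" "Ck_on k U G" "Ck_on k V f" "G ` U \<subseteq> V"
  shows "Ck_on k U (\<lambda>x. f (G x))"
  using assms(2,3)
proof (induction k arbitrary: f)
  case 0
  then show ?case using assms(4) by (auto intro: continuous_on_compose2)
next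
  case (Suc k)
  let ?G' = "\<lambda>x. frechet_derivative G (at x)"
  let ?f' = "\<lambda>y. frechet_derivative f (at y)"
  show ?case
  proof (rule Ck_on_SucI[OF assms(1)])
    fix x assume x: "x \<in> U"
    then have f': "(f has_derivative ?f' (G x)) (at (G x))"
      using Suc.prems(2) assms(4) by (intro Ck_on_has_derivative) auto
    have D: "((\<lambda>x. f (G x)) has_derivative (\<lambda>v. ?f' (G x) (?G' x v))) (at x)"
      by (rule has_derivative_compose[OF Ck_on_has_derivative[OF Suc.prems(1) x] f'])
    have eq: "?f' (G x) w = (\<Sum>b\<in>Basis. (w \<bullet> b) *\<^sub>R ?f' (G x) b)" for w
      using linear_sum[OF has_derivative_linear[OF f'], of "\<lambda>b. (w \<bullet> b) *\<^sub>R b" Basis]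
      by (simp add: euclidean_representation linear_scale[OF has_derivative_linear[OF f']])
    show "((\<lambda>x. f (G x)) has_derivative
        (\<lambda>v. \<Sum>b\<in>Basis. (?G' x v \<bullet> b) *\<^sub>R ?f' (G x) b)) (at x)"
      by (rule has_derivative_eq_rhs[OF D]) (rule ext, rule eq)
  next
    fix v
    have "Ck_on k U (\<lambda>x. ?f' (G x) b)" for b
      using Suc.IH[of "\<lambda>y. ?f' y b"] Ck_on_SucD[OF Suc.prems(1)] Suc.prems(2) by simp
    moreover have "Ck_on k U (\<lambda>x. ?G' x v \<bullet> b)" for b
      using Suc.prems(1) by (intro Ck_on_bounded_linear_comp[OF bounded_linear_inner_left assms(1)]) auto
    ultimately show "Ck_on k U (\<lambda>x. \<Sum>b\<in>Basis. (?G' x v \<bullet> b) *\<^sub>R ?f' (G x) b)"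
      by (intro Ck_on_sum Ck_on_scaleR assms(1))
  qed
qed

lemma Ck_on_inverse:
  fixes f :: "'b::euclidean_space \<Rightarrow> real"
  assumes "open U" "Ck_on k U f" "\<And>x. x \<in> U \<Longrightarrow> f x \<noteq> 0"
  shows "Ck_on k U (\<lambda>x. inverse (f x))"
  using assms(2)
proof (induction k)
  case 0
  then show ?case using assms(3) by (auto intro: continuous_on_inverse)
next
  case (Suc k)
  show ?case
  proof (rule Ck_on_SucI[OF assms(1) Deriv.has_derivative_inverse[OF _ Ck_on_has_derivative[OF Suc.prems]]])
    fix v
    have *: "Ck_on k U (\<lambda>x. inverse (f x))" using Suc Ck_on_SucD by blast
    have "Ck_on k U (\<lambda>x. (inverse (f x) * frechet_derivative f (at x) v) * inverse (f x))"
      using Suc.prems by (intro Ck_on_mult assms(1) *) auto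
    from Ck_on_bounded_linear_comp[OF bounded_linear_minus[OF bounded_linear_ident] assms(1) this]
    show "Ck_on k U (\<lambda>x. - (inverse (f x) * frechet_derivative f (at x) v * inverse (f x)))"
      by simp
  qed (use assms(3) in auto)
qed

lemma Ck_on_divide:
  fixes f g :: "'b::euclidean_space \<Rightarrow> real"
  assumes "open U" "Ck_on k U f" "Ck_on k U g" "\<And>x. x \<in> U \<Longrightarrow> g x \<noteq> 0"
  shows "Ck_on k U (\<lambda>x. f x / g x)"
  unfolding divide_inverse using assms by (intro Ck_on_mult Ck_on_inverse)

lemma Ck_on_ln:
  fixes f :: "'b::euclidean_space \<Rightarrow> real"
  assumes "open U" "Ck_on k U f" "\<And>x. x \<in> U \<Longrightarrow> f x > 0"
  shows "Ck_on k U (\<lambda>x. ln (f x))"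
proof (cases k)
  case 0
  then show ?thesis using assms by (auto intro!: continuous_on_ln simp: less_imp_neq[symmetric])
next
  case (Suc n)
  show ?thesis unfolding Suc
  proof (rule Ck_on_SucI[OF assms(1)])
    fix x assume "x \<in> U"
    then show "((\<lambda>x. ln (f x)) has_derivative (\<lambda>v. frechet_derivative f (at x) v * inverse (f x))) (at x)"
      using assms Suc by (auto intro!: derivative_eq_intros Ck_on_has_derivative[of n U]
          simp: field_simps simp del: Ck_on.simps)
  next
    fix v
    have "Ck_on n U (\<lambda>x. inverse (f x))" using assms Suc
      by (intro Ck_on_inverse) (auto dest: Ck_on_SucD simp del: Ck_on.simps simp: less_imp_neq[symmetric])
    then show "Ck_on n U (\<lambda>x. frechet_derivative f (at x) v * inverse (f x))"
      using assms Suc by (intro Ck_on_mult) auto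
  qed
qed

lemma Ck_on_sqrt:
  fixes f :: "'b::euclidean_space \<Rightarrow> real"
  assumes "open U" "Ck_on k U f" "\<And>x. x \<in> U \<Longrightarrow> f x > 0"
  shows "Ck_on k U (\<lambda>x. sqrt (f x))"
  using assms(2)
proof (induction k)
  case 0
  then show ?case by (auto intro: continuous_on_real_sqrt)
next
  case (Suc k)
  show ?case
  proof (rule Ck_on_SucI[OF assms(1)])
    fix x assume "x \<in> U"
    then show "((\<lambda>x. sqrt (f x)) has_derivative
        (\<lambda>v. frechet_derivative f (at x) v * inverse (2 * sqrt (f x)))) (at x)"
      using assms(3) Suc.prems by (auto intro!: derivative_eq_intros Ck_on_has_derivative[of k U]
          simp: field_simps simp del: Ck_on.simps)
  next
    fix v
    have "Ck_on k U (\<lambda>x. sqrt (f x))" using Suc Ck_on_SucD by blast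
    then have "Ck_on k U (\<lambda>x. inverse (2 * sqrt (f x)))"
      using assms(3) by (intro Ck_on_inverse Ck_on_mult Ck_on_const assms(1)) (auto simp: less_imp_neq[symmetric])
    then show "Ck_on k U (\<lambda>x. frechet_derivative f (at x) v * inverse (2 * sqrt (f x)))"
      using Suc.prems by (intro Ck_on_mult assms(1)) auto
  qed
qed

text \<open>The second difference of \<open>f\<close> over a small parallelogram is, by the mean value theorem
  applied once in each direction, a value of either iterated derivative near \<open>x\<close> times the
  area; letting the parallelogram shrink identifies the two by continuity.\<close>

lemma second_difference_mean_value:
  fixes f :: "'b::euclidean_space \<Rightarrow> real"
  assumes f: "Ck_on 2 U f" and s: "s > 0"
    and sub: "\<And>a b. 0 \<le> a \<Longrightarrow> a \<le> s \<Longrightarrow> 0 \<le> b \<Longrightarrow> b \<le> s \<Longrightarrow> x + a *\<^sub>R v + b *\<^sub>R w \<in> U"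
  shows "\<exists>a b. 0 \<le> a \<and> a \<le> s \<and> 0 \<le> b \<and> b \<le> s \<and>
     f (x + s *\<^sub>R v + s *\<^sub>R w) - f (x + s *\<^sub>R v) - f (x + s *\<^sub>R w) + f x =
     s * s * frechet_derivative (\<lambda>y. frechet_derivative f (at y) v) (at (x + a *\<^sub>R v + b *\<^sub>R w)) w"
proof -
  let ?f' = "\<lambda>y. frechet_derivative f (at y)"
  let ?f'' = "\<lambda>y. frechet_derivative (\<lambda>y. frechet_derivative f (at y) v) (at y)"
  have f1: "Ck_on (Suc 1) U f" and f2: "Ck_on (Suc 0) U (\<lambda>y. ?f' y v)"
    using f by (auto simp: numeral_2_eq_2)
  have d: "((\<lambda>a. f (x + a *\<^sub>R v + b *\<^sub>R w)) has_real_derivative ?f' (x + a *\<^sub>R v + b *\<^sub>R w) v) (at a)"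
    if "0 \<le> a" "a \<le> s" "0 \<le> b" "b \<le> s" for a b
    unfolding has_real_derivative_iff_has_vector_derivative has_vector_derivative_def
  proof (rule has_derivative_eq_rhs)
    show "((\<lambda>a. f (x + a *\<^sub>R v + b *\<^sub>R w)) has_derivative
        (\<lambda>t. ?f' (x + a *\<^sub>R v + b *\<^sub>R w) (t *\<^sub>R v))) (at a)"
      by (rule has_derivative_compose[of "\<lambda>a. x + a *\<^sub>R v + b *\<^sub>R w" _ a UNIV f, OF _ Ck_on_has_derivative[OF f1 sub[OF that]]])
        (auto intro!: derivative_eq_intros)
  qed (simp add: linear_scale[OF has_derivative_linear[OF Ck_on_has_derivative[OF f1 sub[OF that]]]])
  have d2: "((\<lambda>b. ?f' (x + a *\<^sub>R v + b *\<^sub>R w) v) has_real_derivative ?f'' (x + a *\<^sub>R v + b *\<^sub>R w) w) (at b)"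
    if "0 \<le> a" "a \<le> s" "0 \<le> b" "b \<le> s" for a b
    unfolding has_real_derivative_iff_has_vector_derivative has_vector_derivative_def
  proof (rule has_derivative_eq_rhs)
    show "((\<lambda>b. ?f' (x + a *\<^sub>R v + b *\<^sub>R w) v) has_derivative
        (\<lambda>t. ?f'' (x + a *\<^sub>R v + b *\<^sub>R w) (t *\<^sub>R w))) (at b)"
      by (rule has_derivative_compose[of "\<lambda>b. x + a *\<^sub>R v + b *\<^sub>R w" _ b UNIV "\<lambda>y. ?f' y v",
            OF _ Ck_on_has_derivative[OF f2 sub[OF that]]])
        (auto intro!: derivative_eq_intros)
  qed (simp add: linear_scale[OF has_derivative_linear[OF Ck_on_has_derivative[OF f2 sub[OF that]]]])
  have "\<exists>a. 0 < a \<and> a < s \<and>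
     (f (x + s *\<^sub>R v + s *\<^sub>R w) - f (x + s *\<^sub>R v + 0 *\<^sub>R w)) - (f (x + 0 *\<^sub>R v + s *\<^sub>R w) - f (x + 0 *\<^sub>R v + 0 *\<^sub>R w)) =
       (s - 0) * (?f' (x + a *\<^sub>R v + s *\<^sub>R w) v - ?f' (x + a *\<^sub>R v + 0 *\<^sub>R w) v)"
    using s by (intro MVT2 derivative_intros d) auto
  then obtain a where a: "0 < a" "a < s" "f (x + s *\<^sub>R v + s *\<^sub>R w) - f (x + s *\<^sub>R v) - f (x + s *\<^sub>R w) + f x =
       s * (?f' (x + a *\<^sub>R v + s *\<^sub>R w) v - ?f' (x + a *\<^sub>R v + 0 *\<^sub>R w) v)"
    by (auto simp: algebra_simps)
  have "\<exists>b. 0 < b \<and> b < s \<and>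
     ?f' (x + a *\<^sub>R v + s *\<^sub>R w) v - ?f' (x + a *\<^sub>R v + 0 *\<^sub>R w) v = (s - 0) * ?f'' (x + a *\<^sub>R v + b *\<^sub>R w) w"
    using s a by (intro MVT2 d2) auto
  then obtain b where "0 < b" "b < s"
     "?f' (x + a *\<^sub>R v + s *\<^sub>R w) v - ?f' (x + a *\<^sub>R v + 0 *\<^sub>R w) v = s * ?f'' (x + a *\<^sub>R v + b *\<^sub>R w) w" by auto
  with a show ?thesis by (intro exI[of _ a] exI[of _ b]) auto
qed

lemma Ck_on_2_symmetric_real:
  fixes f :: "'b::euclidean_space \<Rightarrow> real"
  assumes U: "open U" and f: "Ck_on 2 U f" and x: "x \<in> U"
  shows "frechet_derivative (\<lambda>y. frechet_derivative f (at y) v) (at x) w =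
    frechet_derivative (\<lambda>y. frechet_derivative f (at y) w) (at x) v"
proof (rule ccontr)
  let ?D = "\<lambda>v w y. frechet_derivative (\<lambda>y. frechet_derivative f (at y) v) (at y) w"
  assume "?D v w x \<noteq> ?D w v x"
  then have e: "dist (?D v w x) (?D w v x) / 2 > 0" (is "?e > 0") by simp
  have close: False if "A = B" "dist A P < dist P Q / 2" "dist B Q < dist P Q / 2" for A B P Q :: real
    using that by (simp add: dist_real_def abs_if split: if_splits)
  have cont: "continuous_on U (?D v w)" for v w
    using f by (auto simp: numeral_2_eq_2)
  have "\<exists>r>0. \<forall>y. dist y x < r \<longrightarrow> y \<in> U \<and> dist (?D v w y) (?D v w x) < ?e" for v w
  proof -
    have "isCont (?D v w) x"
      using cont[of v w] U x by (simp add: continuous_on_eq_continuous_at)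
    then obtain r where "r > 0" "\<forall>y. dist y x < r \<longrightarrow> dist (?D v w y) (?D v w x) < ?e"
      using e unfolding continuous_at_eps_delta by blast
    moreover obtain r' where "r' > 0" "\<forall>y. dist y x < r' \<longrightarrow> y \<in> U"
      using U x unfolding open_dist by blast
    ultimately show ?thesis by (intro exI[of _ "min r r'"]) auto
  qed
  then obtain r1 r2 where r: "r1 > 0" "r2 > 0"
    and r1: "\<And>y. dist y x < r1 \<Longrightarrow> y \<in> U \<and> dist (?D v w y) (?D v w x) < ?e"
    and r2: "\<And>y. dist y x < r2 \<Longrightarrow> y \<in> U \<and> dist (?D w v y) (?D w v x) < ?e" by metis
  \<comment> \<open>The parallelogram with sides \<open>s v\<close> and \<open>s w\<close> at \<open>x\<close> lies in the ball of radius \<open>min r1 r2\<close>.\<close>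
  define s where "s = min r1 r2 / (2 * (norm v + norm w + 1))"
  have s: "s > 0" using r by (auto simp: s_def intro!: divide_pos_pos add_nonneg_pos)
  have near: "dist (x + a *\<^sub>R v + b *\<^sub>R w) x < min r1 r2"
    if "0 \<le> a" "a \<le> s" "0 \<le> b" "b \<le> s" for a b
  proof -
    have "dist (x + a *\<^sub>R v + b *\<^sub>R w) x \<le> a * norm v + b * norm w"
      using norm_triangle_ineq[of "a *\<^sub>R v" "b *\<^sub>R w"] that by (simp add: dist_norm)
    also have "\<dots> \<le> s * norm v + s * norm w" using that by (intro add_mono mult_right_mono) auto
    also have "\<dots> < s * (2 * (norm v + norm w + 1))" using s by (simp add: algebra_simps add_strict_increasing2)
    also have "\<dots> = min r1 r2"
      using add_nonneg_pos[OF add_nonneg_nonneg[OF norm_ge_zero[of v] norm_ge_zero[of w]] zero_less_one]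
      unfolding s_def by simp
    finally show ?thesis .
  qed
  have inU: "x + a *\<^sub>R v + b *\<^sub>R w \<in> U" if "0 \<le> a" "a \<le> s" "0 \<le> b" "b \<le> s" for a b
    using r1 near[OF that] by simp
  then have inU': "x + b *\<^sub>R w + a *\<^sub>R v \<in> U" if "0 \<le> b" "b \<le> s" "0 \<le> a" "a \<le> s" for a b
    using that by (simp add: add.commute add.left_commute)
  obtain a b where 1: "0 \<le> a" "a \<le> s" "0 \<le> b" "b \<le> s"
     "f (x + s *\<^sub>R v + s *\<^sub>R w) - f (x + s *\<^sub>R v) - f (x + s *\<^sub>R w) + f x = s * s * ?D v w (x + a *\<^sub>R v + b *\<^sub>R w)"
    using second_difference_mean_value[OF f s inU] by blast
  obtain a' b' where 2: "0 \<le> a'" "a' \<le> s" "0 \<le> b'" "b' \<le> s"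
     "f (x + s *\<^sub>R w + s *\<^sub>R v) - f (x + s *\<^sub>R w) - f (x + s *\<^sub>R v) + f x = s * s * ?D w v (x + a' *\<^sub>R w + b' *\<^sub>R v)"
    using second_difference_mean_value[OF f s inU'] by blast
  have "?D v w (x + a *\<^sub>R v + b *\<^sub>R w) = ?D w v (x + a' *\<^sub>R w + b' *\<^sub>R v)"
  proof -
    have eq: "x + s *\<^sub>R w + s *\<^sub>R v = x + s *\<^sub>R v + s *\<^sub>R w" by (simp add: add.assoc add.commute)
    have "s * s * ?D v w (x + a *\<^sub>R v + b *\<^sub>R w) = s * s * ?D w v (x + a' *\<^sub>R w + b' *\<^sub>R v)"
      unfolding 1(5)[symmetric] 2(5)[symmetric] eq by linarith
    then show ?thesis using s by simp
  qed
  moreover have "dist (?D v w (x + a *\<^sub>R v + b *\<^sub>R w)) (?D v w x) < ?e"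
  proof -
    from near[OF 1(1-4)] have "dist (x + a *\<^sub>R v + b *\<^sub>R w) x < r1" by simp
    from r1[OF this] show ?thesis by blast
  qed
  moreover have "dist (?D w v (x + a' *\<^sub>R w + b' *\<^sub>R v)) (?D w v x) < ?e"
  proof -
    have "x + b' *\<^sub>R v + a' *\<^sub>R w = x + a' *\<^sub>R w + b' *\<^sub>R v" by (simp only: ac_simps)
    with near[OF 2(3,4,1,2)] have "dist (x + a' *\<^sub>R w + b' *\<^sub>R v) x < r2" by simp
    from r2[OF this] show ?thesis by blast
  qed
  ultimately show False by (rule close)
qed

section \<open>Charts, coordinate derivatives and the chain rule\<close>

lemma cinv_cmap: "is_chart S c \<Longrightarrow> p \<in> cdom c \<Longrightarrow> cinv c (cmap c p) = p"
  by (simp add: is_chart_def homeomorphism_def)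

lemma cmap_cinv: "is_chart S c \<Longrightarrow> x \<in> cmap c ` cdom c \<Longrightarrow> cmap c (cinv c x) = x"
  by (auto simp: is_chart_def homeomorphism_def)

lemma cinv_in: "is_chart S c \<Longrightarrow> x \<in> cmap c ` cdom c \<Longrightarrow> cinv c x \<in> cdom c"
  by (auto simp: is_chart_def homeomorphism_def)

lemma chart_image_open: "is_chart S c \<Longrightarrow> open (cmap c ` cdom c)"
  by (simp add: is_chart_def)

lemma chart_dom_subset: "is_chart S c \<Longrightarrow> cdom c \<subseteq> S"
  by (auto simp: is_chart_def dest: openin_imp_subset)

lemma chart_open_image:
  assumes c: "is_chart S c" and W: "openin (top_of_set S) (W \<inter> S)"
  shows "open (cmap c ` (W \<inter> cdom c))"
proof -
  have "W \<inter> cdom c = cdom c \<inter> (W \<inter> S)" using chart_dom_subset[OF c] by auto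
  then have "openin (top_of_set (cdom c)) (W \<inter> cdom c)"
    using openin_subset_trans[of S "cdom c \<inter> (W \<inter> S)" "cdom c"] W c chart_dom_subset[OF c]
    by (auto simp: is_chart_def)
  moreover have "homeomorphism (cdom c) (cmap c ` cdom c) (cmap c) (cinv c)"
    using c by (simp add: is_chart_def)
  ultimately have "openin (top_of_set (cmap c ` cdom c)) (cmap c ` (W \<inter> cdom c))"
    by (rule homeomorphism_imp_open_map[rotated])
  then show ?thesis using openin_open_trans chart_image_open[OF c] by blast
qed

lemma chart_atE:
  assumes "smooth_atlas S \<B>" "p \<in> S"
  shows "chart_at \<B> p \<in> \<B>" "p \<in> cdom (chart_at \<B> p)"
proof -
  have "\<exists>c. c \<in> \<B> \<and> p \<in> cdom c" using assms by (auto simp: smooth_atlas_def)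
  from someI_ex[OF this] show "chart_at \<B> p \<in> \<B>" "p \<in> cdom (chart_at \<B> p)"
    by (auto simp: chart_at_def)
qed

abbreviation chart_diff :: "('a, 'n::finite) chart \<Rightarrow> ('a \<Rightarrow> 'v::real_normed_vector) \<Rightarrow> 'a \<Rightarrow> bool" where
  "chart_diff c f p \<equiv> (f \<circ> cinv c) differentiable (at (cmap c p))"

lemma pd_eq: "(f \<circ> cinv c has_derivative f') (at (cmap c p)) \<Longrightarrow> pd c i f p = f' (axis i 1)"
  by (simp add: pd_def frechet_derivative_at[symmetric])

lemma linear_eq_sum_axis:
  fixes L :: "real ^ 'n \<Rightarrow> 'v::real_vector"
  assumes "linear L" shows "L v = (\<Sum>i\<in>UNIV. v $ i *\<^sub>R L (axis i 1))"
proof -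
  have "L v = L (\<Sum>i\<in>UNIV. v $ i *\<^sub>R axis i 1)"
    using basis_expansion[of v] by (simp add: scalar_mult_eq_scaleR)
  then show ?thesis by (simp add: linear_sum[OF assms] linear_scale[OF assms])
qed

lemma pd_has_derivative:
  assumes "chart_diff c f p"
  shows "(f \<circ> cinv c has_derivative (\<lambda>v. \<Sum>i\<in>UNIV. v $ i * pd c i f p)) (at (cmap c p))"
proof -
  have D: "(f \<circ> cinv c has_derivative frechet_derivative (f \<circ> cinv c) (at (cmap c p))) (at (cmap c p))"
    using assms frechet_derivative_works by blast
  show ?thesis
    by (rule has_derivative_eq_rhs[OF D])
      (simp add: fun_eq_iff pd_def linear_eq_sum_axis[OF has_derivative_linear[OF D], symmetric]
        flip: real_scaleR_def)
qed

lemma jac_has_derivative: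
  fixes d :: "('a, 'n::finite) chart"
  assumes "chart_diff c (cmap d) p"
  shows "(cmap d \<circ> cinv c has_derivative (\<lambda>v. jac c d p *v v)) (at (cmap c p))"
proof -
  have D: "(cmap d \<circ> cinv c has_derivative frechet_derivative (cmap d \<circ> cinv c) (at (cmap c p))) (at (cmap c p))"
    (is "(_ has_derivative ?D) _") using assms frechet_derivative_works by blast
  have "pd c i (\<lambda>q. cmap d q $ k) p = ?D (axis i 1) $ k" for i k
    by (rule pd_eq) (use bounded_linear.has_derivative[OF bounded_linear_vec_nth D] in \<open>simp add: o_def\<close>)
  then have "jac c d p *v v = ?D v" for v
    using linear_eq_sum_axis[OF has_derivative_linear[OF D], of v]
    by (simp add: vec_eq_iff jac_def matrix_vector_mult_def mult.commute)
  then show ?thesis by (intro has_derivative_eq_rhs[OF D]) (simp add: fun_eq_iff)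
qed

lemma pd_cong:
  assumes c: "is_chart S c" and p: "p \<in> cdom c"
    and W: "openin (top_of_set S) (W \<inter> S)" "p \<in> W" and eq: "\<And>q. q \<in> W \<inter> cdom c \<Longrightarrow> f q = g q"
  shows "pd c i f p = pd c i g p"
proof -
  have eq': "(f \<circ> cinv c) y = (g \<circ> cinv c) y" if "y \<in> cmap c ` (W \<inter> cdom c)" for y
    using that eq cinv_cmap[OF c] by auto
  have "(f \<circ> cinv c has_derivative D) (at (cmap c p)) \<longleftrightarrow> (g \<circ> cinv c has_derivative D) (at (cmap c p))" for D
    using has_derivative_cong_open[OF _ chart_open_image[OF c W(1)], of _ D "cmap c p"] eq' p W(2)
    by (metis IntI imageI)
  then show ?thesis by (simp add: pd_def frechet_derivative_def)
qed

lemma pd_cong_dom: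
  assumes "is_chart S c" "p \<in> cdom c" "\<And>q. q \<in> cdom c \<Longrightarrow> f q = g q"
  shows "pd c i f p = pd c i g p"
  by (rule pd_cong[OF assms(1,2), of S]) (use assms chart_dom_subset[OF assms(1)] in auto)

lemma pd_const: "pd c i (\<lambda>q. a) p = 0"
  by (rule pd_eq[where f' = "\<lambda>_. 0"]) (simp add: o_def)

lemma pd_add:
  assumes "chart_diff c f p" "chart_diff c g p"
  shows "pd c i (\<lambda>q. f q + g q) p = pd c i f p + pd c i g p"
  by (subst pd_eq[where f = "\<lambda>q. f q + g q"])
    (use has_derivative_add[OF assms[THEN frechet_derivative_works[THEN iffD1]]]
      in \<open>auto simp: o_def pd_def\<close>)

lemma pd_mult:
  assumes c: "is_chart S c" "p \<in> cdom c" and "chart_diff c f p" "chart_diff c g p"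
  shows "pd c i (\<lambda>q. f q * g q) p = pd c i f p * g p + f p * pd c i g p"
proof -
  have "((\<lambda>q. f q * g q) \<circ> cinv c has_derivative
      (\<lambda>v. frechet_derivative (f \<circ> cinv c) (at (cmap c p)) v * g p +
           f p * frechet_derivative (g \<circ> cinv c) (at (cmap c p)) v)) (at (cmap c p))"
    by (rule has_derivative_eq_rhs)
      (use has_derivative_mult[OF assms(3,4)[THEN frechet_derivative_works[THEN iffD1]]] cinv_cmap[OF c]
        in \<open>auto simp: o_def add.commute\<close>)
  from pd_eq[OF this] show ?thesis by (simp add: pd_def)
qed

lemma pd_ln:
  assumes c: "is_chart S c" "p \<in> cdom c" and "chart_diff c f p" "f p > 0"
  shows "pd c i (\<lambda>q. ln (f q)) p = pd c i f p / f p"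
proof -
  have D: "(f \<circ> cinv c has_derivative frechet_derivative (f \<circ> cinv c) (at (cmap c p))) (at (cmap c p))"
    using assms(3) frechet_derivative_works by blast
  have "((\<lambda>q. ln (f q)) \<circ> cinv c has_derivative
      (\<lambda>v. frechet_derivative (f \<circ> cinv c) (at (cmap c p)) v * inverse (f p))) (at (cmap c p))"
    unfolding o_def
    by (rule has_derivative_eq_rhs, rule has_derivative_ln[OF _ D[unfolded o_def]])
      (use assms cinv_cmap[OF c] in \<open>simp_all add: o_def\<close>)
  from pd_eq[OF this] show ?thesis by (simp add: pd_def divide_inverse)
qed

lemma pd_sum:
  assumes "finite I" "\<And>j. j \<in> I \<Longrightarrow> chart_diff c (f j) p"
  shows "pd c i (\<lambda>q. \<Sum>j\<in>I. f j q) p = (\<Sum>j\<in>I. pd c i (f j) p)"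
proof -
  have "((\<lambda>q. \<Sum>j\<in>I. f j q) \<circ> cinv c has_derivative
      (\<lambda>v. \<Sum>j\<in>I. frechet_derivative (f j \<circ> cinv c) (at (cmap c p)) v)) (at (cmap c p))"
    unfolding o_def
    by (rule has_derivative_sum)
      (use assms(2)[THEN frechet_derivative_works[THEN iffD1]] in \<open>simp add: o_def\<close>)
  from pd_eq[OF this] show ?thesis by (simp add: pd_def)
qed

text \<open>Finite differentiability is tracked because the cut-off functions in the proof of the
  divergence theorem are only of class \<open>C\<^sup>1\<close>.\<close>

definition Ck_fun :: "nat \<Rightarrow> ('a, 'n::finite) chart set \<Rightarrow> ('a \<Rightarrow> 'v::real_normed_vector) \<Rightarrow> bool" where
  "Ck_fun k \<B> f \<longleftrightarrow> (\<forall>c\<in>\<B>. Ck_on k (cmap c ` cdom c) (f \<circ> cinv c))"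

definition Ck_vfield :: "nat \<Rightarrow> ('a, 'n::finite) chart set \<Rightarrow> ('a, 'n) vfield \<Rightarrow> bool" where
  "Ck_vfield k \<B> V \<longleftrightarrow> (\<forall>c\<in>\<B>. Ck_on k (cmap c ` cdom c) (V c \<circ> cinv c)) \<and>
     (\<forall>c\<in>\<B>. \<forall>d\<in>\<B>. \<forall>p\<in>cdom c \<inter> cdom d. V d p = jac c d p *v V c p)"

lemma smooth_fun_imp_Ck_fun: "smooth_fun \<B> f \<Longrightarrow> Ck_fun k \<B> f"
  by (simp add: smooth_fun_def Ck_fun_def smooth_in_chart_def smooth_on_def)

lemma Ck_on_chart_diff:
  assumes "Ck_on (Suc k) U (f \<circ> cinv c)" "cmap c p \<in> U"
  shows "chart_diff c f p"
  using assms by simp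

lemma Ck_fun_chart_diff: "Ck_fun (Suc k) \<B> f \<Longrightarrow> c \<in> \<B> \<Longrightarrow> p \<in> cdom c \<Longrightarrow> chart_diff c f p"
  by (auto simp: Ck_fun_def)

lemma Ck_vfield_chart_diff:
  assumes "Ck_vfield (Suc k) \<B> V" "c \<in> \<B>" "p \<in> cdom c"
  shows "chart_diff c (\<lambda>q. V c q $ i) p"
proof -
  have "V c \<circ> cinv c differentiable at (cmap c p)" using assms by (auto simp: Ck_vfield_def)
  then obtain D where D: "(V c \<circ> cinv c has_derivative D) (at (cmap c p))" by (auto simp: differentiable_def)
  have "((\<lambda>q. V c q $ i) \<circ> cinv c has_derivative (\<lambda>v. D v $ i)) (at (cmap c p))"
    using bounded_linear.has_derivative[OF bounded_linear_vec_nth D] by (simp add: o_def)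
  then show ?thesis by (auto simp: differentiable_def)
qed

lemma Ck_on_pd:
  assumes c: "is_chart S c" and W: "open (cmap c ` W)" "W \<subseteq> cdom c"
    and f: "Ck_on (Suc k) (cmap c ` W) (f \<circ> cinv c)"
  shows "Ck_on k (cmap c ` W) (pd c i f \<circ> cinv c)"
proof (rule Ck_on_cong[OF W(1)])
  show "Ck_on k (cmap c ` W) (\<lambda>x. frechet_derivative (f \<circ> cinv c) (at x) (axis i 1))"
    using f by simp
qed (use cmap_cinv[OF c] W in \<open>auto simp: pd_def\<close>)

lemma pd_commute:
  assumes c: "is_chart S c" and W: "open (cmap c ` W)" "W \<subseteq> cdom c" and p: "p \<in> W"
    and f: "Ck_on 2 (cmap c ` W) (f \<circ> cinv c)"
  shows "pd c i (pd c j f) p = pd c j (pd c i f) p"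
proof -
  have "pd c i (pd c j f) p =
      frechet_derivative (\<lambda>x. frechet_derivative (f \<circ> cinv c) (at x) (axis j 1)) (at (cmap c p)) (axis i 1)" for i j
  proof (rule pd_eq)
    have "Ck_on (Suc 0) (cmap c ` W) (\<lambda>x. frechet_derivative (f \<circ> cinv c) (at x) (axis j 1))"
      using f by (simp add: numeral_2_eq_2)
    then have "((\<lambda>x. frechet_derivative (f \<circ> cinv c) (at x) (axis j 1)) has_derivative
        frechet_derivative (\<lambda>x. frechet_derivative (f \<circ> cinv c) (at x) (axis j 1)) (at (cmap c p))) (at (cmap c p))"
      by (rule Ck_on_has_derivative) (use p in auto)
    then show "(pd c j f \<circ> cinv c has_derivative
        frechet_derivative (\<lambda>x. frechet_derivative (f \<circ> cinv c) (at x) (axis j 1)) (at (cmap c p))) (at (cmap c p))"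
      by (rule has_derivative_cong_open[OF _ W(1)])
        (use cmap_cinv[OF c] W p in \<open>auto simp: pd_def\<close>)
  qed
  then show ?thesis using Ck_on_2_symmetric_real[OF W(1) f, of "cmap c p"] p by auto
qed

text \<open>A smooth inclusion of one manifold into another. With \<open>S = M\<close> and \<open>\<B> = \<A>\<close> the lemmas
  describe changes of coordinates, otherwise a submanifold in ambient coordinates.\<close>

locale smooth_inclusion =
  fixes S :: "'a::topological_space set" and \<B> :: "('a, 'm::finite) chart set"
    and M :: "'a set" and \<A> :: "('a, 'n::finite) chart set"
  assumes S_atlas: "smooth_atlas S \<B>" and M_atlas: "smooth_atlas M \<A>" and S_sub_M: "S \<subseteq> M"
    and inclusion_smooth: "c \<in> \<B> \<Longrightarrow> C \<in> \<A> \<Longrightarrow> smooth_in_chart c (cdom C) (cmap C)"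
begin

lemma chart_S: "c \<in> \<B> \<Longrightarrow> is_chart S c"
  using S_atlas by (simp add: smooth_atlas_def)

lemma chart_M: "C \<in> \<A> \<Longrightarrow> is_chart M C"
  using M_atlas by (simp add: smooth_atlas_def)

lemma cdom_openin: "C \<in> \<A> \<Longrightarrow> openin (top_of_set S) (cdom C \<inter> S)"
proof -
  assume "C \<in> \<A>"
  then obtain T where "open T" "cdom C = M \<inter> T"
    using chart_M[of C] unfolding is_chart_def openin_open by blast
  then show ?thesis using S_sub_M by (auto simp: openin_open)
qed

lemma overlap_open: "c \<in> \<B> \<Longrightarrow> C \<in> \<A> \<Longrightarrow> open (cmap c ` (cdom C \<inter> cdom c))"
  using chart_open_image[OF chart_S cdom_openin] .

lemma inclusion_Ck: "c \<in> \<B> \<Longrightarrow> C \<in> \<A> \<Longrightarrow> Ck_on k (cmap c ` (cdom C \<inter> cdom c)) (cmap C \<circ> cinv c)"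
  using inclusion_smooth by (simp add: smooth_in_chart_def smooth_on_def)

lemma inclusion_diff: "c \<in> \<B> \<Longrightarrow> C \<in> \<A> \<Longrightarrow> p \<in> cdom c \<Longrightarrow> p \<in> cdom C \<Longrightarrow> chart_diff c (cmap C) p"
  using inclusion_Ck[of c C 1] by auto

lemma jac_deriv: "c \<in> \<B> \<Longrightarrow> C \<in> \<A> \<Longrightarrow> p \<in> cdom c \<Longrightarrow> p \<in> cdom C \<Longrightarrow>
    (cmap C \<circ> cinv c has_derivative (\<lambda>v. jac c C p *v v)) (at (cmap c p))"
  by (rule jac_has_derivative[OF inclusion_diff])

lemma jac_Ck_entry:
  assumes "c \<in> \<B>" "C \<in> \<A>"
  shows "Ck_on k (cmap c ` (cdom C \<inter> cdom c)) (\<lambda>x. jac c C (cinv c x) $ i $ j)"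
proof -
  have "Ck_on (Suc k) (cmap c ` (cdom C \<inter> cdom c)) ((\<lambda>q. cmap C q $ i) \<circ> cinv c)"
    using Ck_on_bounded_linear_comp[OF bounded_linear_vec_nth overlap_open[OF assms] inclusion_Ck[OF assms]]
    by (simp add: o_def)
  from Ck_on_pd[OF chart_S[OF assms(1)] overlap_open[OF assms] _ this]
  show ?thesis by (simp add: jac_def o_def)
qed

lemma chain_has_derivative:
  assumes c: "c \<in> \<B>" "C \<in> \<A>" "p \<in> cdom c" "p \<in> cdom C"
    and f: "(f \<circ> cinv C has_derivative f') (at (cmap C p))"
  shows "(f \<circ> cinv c has_derivative (\<lambda>v. f' (jac c C p *v v))) (at (cmap c p))"
proof -
  have "((\<lambda>x. (f \<circ> cinv C) ((cmap C \<circ> cinv c) x)) has_derivative (\<lambda>v. f' (jac c C p *v v))) (at (cmap c p))"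
    by (rule has_derivative_compose[OF jac_deriv])
      (use c f cinv_cmap[OF chart_S, OF c(1,3)] in \<open>simp_all add: o_def\<close>)
  then show ?thesis
    by (rule has_derivative_cong_open[OF _ overlap_open[OF c(1,2)]])
      (use c cinv_cmap[OF chart_S[OF c(1)]] cinv_cmap[OF chart_M[OF c(2)]] in auto)
qed

lemma pd_chain:
  assumes c: "c \<in> \<B>" "C \<in> \<A>" "p \<in> cdom c" "p \<in> cdom C" and f: "chart_diff C f p"
  shows "pd c i f p = (\<Sum>k\<in>UNIV. jac c C p $ k $ i * pd C k f p)"
  using pd_eq[OF chain_has_derivative[OF c pd_has_derivative[OF f]], of i]
  by (simp add: matrix_vector_mult_basis column_def)

lemma Ck_on_pullback:
  assumes c: "c \<in> \<B>" "C \<in> \<A>" and f: "Ck_on k (cmap C ` cdom C) (f \<circ> cinv C)"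
  shows "Ck_on k (cmap c ` (cdom C \<inter> cdom c)) (f \<circ> cinv c)"
proof (rule Ck_on_cong[OF overlap_open[OF c]])
  show "Ck_on k (cmap c ` (cdom C \<inter> cdom c)) (\<lambda>x. (f \<circ> cinv C) ((cmap C \<circ> cinv c) x))"
    by (rule Ck_on_comp[OF overlap_open[OF c] inclusion_Ck[OF c] f])
      (use cinv_cmap[OF chart_S[OF c(1)]] in auto)
qed (use cinv_cmap[OF chart_S[OF c(1)]] cinv_cmap[OF chart_M[OF c(2)]] in auto)

end

lemma smooth_inclusion_refl: "smooth_atlas S \<B> \<Longrightarrow> smooth_inclusion S \<B> S \<B>"
  by unfold_locales (auto simp: smooth_atlas_def)

lemma (in smooth_inclusion) jac_comp_target:
  assumes "c \<in> \<B>" "C \<in> \<A>" "D \<in> \<A>" "p \<in> cdom c" "p \<in> cdom C" "p \<in> cdom D"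
  shows "jac c D p = jac C D p ** jac c C p"
proof -
  interpret M: smooth_inclusion M \<A> M \<A> by (rule smooth_inclusion_refl[OF M_atlas])
  have "(\<lambda>v. jac c D p *v v) = (\<lambda>v. jac C D p *v (jac c C p *v v))"
    by (rule has_derivative_unique[OF jac_deriv chain_has_derivative[OF _ _ _ _ M.jac_deriv]]) (use assms in auto)
  then show ?thesis unfolding matrix_vector_mul_assoc by (metis matrix_eq)
qed

lemma (in smooth_inclusion) jac_comp_source:
  assumes "c \<in> \<B>" "d \<in> \<B>" "C \<in> \<A>" "p \<in> cdom c" "p \<in> cdom d" "p \<in> cdom C"
  shows "jac c C p = jac d C p ** jac c d p"
proof -
  interpret S: smooth_inclusion S \<B> S \<B> by (rule smooth_inclusion_refl[OF S_atlas])
  have "(\<lambda>v. jac c C p *v v) = (\<lambda>v. jac d C p *v (jac c d p *v v))"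
    by (rule has_derivative_unique[OF jac_deriv S.chain_has_derivative[OF _ _ _ _ jac_deriv]]) (use assms in auto)
  then show ?thesis unfolding matrix_vector_mul_assoc by (metis matrix_eq)
qed

lemma (in smooth_inclusion) jac_self:
  assumes "c \<in> \<B>" "p \<in> cdom c"
  shows "jac c c p = mat 1"
proof -
  interpret S: smooth_inclusion S \<B> S \<B> by (rule smooth_inclusion_refl[OF S_atlas])
  have "(cmap c \<circ> cinv c has_derivative (\<lambda>v. v)) (at (cmap c p))"
    by (rule has_derivative_cong_open[OF has_derivative_ident chart_image_open[OF chart_S[OF assms(1)]]])
      (use assms cmap_cinv[OF chart_S[OF assms(1)]] in auto)
  with S.jac_deriv[OF assms(1) assms(1) assms(2,2)] have "(\<lambda>v. jac c c p *v v) = (\<lambda>v. v)"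
    by (rule has_derivative_unique)
  then show ?thesis by (metis matrix_eq matrix_vector_mul_lid)
qed

lemma (in smooth_inclusion) jac_inverse:
  assumes "c \<in> \<B>" "d \<in> \<B>" "p \<in> cdom c" "p \<in> cdom d"
  shows "jac d c p ** jac c d p = mat 1"
proof -
  interpret S: smooth_inclusion S \<B> S \<B> by (rule smooth_inclusion_refl[OF S_atlas])
  show ?thesis using S.jac_comp_target[of c d c p] jac_self[of c p] assms by simp
qed

lemma (in smooth_inclusion) jac_det_nonzero:
  assumes "c \<in> \<B>" "d \<in> \<B>" "p \<in> cdom c" "p \<in> cdom d"
  shows "det (jac c d p) \<noteq> 0"
  using jac_inverse[OF assms] det_mul[of "jac d c p" "jac c d p"] by auto

section \<open>The Riemannian measure of a closed surface\<close>

text \<open>This transfers the change of variables formula from absolutely integrable functions to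
  nonnegative ones with a possibly infinite integral.\<close>

lemma nn_integral_eq_absolute_integral:
  fixes \<phi> :: "'b::euclidean_space \<Rightarrow> real"
  assumes meas: "(\<lambda>x. indicator A x * \<phi> x) \<in> borel_measurable borel"
    and nonneg: "\<And>x. x \<in> A \<Longrightarrow> 0 \<le> \<phi> x"
  shows "(\<integral>\<^sup>+x\<in>A. ennreal (\<phi> x) \<partial>lborel) =
    (if \<phi> absolutely_integrable_on A then ennreal (integral A \<phi>) else \<infinity>)"
proof (cases "\<phi> absolutely_integrable_on A")
  case True
  then have "(\<phi> has_integral integral A \<phi>) A"
    by (auto dest: set_lebesgue_integral_eq_integral(1))
  from nn_integral_has_integral_lebesgue'[OF nonneg this] True show ?thesis by simp
next
  case False
  have "(\<integral>\<^sup>+x. ennreal (indicator A x * \<phi> x) \<partial>lborel) = \<infinity>"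
  proof (rule ccontr)
    assume "\<not> ?thesis"
    then have "integrable lborel (\<lambda>x. indicator A x * \<phi> x)"
      using meas nonneg by (intro integrableI_nonneg) (auto simp: indicator_def less_top[symmetric])
    then have "integrable lebesgue (\<lambda>x. indicator A x * \<phi> x)"
      using meas by (subst integrable_completion) auto
    with False show False by (simp add: set_integrable_def)
  qed
  with False show ?thesis
    by (simp add: mult.commute nn_integral_set_ennreal)
qed

lemma nn_integral_change_of_variables:
  fixes G :: "real ^ 'm::{finite,wellorder} \<Rightarrow> real ^ 'm::_"
  assumes E: "E \<in> sets lebesgue"
    and der: "\<And>x. x \<in> E \<Longrightarrow> (G has_derivative G' x) (at x within E)" and inj: "inj_on G E"
    and meas: "(\<lambda>y. indicator (G ` E) y * \<phi> y) \<in> borel_measurable borel"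
      "(\<lambda>x. indicator E x * (\<bar>det (matrix (G' x))\<bar> * \<phi> (G x))) \<in> borel_measurable borel"
    and nonneg: "\<And>y. y \<in> G ` E \<Longrightarrow> 0 \<le> \<phi> y"
  shows "(\<integral>\<^sup>+x\<in>E. ennreal (\<bar>det (matrix (G' x))\<bar> * \<phi> (G x)) \<partial>lborel) =
    (\<integral>\<^sup>+y\<in>G ` E. ennreal (\<phi> y) \<partial>lborel)"
proof -
  let ?\<psi> = "\<lambda>x. \<bar>det (matrix (G' x))\<bar> * \<phi> (G x)"
  have "?\<psi> absolutely_integrable_on E \<and> integral E ?\<psi> = b \<longleftrightarrow>
      \<phi> absolutely_integrable_on (G ` E) \<and> integral (G ` E) \<phi> = b" for b
    using has_absolute_integral_change_of_variables[OF E der inj, of "\<lambda>y. vec (\<phi> y) :: real ^ 1" "vec b"]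
    by (auto simp: absolutely_integrable_on_1_iff integral_on_1_eq vec_eq_iff)
  from this[of "integral E ?\<psi>"] this[of "integral (G ` E) \<phi>"] have eq: "(if ?\<psi> absolutely_integrable_on E then ennreal (integral E ?\<psi>) else \<infinity>) =
    (if \<phi> absolutely_integrable_on (G ` E) then ennreal (integral (G ` E) \<phi>) else \<infinity>)"
    by auto
  have "(\<integral>\<^sup>+x\<in>E. ennreal (?\<psi> x) \<partial>lborel) =
    (if ?\<psi> absolutely_integrable_on E then ennreal (integral E ?\<psi>) else \<infinity>)"
    by (rule nn_integral_eq_absolute_integral[OF meas(2)]) (simp add: nonneg)
  also note eq
  also have "(if \<phi> absolutely_integrable_on (G ` E) then ennreal (integral (G ` E) \<phi>) else \<infinity>) =
    (\<integral>\<^sup>+y\<in>G ` E. ennreal (\<phi> y) \<partial>lborel)"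
    by (rule nn_integral_eq_absolute_integral[OF meas(1) nonneg, symmetric])
  finally show ?thesis .
qed

lemma bil_add_left: "bil T (a + b) c = bil T a c + bil T b c"
  and bil_add_right: "bil T c (a + b) = bil T c a + bil T c b"
  and bil_diff_left: "bil T (a - b) c = bil T a c - bil T b c"
  and bil_diff_right: "bil T c (a - b) = bil T c a - bil T c b"
  and bil_scale_left: "bil T (r *\<^sub>R a) c = r * bil T a c"
  and bil_scale_right: "bil T c (r *\<^sub>R a) = r * bil T c a"
  by (simp_all add: bil_def inner_add inner_diff matrix_vector_right_distrib
      matrix_vector_mult_diff_distrib matrix_vector_mult_scaleR)

lemma bil_expand: "bil T v w = (\<Sum>i\<in>UNIV. \<Sum>j\<in>UNIV. v $ i * T $ i $ j * w $ j)"
  by (simp add: bil_def inner_vec_def matrix_vector_mult_def sum_distrib_left mult.assoc)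

lemma bil_pullback: "bil (transpose J ** T ** J) v w = bil T (J *v v) (J *v w)"
  unfolding bil_def matrix_vector_mul_assoc[symmetric] transpose_matrix_vector
  by (metis dot_lmul_matrix inner_commute)

lemma bil_commute: "transpose T = T \<Longrightarrow> bil T v w = bil T w v"
  unfolding bil_def by (metis dot_lmul_matrix inner_commute transpose_matrix_vector)

text \<open>The product form also covers \<open>w = 0\<close>, as is needed at the zeros of the Killing field.\<close>

lemma bil_Cauchy_Schwarz:
  assumes sym: "transpose T = T" and pos: "\<And>v. v \<noteq> 0 \<Longrightarrow> bil T v v > 0"
  shows "(bil T v w)\<^sup>2 \<le> bil T v v * bil T w w"
proof (cases "w = 0")
  case True
  then show ?thesis by (simp add: bil_def)
next
  case False
  define t where "t = bil T v w / bil T w w"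
  have "0 \<le> bil T (v - t *\<^sub>R w) (v - t *\<^sub>R w)"
    using pos[of "v - t *\<^sub>R w"] by (cases "v - t *\<^sub>R w = 0") (auto simp: bil_def)
  also have "\<dots> = bil T v v - 2 * t * bil T v w + t * t * bil T w w"
    by (simp add: bil_diff_left bil_diff_right bil_scale_left bil_scale_right bil_commute[OF sym, of w v] algebra_simps)
  also have "\<dots> = bil T v v - (bil T v w)\<^sup>2 / bil T w w"
    using pos[OF False] by (simp add: t_def power2_eq_square)
  finally have "(bil T v w)\<^sup>2 / bil T w w \<le> bil T v v" by simp
  then show ?thesis using pos[OF False] by (simp only: pos_divide_le_eq)
qed

lemma det_pos_def_2:
  fixes T :: "real ^ 2 ^ 2"
  assumes sym: "transpose T = T" and pos: "\<And>v. v \<noteq> 0 \<Longrightarrow> bil T v v > 0"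
  shows "det T > 0"
proof -
  have s: "T $ 2 $ 1 = T $ 1 $ 2" using arg_cong[OF sym, of "\<lambda>A. A $ 1 $ 2"] by (simp add: transpose_def)
  have "vector [1, 0] \<noteq> (0 :: real ^ 2)" by (auto simp: vec_eq_iff forall_2)
  from pos[OF this] have 1: "T $ 1 $ 1 > 0" by (simp add: bil_expand sum_2)
  then have "vector [- T $ 1 $ 2, T $ 1 $ 1] \<noteq> (0 :: real ^ 2)" by (auto simp: vec_eq_iff forall_2)
  from pos[OF this] have "T $ 1 $ 1 * det T > 0"
    by (simp add: bil_expand sum_2 det_2 s algebra_simps)
  with 1 show ?thesis by (simp add: zero_less_mult_iff)
qed

locale closed_riemannian_surface =
  fixes S :: "'a::{second_countable_topology, t2_space} set" and \<B> :: "('a, 2) chart set"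
    and h :: "('a, 2) tensor2"
  assumes atlas: "smooth_atlas S \<B>" and compact_S: "compact S" and metric: "riemannian_metric \<B> h"

sublocale closed_riemannian_surface \<subseteq> smooth_inclusion S \<B> S \<B>
  by (rule smooth_inclusion_refl[OF atlas])

context closed_riemannian_surface
begin

lemma dom_sub: "c \<in> \<B> \<Longrightarrow> cdom c \<subseteq> S"
  using chart_dom_subset[OF chart_S] .

lemma image_open: "c \<in> \<B> \<Longrightarrow> open (cmap c ` cdom c)"
  using chart_image_open[OF chart_S] .

lemma h_sym: "c \<in> \<B> \<Longrightarrow> p \<in> cdom c \<Longrightarrow> transpose (h c p) = h c p"
  using metric unfolding riemannian_metric_def smooth_sym_tensor2_def by blast

lemma h_pos: "c \<in> \<B> \<Longrightarrow> p \<in> cdom c \<Longrightarrow> v \<noteq> 0 \<Longrightarrow> bil (h c p) v v > 0"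
  using metric unfolding riemannian_metric_def by blast

lemma h_nonneg: "c \<in> \<B> \<Longrightarrow> p \<in> cdom c \<Longrightarrow> bil (h c p) v v \<ge> 0"
  using h_pos[of c p v] by (cases "v = 0") (auto simp: bil_def)

lemma h_trans: "c \<in> \<B> \<Longrightarrow> d \<in> \<B> \<Longrightarrow> p \<in> cdom c \<Longrightarrow> p \<in> cdom d \<Longrightarrow>
    h c p = transpose (jac c d p) ** h d p ** jac c d p"
  using metric unfolding riemannian_metric_def smooth_sym_tensor2_def by blast

lemma det_h_pos: "c \<in> \<B> \<Longrightarrow> p \<in> cdom c \<Longrightarrow> det (h c p) > 0"
  by (rule det_pos_def_2) (auto intro: h_sym h_pos)

lemma det_h_trans: "c \<in> \<B> \<Longrightarrow> d \<in> \<B> \<Longrightarrow> p \<in> cdom c \<Longrightarrow> p \<in> cdom d \<Longrightarrow>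
    det (h c p) = (det (jac c d p))\<^sup>2 * det (h d p)"
  by (subst h_trans[of c d p]) (auto simp: det_mul power2_eq_square)

lemma h_Ck_entry: "c \<in> \<B> \<Longrightarrow> Ck_on k (cmap c ` cdom c) ((\<lambda>q. h c q $ i $ j) \<circ> cinv c)"
proof -
  assume c: "c \<in> \<B>"
  have "Ck_on k (cmap c ` cdom c) (h c \<circ> cinv c)"
    using metric c unfolding riemannian_metric_def smooth_sym_tensor2_def smooth_in_chart_def smooth_on_def
    by auto
  then show ?thesis using image_open[OF c] by (simp add: Ck_on_vec_iff o_def)
qed

lemma det_h_Ck: "c \<in> \<B> \<Longrightarrow> Ck_on k (cmap c ` cdom c) ((\<lambda>q. det (h c q)) \<circ> cinv c)"
  using h_Ck_entry[of c k] image_open[of c]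
  by (auto simp: det_2 o_def intro!: Ck_on_diff Ck_on_mult)

definition dens :: "('a, 2) chart \<Rightarrow> real ^ 2 \<Rightarrow> real" where
  "dens c x = sqrt (det (h c (cinv c x)))"

lemma dens_pos: "c \<in> \<B> \<Longrightarrow> x \<in> cmap c ` cdom c \<Longrightarrow> dens c x > 0"
  using det_h_pos[of c "cinv c x"] cinv_in[OF chart_S] by (simp add: dens_def)

lemma dens_Ck: "c \<in> \<B> \<Longrightarrow> Ck_on k (cmap c ` cdom c) (dens c)"
  unfolding dens_def[abs_def] using det_h_Ck[of c k] image_open det_h_pos cinv_in[OF chart_S]
  by (intro Ck_on_sqrt) (auto simp: o_def)

lemma S_borel: "S \<in> sets borel"
  using compact_S by (intro borel_closed compact_imp_closed)

lemma dom_borel: "c \<in> \<B> \<Longrightarrow> cdom c \<in> sets borel"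
  using chart_S[of c] S_borel by (auto simp: is_chart_def openin_open)

lemma sets_iff: "E \<in> sets (restrict_space borel S) \<longleftrightarrow> E \<subseteq> S \<and> E \<in> sets borel"
  using S_borel by (simp add: sets_restrict_space_iff)

lemma cinv_measurable: "c \<in> \<B> \<Longrightarrow> cinv c \<in> restrict_space lborel (cmap c ` cdom c) \<rightarrow>\<^sub>M restrict_space borel S"
proof -
  assume c: "c \<in> \<B>"
  have "continuous_on (cmap c ` cdom c) (cinv c)"
    using chart_S[OF c] by (simp add: is_chart_def homeomorphism_def)
  from borel_measurable_continuous_on_restrict[OF this]
  have "cinv c \<in> restrict_space borel (cmap c ` cdom c) \<rightarrow>\<^sub>M borel" .
  then have "cinv c \<in> restrict_space lborel (cmap c ` cdom c) \<rightarrow>\<^sub>M borel"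
    by (simp cong: measurable_cong_sets add: sets_restrict_space)
  then show ?thesis
    using dom_sub[OF c] cinv_in[OF chart_S[OF c]]
    by (intro measurable_restrict_space2) (auto simp: space_restrict_space)
qed

lemma vimage_cinv:
  "c \<in> \<B> \<Longrightarrow> cinv c -` E \<inter> cmap c ` cdom c = cmap c ` (E \<inter> cdom c)"
  using cinv_cmap[OF chart_S, of c] by auto

lemma cmap_image_borel: "c \<in> \<B> \<Longrightarrow> E \<in> sets borel \<Longrightarrow> E \<subseteq> cdom c \<Longrightarrow> cmap c ` E \<in> sets borel"
proof -
  assume c: "c \<in> \<B>" and E: "E \<in> sets borel" "E \<subseteq> cdom c"
  then have "E \<in> sets (restrict_space borel S)" using dom_sub[OF c] by (auto simp: sets_iff)
  from measurable_sets[OF cinv_measurable[OF c] this]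
  have "cmap c ` E \<in> sets (restrict_space lborel (cmap c ` cdom c))"
    using vimage_cinv[OF c, of E] E(2) by (simp add: space_restrict_space Int_absorb2)
  then show ?thesis using image_open[OF c] by (simp add: sets_restrict_space_iff)
qed

definition chart_measure :: "('a, 2) chart \<Rightarrow> 'a measure" where
  "chart_measure c = distr (density (restrict_space lborel (cmap c ` cdom c)) (\<lambda>x. ennreal (dens c x)))
     (restrict_space borel S) (cinv c)"

lemma dens_measurable: "c \<in> \<B> \<Longrightarrow> dens c \<in> borel_measurable (restrict_space lborel (cmap c ` cdom c))"
  using borel_measurable_continuous_on_restrict[OF Ck_on_imp_continuous_on[OF dens_Ck]]
  by (simp cong: measurable_cong_sets add: sets_restrict_space)

lemma sets_chart_measure [simp]: "sets (chart_measure c) = sets (restrict_space borel S)"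
  by (simp add: chart_measure_def)

lemma emeasure_chart_measure:
  assumes c: "c \<in> \<B>" and E: "E \<in> sets (restrict_space borel S)"
  shows "emeasure (chart_measure c) E =
    (\<integral>\<^sup>+x\<in>cmap c ` (E \<inter> cdom c). ennreal (dens c x) \<partial>lborel)"
proof -
  have E': "E \<inter> cdom c \<in> sets borel" using E dom_borel[OF c] by (auto simp: sets_iff)
  have "emeasure (chart_measure c) E = emeasure (density (restrict_space lborel (cmap c ` cdom c))
      (\<lambda>x. ennreal (dens c x))) (cmap c ` (E \<inter> cdom c))"
    unfolding chart_measure_def
    by (subst emeasure_distr) (use cinv_measurable[OF c] E vimage_cinv[OF c]
        in \<open>auto simp: space_restrict_space cong: measurable_cong_sets\<close>)
  also have "\<dots> = (\<integral>\<^sup>+x. ennreal (dens c x) * indicator (cmap c ` (E \<inter> cdom c)) x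
      \<partial>restrict_space lborel (cmap c ` cdom c))"
    using dens_measurable[OF c] cmap_image_borel[OF c E'] image_open[OF c]
    by (intro emeasure_density) (auto simp: sets_restrict_space_iff)
  also have "\<dots> = (\<integral>\<^sup>+x\<in>cmap c ` (E \<inter> cdom c). ennreal (dens c x) \<partial>lborel)"
    using image_open[OF c]
    by (subst nn_integral_restrict_space) (auto intro!: nn_integral_cong simp: indicator_def)
  finally show ?thesis .
qed

text \<open>The change of variables formula: \<open>sqrt (det h)\<close> picks up exactly the Jacobian determinant.\<close>

lemma chart_measure_agree:
  assumes c: "c \<in> \<B>" and d: "d \<in> \<B>" and E: "E \<in> sets borel" "E \<subseteq> cdom c" "E \<subseteq> cdom d"
  shows "(\<integral>\<^sup>+x\<in>cmap c ` E. ennreal (dens c x) \<partial>lborel) = (\<integral>\<^sup>+x\<in>cmap d ` E. ennreal (dens d x) \<partial>lborel)"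
proof -
  let ?G = "cmap d \<circ> cinv c"
  let ?G' = "\<lambda>x v. jac c d (cinv c x) *v v"
  have cc: "cinv c (cmap c p) = p" if "p \<in> E" for p using cinv_cmap[OF chart_S[OF c]] that E by auto
  have dd: "cinv d (cmap d p) = p" if "p \<in> E" for p using cinv_cmap[OF chart_S[OF d]] that E by auto
  have img: "?G ` cmap c ` E = cmap d ` E" using cc by (auto simp: image_iff)
  have dens: "\<bar>det (matrix (?G' x))\<bar> * dens d (?G x) = dens c x" if "x \<in> cmap c ` E" for x
    using that det_h_trans[OF c d] E cc dd by (auto simp: dens_def real_sqrt_mult subset_iff)
  have meas: "(\<lambda>x. indicator (cmap e ` E) x * dens e x) \<in> borel_measurable borel"
    if e: "e \<in> \<B>" "E \<subseteq> cdom e" for e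
    using borel_measurable_continuous_on_indicator[OF cmap_image_borel[OF e(1) E(1) e(2)]
      continuous_on_subset[OF Ck_on_imp_continuous_on[OF dens_Ck[OF e(1), of 0]]]] e(2) by (simp add: image_mono)
  have "(\<integral>\<^sup>+x\<in>cmap c ` E. ennreal (dens c x) \<partial>lborel) =
      (\<integral>\<^sup>+x\<in>cmap c ` E. ennreal (\<bar>det (matrix (?G' x))\<bar> * dens d (?G x)) \<partial>lborel)"
    by (intro nn_integral_cong) (auto simp: indicator_def dens simp del: matrix_of_matrix_vector_mul o_apply)
  also have "\<dots> = (\<integral>\<^sup>+x\<in>?G ` cmap c ` E. ennreal (dens d x) \<partial>lborel)"
  proof (rule nn_integral_change_of_variables)
    show "cmap c ` E \<in> sets lebesgue" using cmap_image_borel[OF c E(1,2)] by auto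
    show "(?G has_derivative ?G' x) (at x within cmap c ` E)" if "x \<in> cmap c ` E" for x
    proof -
      obtain p where p: "p \<in> E" "x = cmap c p" using \<open>x \<in> cmap c ` E\<close> by blast
      have "(?G has_derivative (\<lambda>v. jac c d p *v v)) (at (cmap c p))"
        using p(1) E by (intro jac_deriv[OF c d]) blast+
      then show ?thesis unfolding p(2) cc[OF p(1)] by (rule has_derivative_at_withinI)
    qed
    show "inj_on ?G (cmap c ` E)"
    proof (rule inj_onI)
      fix x y assume "x \<in> cmap c ` E" "y \<in> cmap c ` E" and eq: "?G x = ?G y"
      then obtain p q where p: "p \<in> E" "x = cmap c p" and q: "q \<in> E" "y = cmap c q" by blast
      have "cmap d p = cmap d q" using eq p q cc by simp
      then show "x = y" using dd[OF p(1)] dd[OF q(1)] p q by metis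
    qed
    show "(\<lambda>y. indicator (?G ` cmap c ` E) y * dens d y) \<in> borel_measurable borel"
      unfolding img by (rule meas[OF d E(3)])
    have "(\<lambda>x. indicator (cmap c ` E) x * (\<bar>det (matrix (?G' x))\<bar> * dens d (?G x))) =
        (\<lambda>x. indicator (cmap c ` E) x * dens c x)"
      using dens by (auto simp: indicator_def fun_eq_iff simp del: matrix_of_matrix_vector_mul o_apply)
    then show "(\<lambda>x. indicator (cmap c ` E) x * (\<bar>det (matrix (?G' x))\<bar> * dens d (?G x))) \<in> borel_measurable borel"
      using meas[OF c E(2)] by presburger
    show "0 \<le> dens d y" if "y \<in> ?G ` cmap c ` E" for y
      using that E(3) dens_pos[OF d, of y] unfolding img by (auto simp: less_imp_le)
  qed
  finally show ?thesis unfolding img .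
qed

lemma finite_chart_cover: obtains I where "finite I" "I \<subseteq> \<B>" "(\<Union>c\<in>I. cdom c) = S"
proof -
  have "S \<subseteq> \<Union>(cdom ` \<B>)" and "\<And>U. U \<in> cdom ` \<B> \<Longrightarrow> openin (top_of_set S) U"
    using atlas by (auto simp: smooth_atlas_def is_chart_def)
  then obtain \<F> where "finite \<F>" "\<F> \<subseteq> cdom ` \<B>" "S \<subseteq> \<Union>\<F>"
    using compact_S unfolding compact_eq_openin_cover by metis
  then obtain I where "I \<subseteq> \<B>" "finite I" "\<F> = cdom ` I" using finite_subset_image by metis
  with \<open>S \<subseteq> \<Union>\<F>\<close> dom_sub show ?thesis by (intro that[of I]) auto
qed

text \<open>The measure is glued from the chart measures along a partition of \<open>S\<close> into finitely many
  Borel pieces, each contained in a chart domain.\<close>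

lemma riemannian_measure_exists:
  "\<exists>N. sets N = sets (restrict_space borel S) \<and>
     (\<forall>c\<in>\<B>. \<forall>E\<in>sets N. E \<subseteq> cdom c \<longrightarrow>
        emeasure N E = (\<integral>\<^sup>+x\<in>cmap c ` E. ennreal (dens c x) \<partial>lborel))"
proof -
  obtain I where I: "finite I" "I \<subseteq> \<B>" "(\<Union>c\<in>I. cdom c) = S" by (rule finite_chart_cover)
  obtain e and m :: nat where e: "I = e ` {..<m}"
    using I(1) by (metis finite_imp_nat_seg_image_inj_on lessThan_def)
  have eB: "e i \<in> \<B>" if "i < m" for i using that I(2) e by auto
  \<comment> \<open>A point of \<open>S\<close> belongs to the piece of the first chart that contains it.\<close>
  define A where "A i = cdom (e i) - (\<Union>j<i. cdom (e j))" for i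
  have A: "A i \<in> sets borel" if "i < m" for i
    using that eB by (auto simp: A_def intro!: sets.Diff sets.finite_UN dom_borel)
  have A_sub: "A i \<subseteq> cdom (e i)" for i by (auto simp: A_def)
  have A_UN: "(\<Union>i<m. A i) = S"
  proof -
    have "\<exists>i<m. p \<in> A i" if "p \<in> S" for p
    proof -
      have "\<exists>i. i < m \<and> p \<in> cdom (e i)" using that I(3) unfolding e by blast
      then obtain i where i: "i < m" "p \<in> cdom (e i)" "\<And>j. j < i \<Longrightarrow> \<not> (j < m \<and> p \<in> cdom (e j))"
        using exists_least_iff[of "\<lambda>i. i < m \<and> p \<in> cdom (e i)"] by blast
      have "p \<notin> (\<Union>j<i. cdom (e j))" using i(1,3) by fastforce
      then have "p \<in> A i" using i(2) by (simp add: A_def)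
      with i(1) show ?thesis by blast
    qed
    moreover have "A i \<subseteq> S" if "i < m" for i
      using A_sub dom_sub[OF eB[OF that]] by (rule subset_trans)
    ultimately show ?thesis by fast
  qed
  have A_disj: "A i \<inter> A j = {}" if "i \<noteq> j" for i j
    using that unfolding A_def by (cases i j rule: linorder_cases) blast+
  define \<mu> where "\<mu> E = (\<Sum>i<m. emeasure (chart_measure (e i)) (E \<inter> A i))" for E
  define N where "N = measure_of S (sets (restrict_space borel S)) \<mu>"
  have sets_N: "sets N = sets (restrict_space borel S)"
    unfolding N_def using sets.space_closed[of "restrict_space borel S"] sets.sigma_sets_eq[of "restrict_space borel S"]
    by (subst sets_measure_of) (auto simp: space_restrict_space)
  have EA: "E \<inter> A i \<in> sets (restrict_space borel S)" if "E \<in> sets (restrict_space borel S)" "i < m" for E i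
    using that A by (auto simp: sets_iff)
  have emeasure_N: "emeasure N E = \<mu> E" if E: "E \<in> sets (restrict_space borel S)" for E
  proof (rule emeasure_measure_of[OF N_def])
    show "sets (restrict_space borel S) \<subseteq> Pow S" by (auto simp: sets_iff)
    show "E \<in> sets N" using E sets_N by simp
    show "positive (sets N) \<mu>" by (auto simp: positive_def \<mu>_def)
    show "countably_additive (sets N) \<mu>"
    proof (rule countably_additiveI)
      fix F :: "nat \<Rightarrow> 'a set"
      assume F: "range F \<subseteq> sets N" "disjoint_family F"
      have "(\<Sum>n. \<mu> (F n)) = (\<Sum>i<m. \<Sum>n. emeasure (chart_measure (e i)) (F n \<inter> A i))"
        unfolding \<mu>_def by (rule suminf_sum) auto
      also have "\<dots> = (\<Sum>i<m. emeasure (chart_measure (e i)) (\<Union>n. F n \<inter> A i))"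
        using F EA sets_N
        by (intro sum.cong suminf_emeasure) (auto simp: disjoint_family_on_def)
      finally show "(\<Sum>n. \<mu> (F n)) = \<mu> (\<Union> (range F))" by (simp add: \<mu>_def)
    qed
  qed
  have "emeasure N E = (\<integral>\<^sup>+x\<in>cmap c ` E. ennreal (dens c x) \<partial>lborel)"
    if c: "c \<in> \<B>" and E: "E \<in> sets N" "E \<subseteq> cdom c" for c E
  proof -
    have Es: "E \<in> sets (restrict_space borel S)" using E sets_N by simp
    have "emeasure N E = (\<Sum>i<m. emeasure (chart_measure (e i)) (E \<inter> A i))"
      using emeasure_N[OF Es] by (simp add: \<mu>_def)
    also have "\<dots> = (\<Sum>i<m. emeasure (chart_measure c) (E \<inter> A i))"
    proof (rule sum.cong[OF refl])
      fix i assume i: "i \<in> {..<m}"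
      have "E \<inter> A i \<inter> cdom (e i) = E \<inter> A i" "E \<inter> A i \<inter> cdom c = E \<inter> A i"
        using A_sub E(2) by auto
      then show "emeasure (chart_measure (e i)) (E \<inter> A i) = emeasure (chart_measure c) (E \<inter> A i)"
        using i c eB EA[OF Es] E(2) A_sub
        by (simp add: emeasure_chart_measure)
          (intro chart_measure_agree, auto simp: sets_iff)
    qed
    also have "\<dots> = emeasure (chart_measure c) (\<Union>i<m. E \<inter> A i)"
      using EA[OF Es] A_disj by (intro sum_emeasure) (auto simp: disjoint_family_on_def)
    also have "(\<Union>i<m. E \<inter> A i) = E" using A_UN Es by (auto simp: sets_iff)
    finally show ?thesis using emeasure_chart_measure[OF c Es] E(2) by (simp add: Int_absorb2)
  qed
  then show ?thesis using sets_N by blast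
qed

text \<open>A measure on \<open>S\<close> is determined by its values inside chart domains, because finitely many of
  these cover \<open>S\<close>.\<close>

lemma riemannian_measure_unique:
  assumes N: "sets N = sets (restrict_space borel S)"
      "\<And>c E. c \<in> \<B> \<Longrightarrow> E \<in> sets N \<Longrightarrow> E \<subseteq> cdom c \<Longrightarrow> emeasure N E = \<mu> c E"
    and N': "sets N' = sets (restrict_space borel S)"
      "\<And>c E. c \<in> \<B> \<Longrightarrow> E \<in> sets N' \<Longrightarrow> E \<subseteq> cdom c \<Longrightarrow> emeasure N' E = \<mu> c E"
  shows "N = N'"
proof (rule measure_eqI)
  show "sets N = sets N'" using N N' by simp
next
  fix E assume E: "E \<in> sets N"
  obtain I where I: "finite I" "I \<subseteq> \<B>" "(\<Union>c\<in>I. cdom c) = S" by (rule finite_chart_cover)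
  have "emeasure N (E \<inter> (\<Union>c\<in>I. cdom c)) = emeasure N' (E \<inter> (\<Union>c\<in>I. cdom c))"
    using I(1,2)
  proof (induction I rule: finite_induct)
    case (insert c I)
    have c: "c \<in> \<B>" using insert by simp
    let ?U = "E \<inter> (\<Union>c\<in>I. cdom c)" and ?C = "E \<inter> cdom c - (\<Union>c\<in>I. cdom c)"
    have sets: "?U \<in> sets (restrict_space borel S)" "?C \<in> sets (restrict_space borel S)"
    proof -
      have "(\<Union>c\<in>I. cdom c) \<in> sets borel"
        using insert by (intro sets.finite_UN) (blast intro: dom_borel)+
      then show "?U \<in> sets (restrict_space borel S)" "?C \<in> sets (restrict_space borel S)"
        using E N(1) dom_borel[OF c] unfolding sets_iff by (simp_all add: sets_iff) blast+
    qed
    have split: "E \<inter> (\<Union>c\<in>insert c I. cdom c) = ?U \<union> ?C" by auto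
    have "emeasure P (?U \<union> ?C) = emeasure P ?U + emeasure P ?C"
      if "sets P = sets (restrict_space borel S)" for P
      using sets that by (intro plus_emeasure[symmetric]) auto
    moreover have "emeasure N ?C = emeasure N' ?C"
    proof -
      have "?C \<subseteq> cdom c" by blast
      then show ?thesis using N(2)[OF c, of ?C] N'(2)[OF c, of ?C] N(1) N'(1) sets by simp
    qed
    ultimately show ?case unfolding split using N(1) N'(1) insert by simp
  qed simp
  moreover have "E \<inter> (\<Union>c\<in>I. cdom c) = E" using E N(1) I(3) by (auto simp: sets_iff)
  ultimately show "emeasure N E = emeasure N' E" by simp
qed

definition dA :: "'a measure" where
  "dA = riemannian_measure S \<B> h"

lemma sets_dA: "sets dA = sets (restrict_space borel S)"
  and emeasure_dA: "c \<in> \<B> \<Longrightarrow> E \<in> sets dA \<Longrightarrow> E \<subseteq> cdom c \<Longrightarrow>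
        emeasure dA E = (\<integral>\<^sup>+x\<in>cmap c ` E. ennreal (dens c x) \<partial>lborel)"
proof -
  let ?P = "\<lambda>N. sets N = sets (restrict_space borel S) \<and>
     (\<forall>c\<in>\<B>. \<forall>E\<in>sets N. E \<subseteq> cdom c \<longrightarrow>
        emeasure N E = (\<integral>\<^sup>+x\<in>cmap c ` E. ennreal (dens c x) \<partial>lborel))"
  obtain N where "?P N" using riemannian_measure_exists by blast
  moreover have "N' = N" if "?P N'" for N'
    by (rule riemannian_measure_unique[where \<mu> = "\<lambda>c E. \<integral>\<^sup>+x\<in>cmap c ` E. ennreal (dens c x) \<partial>lborel"])
      (use that \<open>?P N\<close> in blast)+
  ultimately have "?P (The ?P)" by (rule theI)
  also have "The ?P = dA" by (simp add: dA_def riemannian_measure_def dens_def)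
  finally show "sets dA = sets (restrict_space borel S)"
    "c \<in> \<B> \<Longrightarrow> E \<in> sets dA \<Longrightarrow> E \<subseteq> cdom c \<Longrightarrow>
        emeasure dA E = (\<integral>\<^sup>+x\<in>cmap c ` E. ennreal (dens c x) \<partial>lborel)"
    by blast+
qed

lemma space_dA: "space dA = S"
  using sets_eq_imp_space_eq[OF sets_dA] by (simp add: space_restrict_space)

lemma chart_measure_eq_density:
  assumes c: "c \<in> \<B>"
  shows "chart_measure c = density dA (\<lambda>p. ennreal (indicator (cdom c) p))"
proof (rule measure_eqI)
  show "sets (chart_measure c) = sets (density dA (\<lambda>p. ennreal (indicator (cdom c) p)))"
    by (simp add: sets_dA)
next
  have dom: "cdom c \<in> sets dA" using dom_sub dom_borel c by (simp add: sets_dA sets_iff)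
  fix E assume "E \<in> sets (chart_measure c)"
  then have E: "E \<in> sets dA" by (simp add: sets_dA)
  have "emeasure (density dA (\<lambda>p. ennreal (indicator (cdom c) p))) E =
      (\<integral>\<^sup>+p. ennreal (indicator (cdom c) p) * indicator E p \<partial>dA)"
    using dom E by (intro emeasure_density) auto
  also have "\<dots> = (\<integral>\<^sup>+p. indicator (E \<inter> cdom c) p \<partial>dA)"
    by (rule nn_integral_cong) (simp split: split_indicator)
  also have "\<dots> = emeasure dA (E \<inter> cdom c)" using dom E by simp
  also have "\<dots> = emeasure (chart_measure c) E"
    using emeasure_dA[OF c, of "E \<inter> cdom c"] dom E emeasure_chart_measure[OF c, of E] by (auto simp: sets_dA)
  finally show "emeasure (chart_measure c) E = emeasure (density dA (\<lambda>p. ennreal (indicator (cdom c) p))) E"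
    by simp
qed

lemma integral_in_chart:
  fixes \<psi> :: "'a \<Rightarrow> real"
  assumes c: "c \<in> \<B>" and \<psi>: "\<psi> \<in> borel_measurable dA" and supp: "\<And>p. p \<in> S \<Longrightarrow> p \<notin> cdom c \<Longrightarrow> \<psi> p = 0"
  shows "(LINT p|dA. \<psi> p) = (LINT x:cmap c ` cdom c|lborel. dens c x * \<psi> (cinv c x))"
proof -
  have dom: "cdom c \<in> sets dA" using dom_sub dom_borel c by (simp add: sets_dA sets_iff)
  have \<psi>': "\<psi> \<in> borel_measurable (restrict_space borel S)"
    using \<psi> by (simp cong: measurable_cong_sets add: sets_dA)
  have "(LINT p|dA. \<psi> p) = (LINT p|dA. indicator (cdom c) p *\<^sub>R \<psi> p)"
    using supp by (intro Bochner_Integration.integral_cong) (auto simp: space_dA indicator_def)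
  also have "\<dots> = (LINT p|chart_measure c. \<psi> p)"
    unfolding chart_measure_eq_density[OF c] using dom \<psi> by (intro integral_density[symmetric]) auto
  also have "\<dots> = (LINT x|density (restrict_space lborel (cmap c ` cdom c)) (\<lambda>x. ennreal (dens c x)). \<psi> (cinv c x))"
    unfolding chart_measure_def
    by (rule integral_distr[OF _ \<psi>']) (simp add: cinv_measurable[OF c])
  also have "\<dots> = (LINT x|restrict_space lborel (cmap c ` cdom c). dens c x *\<^sub>R \<psi> (cinv c x))"
  proof (rule integral_density[OF measurable_compose[OF cinv_measurable[OF c] \<psi>'] dens_measurable[OF c]], rule AE_I2)
    fix x assume "x \<in> space (restrict_space lborel (cmap c ` cdom c))"
    then show "0 \<le> dens c x" using dens_pos[OF c, of x] by (simp add: space_restrict_space)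
  qed
  also have "\<dots> = (LINT x:cmap c ` cdom c|lborel. dens c x * \<psi> (cinv c x))"
    unfolding set_lebesgue_integral_def using image_open[OF c] by (subst integral_restrict_space) auto
  finally show ?thesis .
qed

end

section \<open>The divergence of a vector field\<close>

text \<open>Translation invariance gives \<open>\<integral>(f(x + t v) - f(x)) dx = 0\<close> for all \<open>t\<close>; dividing by \<open>t\<close> and
  letting \<open>t \<longlongrightarrow> 0\<close> under the integral proves this without Fubini's theorem.\<close>

lemma integral_directional_derivative:
  fixes f :: "'b::euclidean_space \<Rightarrow> real"
  assumes f: "Ck_on 1 UNIV f" and K: "compact K" and supp: "\<And>x. x \<notin> K \<Longrightarrow> f x = 0"
  shows "integrable lborel (\<lambda>x. frechet_derivative f (at x) v)"
    and "integral\<^sup>L lborel (\<lambda>x. frechet_derivative f (at x) v) = 0"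
proof -
  let ?g = "\<lambda>x. frechet_derivative f (at x) v"
  have f1: "Ck_on (Suc 0) UNIV f" using f by simp
  have cont_f: "continuous_on UNIV f" and cont_g: "continuous_on UNIV ?g"
    using Ck_on_imp_continuous_on[OF f] f by auto
  have g0: "?g x = 0" if "x \<notin> K" for x
  proof -
    have "(f has_derivative (\<lambda>_. 0)) (at x)"
      by (rule has_derivative_cong_open[OF has_derivative_const[of 0] open_Compl[OF compact_imp_closed[OF K]]])
        (use that supp in auto)
    from frechet_derivative_at[OF this] show ?thesis by metis
  qed
  have integrable_K: "integrable lborel u" if "continuous_on UNIV u" "\<And>x. x \<notin> K \<Longrightarrow> u x = 0" for u :: "'b \<Rightarrow> real"
  proof -
    have "(\<lambda>x. indicator K x *\<^sub>R u x) = u"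
      by (rule ext) (simp add: that(2) split: split_indicator)
    with borel_integrable_compact[OF K continuous_on_subset[OF that(1)]] show ?thesis by simp
  qed
  show int_g: "integrable lborel ?g" by (rule integrable_K[OF cont_g g0])
  obtain B where B: "\<And>x. \<bar>?g x\<bar> \<le> B"
  proof -
    obtain B where "\<forall>x\<in>K. norm (?g x) \<le> B"
      using compact_imp_bounded[OF compact_continuous_image[OF continuous_on_subset[OF cont_g] K]]
      unfolding bounded_iff by auto
    then have "\<bar>?g x\<bar> \<le> max B 0" for x
      using g0[of x] by (cases "x \<in> K") (simp_all add: max.coboundedI1)
    then show ?thesis by (rule that)
  qed
  define t where "t n = inverse (real (Suc n))" for n
  have t: "0 < t n" "t n \<le> 1" for n by (auto simp: t_def inverse_le_1_iff)
  have t_lim: "filterlim t (at 0) sequentially"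
  proof (rule filterlim_atI)
    show "t \<longlonglongrightarrow> 0" unfolding t_def[abs_def] by (rule LIMSEQ_inverse_real_of_nat)
  qed (simp add: t_def)
  have deriv: "((\<lambda>s. f (x + s *\<^sub>R v)) has_real_derivative ?g (x + s *\<^sub>R v)) (at s)" for x s
    unfolding has_real_derivative_iff_has_vector_derivative has_vector_derivative_def
  proof (rule has_derivative_eq_rhs)
    show "((\<lambda>s. f (x + s *\<^sub>R v)) has_derivative
        (\<lambda>r. frechet_derivative f (at (x + s *\<^sub>R v)) (r *\<^sub>R v))) (at s)"
      by (rule has_derivative_compose[of "\<lambda>s. x + s *\<^sub>R v" _ s UNIV f, OF _ Ck_on_has_derivative[OF f1]])
        (auto intro!: derivative_eq_intros)
  qed (simp add: linear_scale[OF has_derivative_linear[OF Ck_on_has_derivative[OF f1 UNIV_I]]])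
  define D where "D n x = (f (x + t n *\<^sub>R v) - f x) / t n" for n x
  have D_lim: "(\<lambda>n. D n x) \<longlonglongrightarrow> ?g x" for x
    using filterlim_compose[OF deriv[of x 0, unfolded has_field_derivative_iff] t_lim]
    by (simp add: D_def)
  \<comment> \<open>A compact set outside which all difference quotients vanish.\<close>
  define K' where "K' = (\<lambda>(x, s). x - s *\<^sub>R v) ` (K \<times> {0..1})"
  have K': "compact K'"
    unfolding K'_def using K
    by (intro compact_continuous_image compact_Times)
      (auto intro!: continuous_intros simp: case_prod_beta)
  have D_bound: "norm (D n x) \<le> B * indicator K' x" for n x
  proof (cases "x \<in> K'")
    case True
    have "\<exists>z>0. z < t n \<and> f (x + t n *\<^sub>R v) - f (x + 0 *\<^sub>R v) = (t n - 0) * ?g (x + z *\<^sub>R v)"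
      by (rule MVT2[OF t(1) deriv])
    then obtain z where "f (x + t n *\<^sub>R v) - f x = t n * ?g (x + z *\<^sub>R v)" by auto
    then have "D n x = ?g (x + z *\<^sub>R v)" using t(1)[of n] by (simp add: D_def)
    then show ?thesis using B True by simp
  next
    case False
    have "x \<notin> K" using False by (force simp: K'_def image_iff)
    moreover have "x + t n *\<^sub>R v \<notin> K"
    proof
      assume "x + t n *\<^sub>R v \<in> K"
      then have "(\<lambda>(x, s). x - s *\<^sub>R v) (x + t n *\<^sub>R v, t n) \<in> K'"
        unfolding K'_def using t[of n] by (intro imageI) auto
      with False show False by simp
    qed
    ultimately show ?thesis using False supp by (simp add: D_def)
  qed
  have int_D: "integral\<^sup>L lborel (D n) = 0" for n
  proof -
    let ?a = "t n *\<^sub>R v"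
    have int_f: "integrable lborel f" by (rule integrable_K[OF cont_f supp])
    have meas: "f \<in> borel_measurable borel" using cont_f by (rule borel_measurable_continuous_onI)
    have d: "distr lborel borel ((+) ?a) = lborel" by (rule lborel_distr_plus)
    have "integrable (distr lborel borel ((+) ?a)) f" using int_f d by simp
    then have int_s: "integrable lborel (\<lambda>x. f (?a + x))"
      using meas by (subst (asm) integrable_distr_eq) auto
    have "integral\<^sup>L (distr lborel borel ((+) ?a)) f = integral\<^sup>L lborel (\<lambda>x. f (?a + x))"
      using meas by (intro integral_distr) auto
    then have "integral\<^sup>L lborel (\<lambda>x. f (?a + x)) = integral\<^sup>L lborel f" using d by simp
    then show ?thesis using int_f int_s by (simp add: D_def[abs_def] add.commute)
  qed
  have "(\<lambda>n. integral\<^sup>L lborel (D n)) \<longlonglongrightarrow> integral\<^sup>L lborel ?g"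
  proof (rule integral_dominated_convergence[where w = "\<lambda>x. B * indicator K' x"])
    show "D n \<in> borel_measurable lborel" for n
      unfolding D_def[abs_def]
      by (intro borel_measurable_divide borel_measurable_diff borel_measurable_const)
        (auto intro!: borel_measurable_continuous_onI continuous_on_compose2[OF cont_f] continuous_intros)
    show "?g \<in> borel_measurable lborel" using int_g by auto
    show "integrable lborel (\<lambda>x. B * indicator K' x)"
      using borel_integrable_compact[OF K', of "\<lambda>_. B"] by (simp add: mult.commute)
  qed (use D_lim D_bound in auto)
  then show "integral\<^sup>L lborel ?g = 0" unfolding int_D by (simp add: LIMSEQ_const_iff)
qed

lemma matrix_inv_eqI:
  fixes A :: "real ^ 'n ^ 'n"
  assumes "A ** B = mat 1" "B ** A = mat 1"
  shows "matrix_inv A = B"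
proof -
  have "A ** matrix_inv A = mat 1 \<and> matrix_inv A ** A = mat 1"
    unfolding matrix_inv_def by (rule someI_ex) (use assms in blast)
  then have "matrix_inv A = matrix_inv A ** (A ** B)" using assms by simp
  also have "\<dots> = B" using \<open>_ \<and> _\<close> by (simp add: matrix_mul_assoc)
  finally show ?thesis .
qed

lemma matrix_inv_2:
  fixes A :: "real ^ 2 ^ 2"
  assumes "det A \<noteq> 0"
  shows "matrix_inv A = vector [vector [A $ 2 $ 2 / det A, - A $ 1 $ 2 / det A],
    vector [- A $ 2 $ 1 / det A, A $ 1 $ 1 / det A]]"
  by (rule matrix_inv_eqI)
    (use assms in \<open>simp_all add: vec_eq_iff forall_2 matrix_matrix_mult_def sum_2 mat_def field_simps, simp_all add: det_2 field_simps\<close>)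

lemma pd_det_2:
  fixes A :: "'a::topological_space \<Rightarrow> real ^ 2 ^ 2"
  assumes c: "is_chart S c" "p \<in> cdom c" and A: "\<And>k i. chart_diff c (\<lambda>q. A q $ k $ i) p"
  shows "pd c j (\<lambda>q. det (A q)) p = pd c j (\<lambda>q. A q $ 1 $ 1) p * A p $ 2 $ 2 + A p $ 1 $ 1 * pd c j (\<lambda>q. A q $ 2 $ 2) p
    - pd c j (\<lambda>q. A q $ 1 $ 2) p * A p $ 2 $ 1 - A p $ 1 $ 2 * pd c j (\<lambda>q. A q $ 2 $ 1) p"
proof -
  note m = pd_mult[OF c]
  have d: "chart_diff c (\<lambda>q. A q $ 1 $ 1 * A q $ 2 $ 2) p" "chart_diff c (\<lambda>q. (- 1) * A q $ 1 $ 2 * A q $ 2 $ 1) p"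
    "chart_diff c (\<lambda>q. (- 1) * A q $ 1 $ 2) p" "chart_diff c (\<lambda>q. - 1 :: real) p"
    using A by (auto simp: o_def intro!: differentiable_mult)
  have "pd c j (\<lambda>q. det (A q)) p = pd c j (\<lambda>q. A q $ 1 $ 1 * A q $ 2 $ 2 + (- 1) * A q $ 1 $ 2 * A q $ 2 $ 1) p"
    by (simp add: det_2)
  also have "\<dots> = pd c j (\<lambda>q. A q $ 1 $ 1) p * A p $ 2 $ 2 + A p $ 1 $ 1 * pd c j (\<lambda>q. A q $ 2 $ 2) p
     + (((- 1) * pd c j (\<lambda>q. A q $ 1 $ 2) p) * A p $ 2 $ 1 + (- 1) * A p $ 1 $ 2 * pd c j (\<lambda>q. A q $ 2 $ 1) p)"
    by (simp only: pd_add[OF d(1,2)] m[OF A A] m[OF d(3) A] m[OF d(4) A] pd_const mult_zero_left add_0_left)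
  finally show ?thesis by simp
qed

lemma pd_sqrt:
  assumes c: "is_chart S c" "p \<in> cdom c" and "chart_diff c f p" "f p > 0"
  shows "pd c i (\<lambda>q. sqrt (f q)) p = pd c i f p / (2 * sqrt (f p))"
proof -
  have D: "(f \<circ> cinv c has_derivative frechet_derivative (f \<circ> cinv c) (at (cmap c p))) (at (cmap c p))"
    using assms(3) frechet_derivative_works by blast
  have "((\<lambda>q. sqrt (f q)) \<circ> cinv c has_derivative
      (\<lambda>v. frechet_derivative (f \<circ> cinv c) (at (cmap c p)) v * (inverse (sqrt (f p)) / 2))) (at (cmap c p))"
    unfolding o_def
    by (rule has_derivative_eq_rhs, rule has_derivative_real_sqrt[OF _ D[unfolded o_def]])
      (use assms cinv_cmap[OF c] in \<open>simp_all add: o_def\<close>)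
  from pd_eq[OF this] show ?thesis by (simp add: pd_def field_simps)
qed

context closed_riemannian_surface
begin

lemma h_21: "c \<in> \<B> \<Longrightarrow> p \<in> cdom c \<Longrightarrow> h c p $ 2 $ 1 = h c p $ 1 $ 2"
  using arg_cong[OF h_sym, of c p "\<lambda>A. A $ 1 $ 2"] by (simp add: transpose_def)

lemma h_diff: "c \<in> \<B> \<Longrightarrow> p \<in> cdom c \<Longrightarrow> chart_diff c (\<lambda>q. h c q $ i $ j) p"
  by (rule Ck_on_chart_diff[OF h_Ck_entry[of c 1, unfolded One_nat_def]]) auto

lemma det_h_diff: "c \<in> \<B> \<Longrightarrow> p \<in> cdom c \<Longrightarrow> chart_diff c (\<lambda>q. det (h c q)) p"
  by (rule Ck_on_chart_diff[OF det_h_Ck[of c 1, unfolded One_nat_def]]) auto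

lemma pd_det_h:
  assumes c: "c \<in> \<B>" "p \<in> cdom c"
  shows "pd c j (\<lambda>q. det (h c q)) p = h c p $ 2 $ 2 * pd c j (\<lambda>q. h c q $ 1 $ 1) p
    + h c p $ 1 $ 1 * pd c j (\<lambda>q. h c q $ 2 $ 2) p - 2 * h c p $ 1 $ 2 * pd c j (\<lambda>q. h c q $ 1 $ 2) p"
proof -
  have "pd c j (\<lambda>q. h c q $ 2 $ 1) p = pd c j (\<lambda>q. h c q $ 1 $ 2) p"
    by (rule pd_cong_dom[OF chart_S[OF c(1)] c(2)]) (rule h_21[OF c(1)])
  then show ?thesis
    using pd_det_2[OF chart_S[OF c(1)] c(2) h_diff[OF c], of j] by (simp add: h_21[OF c] algebra_simps)
qed

lemma ginv_h:
  assumes c: "c \<in> \<B>" "p \<in> cdom c"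
  shows "ginv h c p $ 1 $ 1 = h c p $ 2 $ 2 / det (h c p)" "ginv h c p $ 2 $ 2 = h c p $ 1 $ 1 / det (h c p)"
    "ginv h c p $ 1 $ 2 = - h c p $ 1 $ 2 / det (h c p)" "ginv h c p $ 2 $ 1 = - h c p $ 1 $ 2 / det (h c p)"
  using det_h_pos[OF c] h_21[OF c] by (simp_all add: ginv_def matrix_inv_2)

text \<open>Two of the three derivatives in the Christoffel symbol cancel by symmetry; the remaining trace
  is Jacobi's formula for the derivative of a determinant.\<close>

lemma christoffel_trace:
  assumes c: "c \<in> \<B>" "p \<in> cdom c"
  shows "(\<Sum>i\<in>UNIV. christoffel h c i i j p) = pd c j (\<lambda>q. det (h c q)) p / (2 * det (h c p))"
proof -
  have s: "pd c i (\<lambda>q. h c q $ 2 $ 1) p = pd c i (\<lambda>q. h c q $ 1 $ 2) p" for i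
    by (rule pd_cong_dom[OF chart_S[OF c(1)] c(2)]) (rule h_21[OF c(1)])
  have "j = 1 \<or> j = 2" by (rule exhaust_2)
  then show ?thesis
    using det_h_pos[OF c]
    by (elim disjE) (simp_all add: christoffel_def sum_2 s ginv_h[OF c] pd_det_h[OF c] field_simps)
qed

lemma div_vfield_eq:
  assumes c: "c \<in> \<B>" "p \<in> cdom c"
  shows "div_vfield h V c p = (\<Sum>i\<in>UNIV. pd c i (\<lambda>q. V c q $ i) p) +
    (\<Sum>j\<in>UNIV. V c p $ j * pd c j (\<lambda>q. det (h c q)) p) / (2 * det (h c p))"
proof -
  have "div_vfield h V c p = (\<Sum>i\<in>UNIV. pd c i (\<lambda>q. V c q $ i) p) +
      (\<Sum>i\<in>UNIV. \<Sum>j\<in>UNIV. christoffel h c i i j p * V c p $ j)"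
    by (simp add: div_vfield_def sum.distrib)
  also have "(\<Sum>i\<in>UNIV. \<Sum>j\<in>UNIV. christoffel h c i i j p * V c p $ j) =
      (\<Sum>j\<in>UNIV. (\<Sum>i\<in>UNIV. christoffel h c i i j p) * V c p $ j)"
    by (subst sum.swap) (simp add: sum_distrib_right)
  finally show ?thesis
    by (simp add: christoffel_trace[OF c] sum_divide_distrib mult.commute)
qed

text \<open>The linear algebra of the next lemma, with \<open>Jki\<close> for the Jacobian, \<open>akij\<close> for its (symmetric)
  derivatives, \<open>vij\<close> for the derivatives of the components in the old chart and \<open>Ekl\<close> in the new.\<close>

lemma div_transformation_algebra:
  fixes a111 :: real
  assumes e: "J11 * E11 + J21 * E12 = a111 * V1 + J11 * v11 + a112 * V2 + J12 * v12"
    "J12 * E11 + J22 * E12 = a112 * V1 + J11 * v21 + a122 * V2 + J12 * v22"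
    "J11 * E21 + J21 * E22 = a211 * V1 + J21 * v11 + a212 * V2 + J22 * v12"
    "J12 * E21 + J22 * E22 = a212 * V1 + J21 * v21 + a222 * V2 + J22 * v22"
  shows "(J11 * J22 - J12 * J21) * (v11 + v22)
      + V1 * (a111 * J22 + J11 * a212 - a112 * J21 - J12 * a211)
      + V2 * (a112 * J22 + J11 * a222 - a122 * J21 - J12 * a212) = (J11 * J22 - J12 * J21) * (E11 + E22)"
proof -
  have "(J11 * J22 - J12 * J21) * (E11 + E22) =
      J22 * (J11 * E11 + J21 * E12) - J21 * (J12 * E11 + J22 * E12)
      + J11 * (J12 * E21 + J22 * E22) - J12 * (J11 * E21 + J21 * E22)" by algebra
  then show ?thesis unfolding e by (simp add: algebra_simps)
qed

text \<open>Differentiating the transformation law \<open>V\<^sub>d = (jac c d) V\<^sub>c\<close> produces second derivatives of the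
  change of coordinates. Since these are symmetric, their trace is the logarithmic derivative of
  the Jacobian determinant, which cancels against the one coming from
  \<open>det h\<^sub>c = (det (jac c d))\<^sup>2 det h\<^sub>d\<close>.\<close>

lemma div_vfield_chart_independent:
  assumes V: "Ck_vfield 1 \<B> V" and c: "c \<in> \<B>" "p \<in> cdom c" and d: "d \<in> \<B>" "p \<in> cdom d"
  shows "div_vfield h V c p = div_vfield h V d p"
proof -
  let ?J = "\<lambda>k i. jac c d p $ k $ i"
  let ?W = "cdom d \<inter> cdom c"
  let ?a = "\<lambda>k i j. pd c i (\<lambda>q. jac c d q $ k $ j) p"
  have V': "Ck_vfield (Suc 0) \<B> V" using V by simp
  note ch = chart_S[OF c(1)] c(2)
  note op = overlap_open[OF c(1) d(1)]
  have Wop: "openin (top_of_set S) (?W \<inter> S)"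
  proof -
    have "?W \<inter> S = (cdom c \<inter> S) \<inter> (cdom d \<inter> S)" by blast
    then show ?thesis using openin_Int[OF cdom_openin[OF c(1)] cdom_openin[OF d(1)]] by simp
  qed
  have Jd: "chart_diff c (\<lambda>q. jac c d q $ k $ i) p" for k i
    using jac_Ck_entry[OF c(1) d(1), of "Suc 0" k i] c d by (intro Ck_on_chart_diff[of 0 "cmap c ` ?W"]) (auto simp: o_def)
  have a_sym: "?a k i j = ?a k j i" for k i j
  proof -
    have "Ck_on 2 (cmap c ` ?W) ((\<lambda>q. cmap d q $ k) \<circ> cinv c)"
      using Ck_on_bounded_linear_comp[OF bounded_linear_vec_nth op inclusion_Ck[OF c(1) d(1)]] by (simp add: o_def)
    from pd_commute[OF ch(1) op _ _ this, of p i j] c d show ?thesis by (simp add: jac_def)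
  qed
  have Vc: "chart_diff c (\<lambda>q. V c q $ j) p" for j using Ck_vfield_chart_diff[OF V' c] .
  have Vd: "chart_diff d (\<lambda>q. V d q $ j) p" for j using Ck_vfield_chart_diff[OF V' d] .
  have JV: "chart_diff c (\<lambda>q. jac c d q $ k $ j * V c q $ j) p" for k j
    using differentiable_mult[OF Jd[of k j] Vc[of j]] by (simp add: o_def)
  have e: "(\<Sum>l\<in>UNIV. ?J l i * pd d l (\<lambda>q. V d q $ k) p) =
      (\<Sum>j\<in>UNIV. ?a k i j * V c p $ j + ?J k j * pd c i (\<lambda>q. V c q $ j) p)" for i k
  proof -
    have "(\<Sum>l\<in>UNIV. ?J l i * pd d l (\<lambda>q. V d q $ k) p) = pd c i (\<lambda>q. V d q $ k) p"
      by (rule pd_chain[OF c(1) d(1) c(2) d(2) Vd, symmetric])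
    also have "\<dots> = pd c i (\<lambda>q. \<Sum>j\<in>UNIV. jac c d q $ k $ j * V c q $ j) p"
    proof (rule pd_cong[OF ch Wop])
      show "p \<in> ?W" using c d by simp
      fix q assume "q \<in> ?W \<inter> cdom c"
      then have "V d q = jac c d q *v V c q" using V c(1) d(1) unfolding Ck_vfield_def by blast
      then show "V d q $ k = (\<Sum>j\<in>UNIV. jac c d q $ k $ j * V c q $ j)"
        by (simp add: matrix_vector_mult_def)
    qed
    also have "\<dots> = (\<Sum>j\<in>UNIV. ?a k i j * V c p $ j + ?J k j * pd c i (\<lambda>q. V c q $ j) p)"
      by (subst pd_sum) (auto intro!: sum.cong pd_mult[OF ch] JV Jd Vc)
    finally show ?thesis .
  qed
  have dJ: "chart_diff c (\<lambda>q. det (jac c d q)) p"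
    using Jd by (auto simp: det_2 o_def intro!: differentiable_diff differentiable_mult)
  have pdJ: "pd c j (\<lambda>q. det (jac c d q)) p =
      ?a 1 j 1 * ?J 2 2 + ?J 1 1 * ?a 2 j 2 - ?a 1 j 2 * ?J 2 1 - ?J 1 2 * ?a 2 j 1" for j
    by (rule pd_det_2[OF ch Jd])
  let ?D = "det (jac c d p)"
  have D: "?D \<noteq> 0" by (rule jac_det_nonzero[OF c(1) d(1) c(2) d(2)])
  have hd: "det (h d p) > 0" by (rule det_h_pos[OF d])
  have dhd: "chart_diff c (\<lambda>q. det (h d q)) p"
    using chain_has_derivative[OF c(1) d(1) c(2) d(2)] det_h_diff[OF d] unfolding differentiable_def by blast
  have pdh: "pd c j (\<lambda>q. det (h c q)) p = 2 * ?D * pd c j (\<lambda>q. det (jac c d q)) p * det (h d p)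
      + ?D * ?D * (\<Sum>l\<in>UNIV. ?J l j * pd d l (\<lambda>q. det (h d q)) p)" for j
  proof -
    have dd: "chart_diff c (\<lambda>q. det (jac c d q) * det (jac c d q)) p"
      using differentiable_mult[OF dJ dJ] by (simp add: o_def)
    have "pd c j (\<lambda>q. det (h c q)) p = pd c j (\<lambda>q. det (jac c d q) * det (jac c d q) * det (h d q)) p"
      by (rule pd_cong[OF ch Wop]) (use c d det_h_trans[OF c(1) d(1)] in \<open>auto simp: power2_eq_square\<close>)
    also have "\<dots> = (pd c j (\<lambda>q. det (jac c d q)) p * ?D + ?D * pd c j (\<lambda>q. det (jac c d q)) p) * det (h d p)
        + ?D * ?D * pd c j (\<lambda>q. det (h d q)) p"
      by (simp only: pd_mult[OF ch dd dhd] pd_mult[OF ch dJ dJ])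
    finally show ?thesis
      using pd_chain[OF c(1) d(1) c(2) d(2) det_h_diff[OF d], of j] by (simp add: algebra_simps)
  qed
  have hc: "det (h c p) = ?D * ?D * det (h d p)"
    using det_h_trans[OF c(1) d(1) c(2) d(2)] by (simp add: power2_eq_square)
  have VdV: "V d p = jac c d p *v V c p" using V c d unfolding Ck_vfield_def by blast
  have dens_part: "(\<Sum>j\<in>UNIV. V c p $ j * pd c j (\<lambda>q. det (h c q)) p) / (2 * det (h c p)) =
      (\<Sum>j\<in>UNIV. V c p $ j * pd c j (\<lambda>q. det (jac c d q)) p) / ?D
      + (\<Sum>l\<in>UNIV. V d p $ l * pd d l (\<lambda>q. det (h d q)) p) / (2 * det (h d p))"
    using D hd unfolding pdh hc VdV
    by (simp add: sum_2 matrix_vector_mult_def field_simps)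
  have "?D * ((\<Sum>i\<in>UNIV. pd c i (\<lambda>q. V c q $ i) p)) + (\<Sum>j\<in>UNIV. V c p $ j * pd c j (\<lambda>q. det (jac c d q)) p)
      = ?D * (\<Sum>l\<in>UNIV. pd d l (\<lambda>q. V d q $ l) p)"
    using div_transformation_algebra[of "?J 1 1" "pd d 1 (\<lambda>q. V d q $ 1) p" "?J 2 1" "pd d 2 (\<lambda>q. V d q $ 1) p"
      "?a 1 1 1" "V c p $ 1" "pd c 1 (\<lambda>q. V c q $ 1) p" "?a 1 1 2" "V c p $ 2" "?J 1 2" "pd c 1 (\<lambda>q. V c q $ 2) p"
      "?J 2 2" "pd c 2 (\<lambda>q. V c q $ 1) p" "?a 1 2 2" "pd c 2 (\<lambda>q. V c q $ 2) p"
      "pd d 1 (\<lambda>q. V d q $ 2) p" "pd d 2 (\<lambda>q. V d q $ 2) p" "?a 2 1 1" "?a 2 1 2" "?a 2 2 2"]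
      e[of 1 1] e[of 2 1] e[of 1 2] e[of 2 2] a_sym[where k = 1 and i = 2 and j = 1] a_sym[where k = 2 and i = 2 and j = 1]
    unfolding pdJ by (simp add: sum_2 det_2)
  then have "(\<Sum>i\<in>UNIV. pd c i (\<lambda>q. V c q $ i) p) + (\<Sum>j\<in>UNIV. V c p $ j * pd c j (\<lambda>q. det (jac c d q)) p) / ?D
      = (\<Sum>l\<in>UNIV. pd d l (\<lambda>q. V d q $ l) p)"
    using D by (simp add: field_simps)
  then show ?thesis
    unfolding div_vfield_eq[OF c] div_vfield_eq[OF d] dens_part by simp
qed

end

section \<open>The divergence theorem on a closed surface\<close>

lemma Ck_on_max_square:
  assumes "open U" "Ck_on 1 U f"
  shows "Ck_on 1 U (\<lambda>x. (max 0 (f x :: real))\<^sup>2)"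
proof -
  have sq: "((\<lambda>t::real. (max 0 t)\<^sup>2) has_real_derivative 2 * max 0 t) (at t)" for t
  proof -
    consider "t > 0" | "t < 0" | "t = 0" by linarith
    then show ?thesis
    proof cases
      case 1
      have "((\<lambda>t::real. t\<^sup>2) has_real_derivative 2 * max 0 t) (at t)"
        using 1 by (auto intro!: derivative_eq_intros)
      then show ?thesis
        by (rule DERIV_cong_ev[THEN iffD1, OF refl _ refl, rotated])
          (use 1 in \<open>auto intro!: eventually_nhds_in_open[of "{0<..}", THEN eventually_mono]\<close>)
    next
      case 2
      have "((\<lambda>t::real. 0) has_real_derivative 2 * max 0 t) (at t)"
        using 2 by simp
      then show ?thesis
        by (rule DERIV_cong_ev[THEN iffD1, OF refl _ refl, rotated])
          (use 2 in \<open>auto intro!: eventually_nhds_in_open[of "{..<0}", THEN eventually_mono]\<close>)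
    next
      case 3
      have "((\<lambda>s::real. (max 0 s)\<^sup>2 / s) \<longlongrightarrow> 0) (at 0)"
      proof (rule Lim_null_comparison)
        show "\<forall>\<^sub>F s in at 0. norm ((max 0 s)\<^sup>2 / s) \<le> \<bar>s :: real\<bar>"
          by (intro always_eventually allI) (auto simp: max_def power2_eq_square)
        show "((\<lambda>s::real. \<bar>s\<bar>) \<longlongrightarrow> 0) (at 0)" by (auto intro!: tendsto_eq_intros)
      qed
      then show ?thesis using 3 by (simp add: has_field_derivative_iff)
    qed
  qed
  have "continuous_on UNIV (\<lambda>t::real. max 0 t)" by (auto intro!: continuous_intros)
  then have "Ck_on 1 UNIV (\<lambda>t::real. (max 0 t)\<^sup>2)"
    unfolding One_nat_def
    by (intro Ck_on_SucI[where f' = "\<lambda>t v. v * (2 * max 0 t)"])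
      (use sq in \<open>auto simp: has_real_derivative_iff_has_vector_derivative has_vector_derivative_def
        intro!: continuous_intros\<close>)
  from Ck_on_comp[OF assms this] show ?thesis by simp
qed

context closed_riemannian_surface
begin

lemma Ck_fun_const: "Ck_fun k \<B> (\<lambda>p. a)"
  by (simp add: Ck_fun_def o_def Ck_on_const)

lemma Ck_fun_add:
  "Ck_fun k \<B> f \<Longrightarrow> Ck_fun k \<B> g \<Longrightarrow> Ck_fun k \<B> (\<lambda>p. f p + g p)"
  unfolding Ck_fun_def o_def using Ck_on_add[OF image_open] by blast

lemma Ck_fun_sum:
  "(\<And>i. i \<in> I \<Longrightarrow> Ck_fun k \<B> (f i)) \<Longrightarrow> Ck_fun k \<B> (\<lambda>p. \<Sum>i\<in>I. f i p)"
  by (induction I rule: infinite_finite_induct) (auto intro: Ck_fun_const Ck_fun_add)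

lemma Ck_fun_mult:
  fixes f g :: "'a \<Rightarrow> real"
  shows "Ck_fun k \<B> f \<Longrightarrow> Ck_fun k \<B> g \<Longrightarrow> Ck_fun k \<B> (\<lambda>p. f p * g p)"
  unfolding Ck_fun_def o_def using Ck_on_mult[OF image_open] by blast

lemma Ck_fun_divide:
  fixes f g :: "'a \<Rightarrow> real"
  assumes "Ck_fun k \<B> f" "Ck_fun k \<B> g" "\<And>p. p \<in> S \<Longrightarrow> g p \<noteq> 0"
  shows "Ck_fun k \<B> (\<lambda>p. f p / g p)"
  unfolding Ck_fun_def o_def
proof
  fix c assume c: "c \<in> \<B>"
  show "Ck_on k (cmap c ` cdom c) (\<lambda>x. f (cinv c x) / g (cinv c x))"
  proof (rule Ck_on_divide[OF image_open[OF c]])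
    show "g (cinv c x) \<noteq> 0" if "x \<in> cmap c ` cdom c" for x
      by (rule assms(3)) (use dom_sub[OF c] cinv_in[OF chart_S[OF c] that] in blast)
  qed (use assms(1,2) c in \<open>simp_all add: Ck_fun_def o_def\<close>)
qed

lemma Ck_fun_ln:
  fixes f :: "'a \<Rightarrow> real"
  assumes "Ck_fun k \<B> f" "\<And>p. p \<in> S \<Longrightarrow> f p > 0"
  shows "Ck_fun k \<B> (\<lambda>p. ln (f p))"
  unfolding Ck_fun_def o_def
proof
  fix c assume c: "c \<in> \<B>"
  show "Ck_on k (cmap c ` cdom c) (\<lambda>x. ln (f (cinv c x)))"
  proof (rule Ck_on_ln[OF image_open[OF c]])
    show "f (cinv c x) > 0" if "x \<in> cmap c ` cdom c" for x
      by (rule assms(2)) (use dom_sub[OF c] cinv_in[OF chart_S[OF c] that] in blast)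
  qed (use assms(1) c in \<open>simp add: Ck_fun_def o_def\<close>)
qed

lemma Ck_vfield_trans:
  "Ck_vfield k \<B> V \<Longrightarrow> c \<in> \<B> \<Longrightarrow> d \<in> \<B> \<Longrightarrow> p \<in> cdom c \<Longrightarrow> p \<in> cdom d \<Longrightarrow> V d p = jac c d p *v V c p"
  unfolding Ck_vfield_def by blast

lemma Ck_vfield_Ck_on: "Ck_vfield k \<B> V \<Longrightarrow> c \<in> \<B> \<Longrightarrow> Ck_on k (cmap c ` cdom c) (V c \<circ> cinv c)"
  unfolding Ck_vfield_def by blast

lemma Ck_vfieldI:
  "(\<And>c. c \<in> \<B> \<Longrightarrow> Ck_on k (cmap c ` cdom c) (V c \<circ> cinv c)) \<Longrightarrow>
   (\<And>c d p. c \<in> \<B> \<Longrightarrow> d \<in> \<B> \<Longrightarrow> p \<in> cdom c \<Longrightarrow> p \<in> cdom d \<Longrightarrow> V d p = jac c d p *v V c p) \<Longrightarrow> Ck_vfield k \<B> V"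
  unfolding Ck_vfield_def by blast

lemma Ck_vfield_scale:
  assumes \<psi>: "Ck_fun k \<B> \<psi>" and V: "Ck_vfield k \<B> V"
  shows "Ck_vfield k \<B> (\<lambda>c p. \<psi> p *\<^sub>R V c p)"
proof (rule Ck_vfieldI)
  fix c assume c: "c \<in> \<B>"
  show "Ck_on k (cmap c ` cdom c) ((\<lambda>p. \<psi> p *\<^sub>R V c p) \<circ> cinv c)"
    using Ck_on_scaleR[OF image_open[OF c], of k "\<psi> \<circ> cinv c" "V c \<circ> cinv c"] \<psi> c Ck_vfield_Ck_on[OF V c]
    by (simp add: Ck_fun_def o_def)
next
  fix c d p assume "c \<in> \<B>" "d \<in> \<B>" "p \<in> cdom c" "p \<in> cdom d"
  from Ck_vfield_trans[OF V this] show "\<psi> p *\<^sub>R V d p = jac c d p *v (\<psi> p *\<^sub>R V c p)"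
    by (simp add: matrix_vector_mult_scaleR)
qed

lemma Ck_vfield_add:
  assumes V: "Ck_vfield k \<B> V" and W: "Ck_vfield k \<B> W"
  shows "Ck_vfield k \<B> (\<lambda>c p. V c p + W c p)"
proof (rule Ck_vfieldI)
  fix c assume c: "c \<in> \<B>"
  show "Ck_on k (cmap c ` cdom c) ((\<lambda>p. V c p + W c p) \<circ> cinv c)"
    using Ck_on_add[OF image_open[OF c] Ck_vfield_Ck_on[OF V c] Ck_vfield_Ck_on[OF W c]] by (simp add: o_def)
next
  fix c d p assume "c \<in> \<B>" "d \<in> \<B>" "p \<in> cdom c" "p \<in> cdom d"
  from Ck_vfield_trans[OF V this] Ck_vfield_trans[OF W this]
  show "V d p + W d p = jac c d p *v (V c p + W c p)"
    by (simp add: matrix_vector_right_distrib)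
qed

lemma div_vfield_cong:
  assumes c: "c \<in> \<B>" "p \<in> cdom c" and eq: "\<And>q. q \<in> cdom c \<Longrightarrow> V c q = W c q"
  shows "div_vfield h V c p = div_vfield h W c p"
proof -
  have "pd c i (\<lambda>q. V c q $ i) p = pd c i (\<lambda>q. W c q $ i) p" for i
    by (rule pd_cong_dom[OF chart_S[OF c(1)] c(2)]) (simp add: eq)
  then show ?thesis unfolding div_vfield_def using eq[OF c(2)] by simp
qed

lemma div_vfield_scale:
  assumes c: "c \<in> \<B>" "p \<in> cdom c" and \<psi>: "Ck_fun 1 \<B> \<psi>" and V: "Ck_vfield 1 \<B> V"
  shows "div_vfield h (\<lambda>c q. \<psi> q *\<^sub>R V c q) c p = \<psi> p * div_vfield h V c p + lie_fun V \<psi> c p"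
proof -
  have "pd c i (\<lambda>q. \<psi> q * V c q $ i) p = pd c i \<psi> p * V c p $ i + \<psi> p * pd c i (\<lambda>q. V c q $ i) p" for i
    using Ck_fun_chart_diff[OF \<psi>[unfolded One_nat_def] c] Ck_vfield_chart_diff[OF V[unfolded One_nat_def] c]
    by (rule pd_mult[OF chart_S[OF c(1)] c(2)])
  then show ?thesis
    unfolding div_vfield_def lie_fun_def
    by (simp add: sum.distrib sum_distrib_left distrib_left algebra_simps)
qed

lemma div_vfield_add:
  assumes c: "c \<in> \<B>" "p \<in> cdom c" and V: "Ck_vfield 1 \<B> V" and W: "Ck_vfield 1 \<B> W"
  shows "div_vfield h (\<lambda>c q. V c q + W c q) c p = div_vfield h V c p + div_vfield h W c p"
proof -
  have "pd c i (\<lambda>q. V c q $ i + W c q $ i) p = pd c i (\<lambda>q. V c q $ i) p + pd c i (\<lambda>q. W c q $ i) p" for i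
    using Ck_vfield_chart_diff[OF V[unfolded One_nat_def] c] Ck_vfield_chart_diff[OF W[unfolded One_nat_def] c]
    by (rule pd_add)
  then show ?thesis
    unfolding div_vfield_def by (simp add: sum.distrib distrib_left algebra_simps)
qed

lemma Ck_vfield_zero: "Ck_vfield k \<B> (\<lambda>c p. 0)"
  by (rule Ck_vfieldI) (auto simp: o_def Ck_on_const)

lemma div_vfield_zero: "div_vfield h (\<lambda>c q. 0) c p = 0"
  by (simp add: div_vfield_def pd_const)

lemma Ck_vfield_sum:
  assumes "\<And>i. i \<in> I \<Longrightarrow> Ck_vfield k \<B> (V i)"
  shows "Ck_vfield k \<B> (\<lambda>c p. \<Sum>i\<in>I. V i c p)"
  using assms by (induction I rule: infinite_finite_induct) (auto intro: Ck_vfield_zero Ck_vfield_add)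

lemma div_vfield_sum:
  assumes "finite I" and c: "c \<in> \<B>" "p \<in> cdom c" and V: "\<And>i. i \<in> I \<Longrightarrow> Ck_vfield 1 \<B> (V i)"
  shows "div_vfield h (\<lambda>c q. \<Sum>i\<in>I. V i c q) c p = (\<Sum>i\<in>I. div_vfield h (V i) c p)"
  using assms(1) V
proof (induction I rule: finite_induct)
  case (insert i I)
  then have "Ck_vfield 1 \<B> (V i)" "Ck_vfield 1 \<B> (\<lambda>c p. \<Sum>i\<in>I. V i c p)"
    by (auto intro: Ck_vfield_sum)
  from div_vfield_add[OF c this] insert show ?case by simp
qed (simp add: div_vfield_zero)

lemma continuous_on_S_I:
  assumes "\<And>c. c \<in> \<B> \<Longrightarrow> continuous_on (cmap c ` cdom c) (F \<circ> cinv c)"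
  shows "continuous_on S F"
  unfolding continuous_on_eq_continuous_within
proof
  fix p assume p: "p \<in> S"
  define c where "c = chart_at \<B> p"
  have c: "c \<in> \<B>" "p \<in> cdom c" using chart_atE[OF atlas p] by (simp_all add: c_def)
  have "continuous_on (cdom c) (cmap c)"
    using chart_S[OF c(1)] unfolding is_chart_def homeomorphism_def by blast
  from continuous_on_compose[OF this assms[OF c(1)]]
  have "continuous_on (cdom c) (F \<circ> cinv c \<circ> cmap c)" .
  then have "continuous_on (cdom c) F"
    by (rule continuous_on_cong[THEN iffD1, rotated 2]) (simp_all add: cinv_cmap[OF chart_S[OF c(1)]])
  then have "continuous (at p within cdom c) F" using c by (simp add: continuous_on_eq_continuous_within)
  moreover obtain T where T: "open T" "cdom c = S \<inter> T"
    using chart_S[OF c(1)] unfolding is_chart_def openin_open by blast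
  moreover have "at p within S = at p within cdom c"
    by (rule at_within_nhd[of p T]) (use T c in auto)
  ultimately show "continuous (at p within S) F" by simp
qed

lemma Ck_fun_continuous_on: "Ck_fun k \<B> f \<Longrightarrow> continuous_on S f"
  unfolding Ck_fun_def by (rule continuous_on_S_I) (blast intro: Ck_on_imp_continuous_on)

text \<open>The divergence as a function on \<open>S\<close>; the chart at each point is arbitrary, so that continuity
  rests on the independence of the chart.\<close>

definition divg :: "('a, 2) vfield \<Rightarrow> 'a \<Rightarrow> real" where
  "divg V p = div_vfield h V (chart_at \<B> p) p"

lemma divg_eq:
  assumes "Ck_vfield 1 \<B> V" "c \<in> \<B>" "p \<in> cdom c"
  shows "divg V p = div_vfield h V c p"
proof -
  have p: "p \<in> S" using assms dom_sub by blast
  show ?thesis unfolding divg_def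
    by (rule div_vfield_chart_independent[OF assms(1) chart_atE[OF atlas p] assms(2,3)])
qed

lemma divg_continuous:
  assumes V: "Ck_vfield 1 \<B> V"
  shows "continuous_on S (divg V)"
proof (rule continuous_on_S_I)
  fix c assume c: "c \<in> \<B>"
  note op = image_open[OF c]
  have V1: "Ck_on 1 (cmap c ` cdom c) ((\<lambda>q. V c q $ i) \<circ> cinv c)" for i
    using Ck_on_bounded_linear_comp[OF bounded_linear_vec_nth op Ck_vfield_Ck_on[OF V c]] by (simp add: o_def)
  have pdV: "Ck_on 0 (cmap c ` cdom c) (\<lambda>x. pd c i (\<lambda>q. V c q $ i) (cinv c x))" for i
    using Ck_on_pd[OF chart_S[OF c] op order_refl V1[unfolded One_nat_def]] by (simp only: o_def)
  have pdh: "Ck_on 0 (cmap c ` cdom c) (\<lambda>x. pd c i (\<lambda>q. det (h c q)) (cinv c x))" for i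
    using Ck_on_pd[OF chart_S[OF c] op order_refl det_h_Ck[OF c]] by (simp only: o_def)
  have V0: "Ck_on 0 (cmap c ` cdom c) (\<lambda>x. V c (cinv c x) $ i)" for i
    by (rule Ck_on_mono[OF V1[unfolded o_def]]) simp
  have h0: "Ck_on 0 (cmap c ` cdom c) (\<lambda>x. det (h c (cinv c x)))"
    using det_h_Ck[OF c, of 0] by (simp only: o_def)
  have "Ck_on 0 (cmap c ` cdom c) (\<lambda>x. (\<Sum>i\<in>UNIV. pd c i (\<lambda>q. V c q $ i) (cinv c x)) +
    (\<Sum>j\<in>UNIV. V c (cinv c x) $ j * pd c j (\<lambda>q. det (h c q)) (cinv c x)) / (2 * det (h c (cinv c x))))"
  proof (intro Ck_on_add Ck_on_sum Ck_on_divide Ck_on_mult Ck_on_const op pdV pdh V0 h0)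
    fix x assume "x \<in> cmap c ` cdom c"
    then show "2 * det (h c (cinv c x)) \<noteq> 0" using det_h_pos[OF c cinv_in[OF chart_S[OF c]], of x] by simp
  qed
  then have "continuous_on (cmap c ` cdom c) (\<lambda>x. (\<Sum>i\<in>UNIV. pd c i (\<lambda>q. V c q $ i) (cinv c x)) +
    (\<Sum>j\<in>UNIV. V c (cinv c x) $ j * pd c j (\<lambda>q. det (h c q)) (cinv c x)) / (2 * det (h c (cinv c x))))"
    by (rule Ck_on_imp_continuous_on)
  then show "continuous_on (cmap c ` cdom c) (divg V \<circ> cinv c)"
  proof (rule continuous_on_cong[THEN iffD1, rotated 2])
    fix x assume "x \<in> cmap c ` cdom c"
    then have "cinv c x \<in> cdom c" by (rule cinv_in[OF chart_S[OF c]])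
    then show "(\<Sum>i\<in>UNIV. pd c i (\<lambda>q. V c q $ i) (cinv c x)) +
      (\<Sum>j\<in>UNIV. V c (cinv c x) $ j * pd c j (\<lambda>q. det (h c q)) (cinv c x)) / (2 * det (h c (cinv c x))) =
      (divg V \<circ> cinv c) x"
      using div_vfield_eq[OF c] divg_eq[OF V c] by simp
  qed simp
qed

lemma chart_ball:
  assumes "p \<in> S"
  obtains c r where "c \<in> \<B>" "p \<in> cdom c" "r > 0" "cball (cmap c p) r \<subseteq> cmap c ` cdom c"
  using chart_atE[OF atlas assms] image_open open_contains_cball by (metis imageI)

lemma chart_ball_openin:
  assumes c: "c \<in> \<B>"
  shows "openin (top_of_set S) {q \<in> cdom c. cmap c q \<in> ball x r}"
proof -
  have "continuous_on (cdom c) (cmap c)"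
    using chart_S[OF c] unfolding is_chart_def homeomorphism_def by blast
  from continuous_openin_preimage_gen[OF this open_ball]
  have "openin (top_of_set (cdom c)) (cdom c \<inter> cmap c -` ball x r)" .
  moreover have "openin (top_of_set S) (cdom c)" using chart_S[OF c] unfolding is_chart_def by blast
  ultimately have "openin (top_of_set S) (cdom c \<inter> cmap c -` ball x r)" by (rule openin_trans)
  moreover have "cdom c \<inter> cmap c -` ball x r = {q \<in> cdom c. cmap c q \<in> ball x r}" by auto
  ultimately show ?thesis by simp
qed

lemma finite_dA: "emeasure dA S < \<infinity>"
proof -
  let ?\<C> = "{N. openin (top_of_set S) N \<and> emeasure dA N < \<infinity>}"
  have "\<exists>N\<in>?\<C>. p \<in> N" if pS: "p \<in> S" for p
  proof -
    obtain c r where c: "c \<in> \<B>" "p \<in> cdom c" and r: "r > 0" "cball (cmap c p) r \<subseteq> cmap c ` cdom c"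
      by (rule chart_ball[OF pS])
    let ?N = "{q \<in> cdom c. cmap c q \<in> ball (cmap c p) r}"
    have opN: "openin (top_of_set S) ?N" by (rule chart_ball_openin[OF c(1)])
    have "?N \<in> sets borel" using opN S_borel by (auto simp: openin_open)
    then have N: "?N \<in> sets dA" using dom_sub[OF c(1)] by (auto simp: sets_dA sets_iff)
    have "continuous_on (cball (cmap c p) r) (dens c)"
      using Ck_on_imp_continuous_on[OF dens_Ck[OF c(1)]] r(2) by (rule continuous_on_subset)
    from compact_imp_bounded[OF compact_continuous_image[OF this compact_cball]]
    obtain b where b: "\<forall>x\<in>cball (cmap c p) r. norm (dens c x) \<le> b" unfolding bounded_iff by auto
    have "emeasure dA ?N = (\<integral>\<^sup>+x\<in>cmap c ` ?N. ennreal (dens c x) \<partial>lborel)"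
      by (rule emeasure_dA[OF c(1) N]) auto
    also have "\<dots> \<le> (\<integral>\<^sup>+x. ennreal b * indicator (ball (cmap c p) r) x \<partial>lborel)"
    proof (rule nn_integral_mono)
      fix x show "ennreal (dens c x) * indicator (cmap c ` ?N) x \<le> ennreal b * indicator (ball (cmap c p) r) x"
      proof (cases "x \<in> cmap c ` ?N")
        case True
        then have x: "x \<in> ball (cmap c p) r" by blast
        then have "\<bar>dens c x\<bar> \<le> b" using b ball_subset_cball by fastforce
        then have "ennreal (dens c x) \<le> ennreal b" by (intro ennreal_leI) simp
        with x True show ?thesis by simp
      qed simp
    qed
    also have "\<dots> = ennreal b * emeasure lborel (ball (cmap c p) r)"
      by (intro nn_integral_cmult_indicator) simp
    also have "\<dots> < \<infinity>"
      using emeasure_lborel_ball_finite[of "cmap c p" r] by (simp add: ennreal_mult_less_top)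
    finally show ?thesis using opN c(2) r(1) by (intro bexI[of _ ?N]) auto
  qed
  then have "S \<subseteq> \<Union>?\<C>" by blast
  then obtain \<F> where \<F>: "finite \<F>" "\<F> \<subseteq> ?\<C>" "S \<subseteq> \<Union>\<F>"
    using compact_S unfolding compact_eq_openin_cover by (metis (no_types, lifting) mem_Collect_eq)
  have sub: "N \<in> sets dA" if "N \<in> \<F>" for N
    using that \<F>(2) S_borel by (auto simp: sets_dA sets_iff openin_open)
  have "emeasure dA S \<le> emeasure dA (\<Union>N\<in>\<F>. N)"
    using \<F> sub by (intro emeasure_mono) auto
  also have "\<dots> \<le> (\<Sum>N\<in>\<F>. emeasure dA N)"
    using \<F>(1) sub by (intro emeasure_subadditive_finite) auto
  also have "\<dots> < \<infinity>" using \<F>(1,2) by auto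
  finally show ?thesis .
qed

lemma borel_measurable_continuous_S:
  "continuous_on S \<psi> \<Longrightarrow> \<psi> \<in> borel_measurable dA"
  using borel_measurable_continuous_on_restrict[of S \<psi>] by (simp cong: measurable_cong_sets add: sets_dA)

lemma integrable_continuous_S:
  fixes \<psi> :: "'a \<Rightarrow> real"
  assumes "continuous_on S \<psi>"
  shows "integrable dA \<psi>"
proof -
  interpret finite_measure dA using finite_dA by (intro finite_measureI) (simp add: space_dA)
  obtain b where "\<forall>p\<in>S. norm (\<psi> p) \<le> b"
    using compact_imp_bounded[OF compact_continuous_image[OF assms compact_S]] unfolding bounded_iff by auto
  then show ?thesis
    by (intro integrable_const_bound[of _ b] AE_I2 borel_measurable_continuous_S[OF assms]) (auto simp: space_dA)
qed

text \<open>In coordinates, \<open>sqrt (det h) div V\<close> is a sum of coordinate derivatives of functions with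
  compact support, extended by zero from the image of the chart to the plane.\<close>

lemma integral_divg_chart_supported:
  assumes V: "Ck_vfield 1 \<B> V" and c: "c \<in> \<B>" and K: "compact K" "K \<subseteq> cdom c"
    and supp: "\<And>d p. d \<in> \<B> \<Longrightarrow> p \<in> cdom d \<Longrightarrow> p \<notin> K \<Longrightarrow> V d p = 0"
  shows "(LINT p|dA. divg V p) = 0"
proof -
  let ?U = "cmap c ` cdom c"
  let ?K = "cmap c ` K"
  define P where "P i x = (if x \<in> ?U then dens c x * V c (cinv c x) $ i else 0)" for i x
  note op = image_open[OF c] and ch = chart_S[OF c]
  have contc: "continuous_on (cdom c) (cmap c)" using ch unfolding is_chart_def homeomorphism_def by blast
  have cK: "compact ?K" by (rule compact_continuous_image[OF continuous_on_subset[OF contc K(2)] K(1)])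
  have notK: "cinv c x \<notin> K" if "x \<in> ?U" "x \<notin> ?K" for x
    using that cmap_cinv[OF ch that(1)] by (metis imageI)
  have P0: "P i x = 0" if "x \<notin> ?K" for i x
    using supp[OF c cinv_in[OF ch] notK[OF _ that]] by (simp add: P_def)
  have VU: "Ck_on 1 ?U (\<lambda>x. V c (cinv c x) $ i)" for i
    using Ck_on_bounded_linear_comp[OF bounded_linear_vec_nth op Ck_vfield_Ck_on[OF V c]] by (simp add: o_def)
  have PU: "Ck_on 1 ?U (P i)" for i
    by (rule Ck_on_cong[OF op _ Ck_on_mult[OF op dens_Ck[OF c] VU[of i]]]) (simp add: P_def)
  have P1: "Ck_on 1 UNIV (P i)" for i
  proof (rule Ck_on_local)
    fix x show "\<exists>W. open W \<and> x \<in> W \<and> Ck_on 1 W (P i)"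
    proof (cases "x \<in> ?U")
      case True
      with op PU show ?thesis by blast
    next
      case False
      have oK: "open (- ?K)" using cK by (simp add: compact_imp_closed open_Compl)
      have "Ck_on 1 (- ?K) (P i)"
        by (rule Ck_on_cong[OF oK _ Ck_on_const[of 1 _ 0]]) (simp add: P0)
      with oK False K(2) show ?thesis by blast
    qed
  qed
  let ?D = "\<lambda>i x. frechet_derivative (P i) (at x) (axis i 1)"
  have D0: "?D i x = 0" if "x \<notin> ?K" for i x
  proof -
    have "(P i has_derivative (\<lambda>_. 0)) (at x)"
      by (rule has_derivative_cong_open[OF has_derivative_const[of 0] open_Compl[OF compact_imp_closed[OF cK]]])
        (use that P0 in auto)
    from frechet_derivative_at[OF this] show ?thesis by metis
  qed
  have D: "dens c x * divg V (cinv c x) = (\<Sum>i\<in>UNIV. ?D i x)" if x: "x \<in> ?U" for x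
  proof -
    define p where "p = cinv c x"
    have p: "p \<in> cdom c" "cmap c p = x" using cinv_in[OF ch x] cmap_cinv[OF ch x] by (auto simp: p_def)
    let ?r = "\<lambda>q. sqrt (det (h c q))"
    have hp: "det (h c p) > 0" by (rule det_h_pos[OF c p(1)])
    have rd: "chart_diff c ?r p"
      using dens_Ck[OF c, of 1] x p(2) by (auto simp: dens_def[abs_def] o_def)
    have Vd: "chart_diff c (\<lambda>q. V c q $ i) p" for i
      by (rule Ck_vfield_chart_diff[OF V[unfolded One_nat_def] c p(1)])
    have Di: "?D i x = pd c i (\<lambda>q. ?r q * V c q $ i) p" for i
    proof -
      have "(P i has_derivative frechet_derivative (P i) (at x)) (at x)"
        using Ck_on_has_derivative[OF P1[unfolded One_nat_def]] by blast
      then have "((\<lambda>q. ?r q * V c q $ i) \<circ> cinv c has_derivative frechet_derivative (P i) (at x)) (at (cmap c p))"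
        unfolding p(2) by (rule has_derivative_cong_open[OF _ op x]) (simp add: P_def dens_def)
      from pd_eq[OF this] show ?thesis by simp
    qed
    have Dx: "?D i x = pd c i (\<lambda>q. det (h c q)) p / (2 * ?r p) * V c p $ i + ?r p * pd c i (\<lambda>q. V c q $ i) p" for i
      unfolding Di pd_mult[OF ch p(1) rd Vd] pd_sqrt[OF ch p(1) det_h_diff[OF c p(1)] hp] ..
    have alg: "a / (2 * r) * u + r * s + (b / (2 * r) * w + r * t) = r * ((s + t) + (u * a + w * b) / (2 * (r * r)))"
      if "r \<noteq> 0" for a b r s t u w :: real using that by (simp add: field_simps)
    have "(\<Sum>i\<in>UNIV. ?D i x) = ?r p * ((\<Sum>i\<in>UNIV. pd c i (\<lambda>q. V c q $ i) p) +
        (\<Sum>j\<in>UNIV. V c p $ j * pd c j (\<lambda>q. det (h c q)) p) / (2 * (?r p * ?r p)))"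
      unfolding sum_2 Dx by (rule alg) (use hp in simp)
    also have "?r p * ?r p = det (h c p)" using hp by simp
    finally show ?thesis
      using divg_eq[OF V c p(1)] div_vfield_eq[OF c p(1), of V] by (simp add: dens_def p_def)
  qed
  have supp': "divg V p = 0" if "p \<in> S" "p \<notin> cdom c" for p
  proof -
    define d where "d = chart_at \<B> p"
    have d: "d \<in> \<B>" "p \<in> cdom d" using chart_atE[OF atlas that(1)] by (simp_all add: d_def)
    have "openin (top_of_set S) (- K \<inter> S)"
      using compact_imp_closed[OF K(1)] by (auto simp: openin_open intro!: exI[of _ "- K"])
    then have "pd d i (\<lambda>q. V d q $ i) p = pd d i (\<lambda>q. 0) p" for i
      by (rule pd_cong[OF chart_S[OF d(1)] d(2)]) (use that K supp[OF d(1)] in auto)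
    moreover have "V d p = 0" using supp[OF d] that K by auto
    ultimately show ?thesis unfolding divg_eq[OF V d] div_vfield_eq[OF d] by (simp add: pd_const)
  qed
  have "(LINT p|dA. divg V p) = (LINT x:?U|lborel. dens c x * divg V (cinv c x))"
    using supp' by (intro integral_in_chart[OF c] borel_measurable_continuous_S divg_continuous V) auto
  also have "\<dots> = (LINT x|lborel. (\<Sum>i\<in>UNIV. ?D i x))"
    unfolding set_lebesgue_integral_def
  proof (rule Bochner_Integration.integral_cong[OF refl])
    fix x
    show "indicator ?U x *\<^sub>R (dens c x * divg V (cinv c x)) = (\<Sum>i\<in>UNIV. ?D i x)"
    proof (cases "x \<in> ?U")
      case False
      then have "x \<notin> ?K" using K(2) by blast
      with False show ?thesis by (simp add: D0)
    qed (simp add: D)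
  qed
  also have "\<dots> = (\<Sum>i\<in>UNIV. (LINT x|lborel. ?D i x))"
    by (intro Bochner_Integration.integral_sum integral_directional_derivative(1)[OF P1 cK P0])
  also have "\<dots> = 0" by (simp add: integral_directional_derivative(2)[OF P1 cK P0])
  finally show ?thesis .
qed

text \<open>Squaring the positive part makes it of class \<open>C\<^sup>1\<close>, which is all that the divergence needs.\<close>

definition bump :: "('a, 2) chart \<Rightarrow> real ^ 2 \<Rightarrow> real \<Rightarrow> 'a \<Rightarrow> real" where
  "bump c x r q = (if q \<in> cdom c then (max 0 (r\<^sup>2 - (cmap c q - x) \<bullet> (cmap c q - x)))\<^sup>2 else 0)"

lemma bump_nonneg: "bump c x r q \<ge> 0"
  by (simp add: bump_def)

lemma inner_diff_less_iff: "r > 0 \<Longrightarrow> (y - x) \<bullet> (y - x) < r\<^sup>2 \<longleftrightarrow> (y :: real ^ 2) \<in> ball x r"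
  using power2_less_imp_less[of "norm (x - y)" r] power_strict_mono[of "norm (x - y)" r 2]
  by (auto simp: power2_norm_eq_inner[symmetric] dist_norm norm_minus_commute[of y x])

lemma bump_pos: "r > 0 \<Longrightarrow> q \<in> cdom c \<Longrightarrow> cmap c q \<in> ball x r \<Longrightarrow> bump c x r q > 0"
  using inner_diff_less_iff[of r "cmap c q" x] by (simp add: bump_def)

lemma bump_support:
  assumes "c \<in> \<B>" "r > 0" "q \<notin> cinv c ` cball x r" shows "bump c x r q = 0"
proof (cases "q \<in> cdom c")
  case True
  have "cmap c q \<notin> ball x r"
    using assms(3) cinv_cmap[OF chart_S[OF assms(1)] True] ball_subset_cball by (metis imageI subsetD)
  then show ?thesis using inner_diff_less_iff[OF assms(2), of "cmap c q" x] by (simp add: bump_def)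
qed (simp add: bump_def)

lemma bump_support_compact:
  assumes "c \<in> \<B>" "cball x r \<subseteq> cmap c ` cdom c"
  shows "compact (cinv c ` cball x r)" "cinv c ` cball x r \<subseteq> cdom c"
proof -
  have "continuous_on (cmap c ` cdom c) (cinv c)"
    using chart_S[OF assms(1)] unfolding is_chart_def homeomorphism_def by blast
  from compact_continuous_image[OF continuous_on_subset[OF this assms(2)] compact_cball]
  show "compact (cinv c ` cball x r)" .
  show "cinv c ` cball x r \<subseteq> cdom c" using cinv_in[OF chart_S[OF assms(1)]] assms(2) by blast
qed

lemma bump_Ck:
  assumes c: "c \<in> \<B>" and r: "r > 0" "cball x r \<subseteq> cmap c ` cdom c"
  shows "Ck_fun 1 \<B> (bump c x r)"
  unfolding Ck_fun_def
proof
  fix d assume d: "d \<in> \<B>"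
  let ?K = "cinv c ` cball x r"
  have q: "Ck_on 1 UNIV (\<lambda>y :: real ^ 2. r\<^sup>2 - (y - x) \<bullet> (y - x))"
    by (intro Ck_on_diff Ck_on_const Ck_on_bilinear[OF bounded_bilinear_inner] open_UNIV
        Ck_on_bounded_linear[OF bounded_linear_ident])
  show "Ck_on 1 (cmap d ` cdom d) (bump c x r \<circ> cinv d)"
  proof (rule Ck_on_local)
    fix y assume "y \<in> cmap d ` cdom d"
    then obtain p where p: "p \<in> cdom d" "y = cmap d p" by blast
    show "\<exists>W. open W \<and> y \<in> W \<and> Ck_on 1 W (bump c x r \<circ> cinv d)"
    proof (cases "p \<in> cdom c")
      case True
      let ?W = "cmap d ` (cdom c \<inter> cdom d)"
      have op: "open ?W" by (rule overlap_open[OF d c])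
      have "Ck_on 1 ?W (\<lambda>y. (max 0 (r\<^sup>2 - ((cmap c \<circ> cinv d) y - x) \<bullet> ((cmap c \<circ> cinv d) y - x)))\<^sup>2)"
        using Ck_on_comp[OF op inclusion_Ck[OF d c] Ck_on_max_square[OF open_UNIV q]] by simp
      then have "Ck_on 1 ?W (bump c x r \<circ> cinv d)"
        by (rule Ck_on_cong[OF op, rotated]) (auto simp: bump_def cinv_cmap[OF chart_S[OF d]])
      with op True p show ?thesis by blast
    next
      case False
      let ?W = "cmap d ` (- ?K \<inter> cdom d)"
      have "openin (top_of_set S) (- ?K \<inter> S)"
        using compact_imp_closed[OF bump_support_compact(1)[OF c r(2)]]
        by (auto simp: openin_open intro!: exI[of _ "- ?K"])
      then have op: "open ?W" by (rule chart_open_image[OF chart_S[OF d]])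
      have "Ck_on 1 ?W (bump c x r \<circ> cinv d)"
        by (rule Ck_on_cong[OF op _ Ck_on_const[of 1 _ 0]])
          (auto simp: cinv_cmap[OF chart_S[OF d]] bump_support[OF c r(1)])
      moreover have "p \<notin> ?K" using False bump_support_compact(2)[OF c r(2)] by blast
      ultimately show ?thesis using op p by blast
    qed
  qed
qed

text \<open>A partition of unity subordinate to coordinate balls, the functions \<open>b p / \<beta>\<close> below, reduces
  this to fields supported in one chart.\<close>

theorem divergence_theorem:
  assumes V: "Ck_vfield 1 \<B> V"
  shows "(LINT p|dA. divg V p) = 0"
proof -
  obtain c r where c: "\<And>p. p \<in> S \<Longrightarrow> c p \<in> \<B>" "\<And>p. p \<in> S \<Longrightarrow> p \<in> cdom (c p)"
    and r: "\<And>p. p \<in> S \<Longrightarrow> r p > 0" "\<And>p. p \<in> S \<Longrightarrow> cball (cmap (c p) p) (r p) \<subseteq> cmap (c p) ` cdom (c p)"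
  proof -
    have "\<forall>p\<in>S. \<exists>cr. fst cr \<in> \<B> \<and> p \<in> cdom (fst cr) \<and> snd cr > 0 \<and>
        cball (cmap (fst cr) p) (snd cr) \<subseteq> cmap (fst cr) ` cdom (fst cr)"
    proof
      fix p assume "p \<in> S"
      then obtain c r where "c \<in> \<B>" "p \<in> cdom c" "r > 0" "cball (cmap c p) r \<subseteq> cmap c ` cdom c"
        by (rule chart_ball)
      then show "\<exists>cr. fst cr \<in> \<B> \<and> p \<in> cdom (fst cr) \<and> snd cr > 0 \<and>
        cball (cmap (fst cr) p) (snd cr) \<subseteq> cmap (fst cr) ` cdom (fst cr)"
        by (intro exI[of _ "(c, r)"]) simp
    qed
    then obtain cr where "\<forall>p\<in>S. fst (cr p) \<in> \<B> \<and> p \<in> cdom (fst (cr p)) \<and> snd (cr p) > 0 \<and>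
        cball (cmap (fst (cr p)) p) (snd (cr p)) \<subseteq> cmap (fst (cr p)) ` cdom (fst (cr p))"
      by (rule bchoice[THEN exE])
    then show ?thesis by (intro that[of "\<lambda>p. fst (cr p)" "\<lambda>p. snd (cr p)"]) blast+
  qed
  define N where "N p = {q \<in> cdom (c p). cmap (c p) q \<in> ball (cmap (c p) p) (r p)}" for p
  have "S \<subseteq> \<Union>(N ` S)" using c r(1) by (auto simp: N_def)
  moreover have "\<forall>U\<in>N ` S. openin (top_of_set S) U"
    using chart_ball_openin[OF c(1)] by (auto simp: N_def)
  ultimately obtain \<F> where \<F>: "finite \<F>" "\<F> \<subseteq> N ` S" "S \<subseteq> \<Union>\<F>"
    using compact_S unfolding compact_eq_openin_cover by metis
  then obtain P where P: "finite P" "P \<subseteq> S" "S \<subseteq> (\<Union>p\<in>P. N p)"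
    using finite_subset_image[OF \<F>(1,2)] by metis
  define b where "b p = bump (c p) (cmap (c p) p) (r p)" for p
  define \<beta> where "\<beta> q = (\<Sum>p\<in>P. b p q)" for q
  have b1: "Ck_fun 1 \<B> (b p)" if "p \<in> P" for p
    unfolding b_def using that P(2) by (intro bump_Ck c(1) r) blast+
  have \<beta>1: "Ck_fun 1 \<B> \<beta>" unfolding \<beta>_def[abs_def] by (rule Ck_fun_sum[OF b1])
  have \<beta>_pos: "\<beta> q > 0" if qS: "q \<in> S" for q
  proof -
    obtain p where p: "p \<in> P" "q \<in> N p" using P(3) qS by blast
    have "b p q > 0" unfolding b_def using p P(2) r(1) by (intro bump_pos) (auto simp: N_def)
    then show ?thesis
      unfolding \<beta>_def using P(1) p(1) by (intro sum_pos2[of P p]) (auto simp: b_def bump_nonneg)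
  qed
  define W where "W p = (\<lambda>d q. (b p q / \<beta> q) *\<^sub>R V d q)" for p
  have W1: "Ck_vfield 1 \<B> (W p)" if "p \<in> P" for p
    unfolding W_def using \<beta>_pos by (intro Ck_vfield_scale Ck_fun_divide b1 \<beta>1 V that) force
  have "divg V q = (\<Sum>p\<in>P. divg (W p) q)" if q: "q \<in> S" for q
  proof -
    note d = chart_atE[OF atlas q]
    have "divg V q = div_vfield h (\<lambda>d q. \<Sum>p\<in>P. W p d q) (chart_at \<B> q) q"
      unfolding divg_def
    proof (rule div_vfield_cong[OF d])
      fix q' assume "q' \<in> cdom (chart_at \<B> q)"
      then have "\<beta> q' > 0" using \<beta>_pos dom_sub[OF d(1)] by blast
      then show "V (chart_at \<B> q) q' = (\<Sum>p\<in>P. W p (chart_at \<B> q) q')"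
        by (simp add: W_def scaleR_sum_left[symmetric] sum_divide_distrib[symmetric] \<beta>_def[symmetric])
    qed
    also have "\<dots> = (\<Sum>p\<in>P. divg (W p) q)"
      unfolding divg_def by (rule div_vfield_sum[OF P(1) d W1])
    finally show ?thesis .
  qed
  then have "(LINT q|dA. divg V q) = (LINT q|dA. (\<Sum>p\<in>P. divg (W p) q))"
    by (intro Bochner_Integration.integral_cong) (auto simp: space_dA)
  also have "\<dots> = (\<Sum>p\<in>P. (LINT q|dA. divg (W p) q))"
    by (intro Bochner_Integration.integral_sum integrable_continuous_S divg_continuous W1)
  also have "\<dots> = 0"
  proof (rule sum.neutral, rule ballI)
    fix p assume p: "p \<in> P"
    then have pS: "p \<in> S" using P(2) by blast
    show "(LINT q|dA. divg (W p) q) = 0"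
    proof (rule integral_divg_chart_supported[OF W1[OF p] c(1)[OF pS] bump_support_compact[OF c(1)[OF pS] r(2)[OF pS]]])
      fix d q assume "q \<notin> cinv (c p) ` cball (cmap (c p) p) (r p)"
      from bump_support[OF c(1)[OF pS] r(1)[OF pS] this] show "W p d q = 0" by (simp add: W_def b_def)
    qed
  qed
  finally show ?thesis .
qed

end

section \<open>Lie derivatives along an invariant surface\<close>

lemma bounded_bilinear_matrix_vector:
  "bounded_bilinear (\<lambda>(A :: real ^ 'm ^ 'n) v. A *v v)"
  by (subst bilinear_conv_bounded_bilinear[symmetric])
    (auto simp: bilinear_def matrix_vector_mult_add_rdistrib matrix_vector_right_distrib
      scaleR_matrix_vector_assoc[symmetric] matrix_vector_mult_scaleR intro!: linearI)

lemma bil_has_derivative: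
  assumes "(T has_derivative T') (at x)" "(a has_derivative a') (at x)" "(b has_derivative b') (at x)"
  shows "((\<lambda>z. bil (T z) (a z) (b z)) has_derivative
    (\<lambda>v. bil (T' v) (a x) (b x) + bil (T x) (a' v) (b x) + bil (T x) (a x) (b' v))) (at x)"
  unfolding bil_def
  by (rule has_derivative_eq_rhs[OF bounded_bilinear.FDERIV[OF bounded_bilinear_inner assms(2)
          bounded_bilinear.FDERIV[OF bounded_bilinear_matrix_vector assms(1,3)]]])
    (simp add: fun_eq_iff inner_add_right)

text \<open>The setting in coordinates: \<open>F\<close> is an immersed surface with differential \<open>J\<close>, and the tangent
  field \<open>\<xi>\<close> of the surface is related to the ambient field \<open>\<eta>\<close>.\<close>

locale related_fields =
  fixes U :: "(real ^ 2) set" and x :: "real ^ 2" and F :: "real ^ 2 \<Rightarrow> real ^ 3"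
    and J :: "real ^ 2 \<Rightarrow> real ^ 2 ^ 3" and J' :: "real ^ 2 \<Rightarrow> real ^ 2 ^ 3"
    and \<xi> \<xi>' :: "real ^ 2 \<Rightarrow> real ^ 2" and \<eta> \<eta>' :: "real ^ 3 \<Rightarrow> real ^ 3"
  assumes U: "open U" "x \<in> U"
    and F: "(F has_derivative (\<lambda>v. J x *v v)) (at x)"
    and J: "(J has_derivative J') (at x)" and J'_sym: "J' v *v w = J' w *v v"
    and \<xi>: "(\<xi> has_derivative \<xi>') (at x)" and \<eta>: "(\<eta> has_derivative \<eta>') (at (F x))"
    and related: "\<And>z. z \<in> U \<Longrightarrow> J z *v \<xi> z = \<eta> (F z)"
begin

lemma related_at: "J x *v \<xi> x = \<eta> (F x)"
  by (rule related[OF U(2)])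

lemma \<eta>_along: "((\<lambda>z. \<eta> (F z)) has_derivative (\<lambda>v. \<eta>' (J x *v v))) (at x)"
  by (rule has_derivative_compose[OF F \<eta>])

lemma zero_deriv:
  assumes "(f has_derivative f') (at x)" "\<And>z. z \<in> U \<Longrightarrow> f z = c"
  shows "f' v = 0"
proof -
  have "(f has_derivative (\<lambda>_. 0)) (at x)"
    by (rule has_derivative_cong_open[OF has_derivative_const[of c] U]) (simp add: assms(2))
  from has_derivative_unique[OF assms(1) this] show ?thesis by simp
qed

text \<open>The commutator of \<open>\<xi>\<close> with a constant coordinate field: here the symmetry of the second
  derivatives of \<open>F\<close> enters.\<close>

lemma transport_of_tangent_vector: "J' (\<xi> x) *v v = \<eta>' (J x *v v) - J x *v \<xi>' v"
proof -
  have "((\<lambda>z. J z *v \<xi> z) has_derivative (\<lambda>v. J x *v \<xi>' v + J' v *v \<xi> x)) (at x)"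
    by (rule bounded_bilinear.FDERIV[OF bounded_bilinear_matrix_vector J \<xi>])
  moreover have "((\<lambda>z. J z *v \<xi> z) has_derivative (\<lambda>v. \<eta>' (J x *v v))) (at x)"
    by (rule has_derivative_cong_open[OF \<eta>_along U]) (simp add: related)
  ultimately have "(\<lambda>v. J x *v \<xi>' v + J' v *v \<xi> x) = (\<lambda>v. \<eta>' (J x *v v))"
    by (rule has_derivative_unique)
  then have "J x *v \<xi>' v + J' v *v \<xi> x = \<eta>' (J x *v v)" by (rule fun_cong)
  then show ?thesis using J'_sym[of v "\<xi> x"] by (simp add: algebra_simps)
qed

end

locale related_fields_tensor = related_fields +
  fixes T T' :: "real ^ 3 \<Rightarrow> real ^ 3 ^ 3"
  assumes T: "(T has_derivative T') (at (F x))"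
    and lie: "bil (T' (\<eta> (F x))) v w + bil (T (F x)) (\<eta>' v) w + bil (T (F x)) v (\<eta>' w) = 0"
begin

lemma T_along: "((\<lambda>z. T (F z)) has_derivative (\<lambda>v. T' (J x *v v))) (at x)"
  by (rule has_derivative_compose[OF F T])

lemma bil_along:
  assumes "(a has_derivative a') (at x)" "(b has_derivative b') (at x)"
  shows "((\<lambda>z. bil (T (F z)) (a z) (b z)) has_derivative
    (\<lambda>v. bil (T' (J x *v v)) (a x) (b x) + bil (T (F x)) (a' v) (b x) + bil (T (F x)) (a x) (b' v))) (at x)"
  by (rule bil_has_derivative[OF T_along assms])

text \<open>The Leibniz rule: since \<open>a\<close> and \<open>b\<close> commute with \<open>\<eta>\<close>, the derivative of \<open>T(a, b)\<close> along \<open>\<xi>\<close>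
  consists of the three terms of \<open>(L\<^sub>\<eta> T)(a, b)\<close>.\<close>

lemma transported_bil:
  assumes "(a has_derivative a') (at x)" "(b has_derivative b') (at x)"
    and "a' (\<xi> x) = \<eta>' (a x)" "b' (\<xi> x) = \<eta>' (b x)"
    and "((\<lambda>z. bil (T (F z)) (a z) (b z)) has_derivative f') (at x)"
  shows "f' (\<xi> x) = 0"
  using has_derivative_unique[OF assms(5) bil_along[OF assms(1,2)]] lie[of "a x" "b x"]
  by (simp add: related_at assms(3,4))

lemma tangent_field_along: "((\<lambda>z. J z *v v) has_derivative (\<lambda>w. J' w *v v)) (at x)"
  using bounded_bilinear.FDERIV[OF bounded_bilinear_matrix_vector J has_derivative_const[of v]] by simp

text \<open>Naturality of the Lie derivative: the derivatives of \<open>J\<close> that arise from differentiating the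
  pullback are eliminated by the commutator formula above.\<close>

lemma lie_pullback:
  assumes h: "(h has_derivative h') (at x)"
    and eq: "\<And>z v w. z \<in> U \<Longrightarrow> bil (h z) v w = bil (T (F z)) (J z *v v) (J z *v w)"
  shows "bil (h' (\<xi> x)) v w + bil (h x) (\<xi>' v) w + bil (h x) v (\<xi>' w) = 0"
proof -
  have "((\<lambda>z. bil (h z) v w) has_derivative (\<lambda>u. bil (h' u) v w)) (at x)"
    using bil_has_derivative[OF h has_derivative_const[of v] has_derivative_const[of w]] by (simp add: bil_def)
  moreover have "((\<lambda>z. bil (h z) v w) has_derivative (\<lambda>u. bil (T' (J x *v u)) (J x *v v) (J x *v w)
      + bil (T (F x)) (J' u *v v) (J x *v w) + bil (T (F x)) (J x *v v) (J' u *v w))) (at x)"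
    by (rule has_derivative_cong_open[OF bil_along[OF tangent_field_along tangent_field_along] U])
      (simp add: eq)
  ultimately have "(\<lambda>u. bil (h' u) v w) = (\<lambda>u. bil (T' (J x *v u)) (J x *v v) (J x *v w)
      + bil (T (F x)) (J' u *v v) (J x *v w) + bil (T (F x)) (J x *v v) (J' u *v w))"
    by (rule has_derivative_unique)
  from fun_cong[OF this, of "\<xi> x"] show ?thesis
    using lie[of "J x *v v" "J x *v w"] eq[OF U(2), of "\<xi>' v" w] eq[OF U(2), of v "\<xi>' w"]
    by (simp add: related_at transport_of_tangent_vector bil_diff_left bil_diff_right)
qed

end

text \<open>A unit normal of the surface commutes with \<open>\<eta>\<close>: the commutator is orthogonal to \<open>\<nu>\<close> because
  \<open>|\<nu>|\<close> is constant, and to the surface because \<open>\<nu>\<close> is.\<close>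

lemma (in related_fields_tensor) unit_normal_transported:
  assumes \<nu>: "(\<nu> has_derivative \<nu>') (at x)"
    and sym: "transpose (T (F x)) = T (F x)"
    and pos: "\<And>v. v \<noteq> 0 \<Longrightarrow> bil (T (F x)) v v > 0"
    and unit: "\<And>z. z \<in> U \<Longrightarrow> bil (T (F z)) (\<nu> z) (\<nu> z) = 1"
    and orth: "\<And>z v. z \<in> U \<Longrightarrow> bil (T (F z)) (\<nu> z) (J z *v v) = 0"
    and inj: "inj ((*v) (J x))"
  shows "\<nu>' (\<xi> x) = \<eta>' (\<nu> x)"
proof -
  let ?G = "T (F x)"
  define N where "N = \<nu>' (\<xi> x) - \<eta>' (\<nu> x)"
  have "bil (T' (J x *v \<xi> x)) (\<nu> x) (\<nu> x) + bil ?G (\<nu>' (\<xi> x)) (\<nu> x) + bil ?G (\<nu> x) (\<nu>' (\<xi> x)) = 0"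
    by (rule zero_deriv[OF bil_along[OF \<nu> \<nu>] unit])
  then have N1: "bil ?G N (\<nu> x) = 0"
    using lie[of "\<nu> x" "\<nu> x"]
    by (simp add: N_def related_at bil_diff_left bil_commute[OF sym, of "\<nu> x"])
  have N2: "bil ?G N (J x *v v) = 0" for v
  proof -
    have "bil (T' (J x *v \<xi> x)) (\<nu> x) (J x *v v) + bil ?G (\<nu>' (\<xi> x)) (J x *v v) + bil ?G (\<nu> x) (J' (\<xi> x) *v v) = 0"
      by (rule zero_deriv[OF bil_along[OF \<nu> tangent_field_along] orth])
    then show ?thesis
      using lie[of "\<nu> x" "J x *v v"] orth[OF U(2), of "\<xi>' v"]
      by (simp add: N_def related_at bil_diff_left bil_diff_right transport_of_tangent_vector)
  qed
  \<comment> \<open>The normal and the tangent plane span the space, so \<open>N\<close> is orthogonal to itself.\<close>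
  define L :: "real ^ 3 \<Rightarrow> real ^ 3" where "L u = (u $ 3) *\<^sub>R \<nu> x + J x *v (\<chi> i. if i = 1 then u $ 1 else u $ 2)" for u
  have lin: "linear L"
  proof (rule linearI)
    fix u w :: "real ^ 3" and r :: real
    have "(\<chi> i::2. if i = 1 then (u + w) $ 1 else (u + w) $ 2) =
        (\<chi> i. if i = 1 then u $ 1 else u $ 2) + (\<chi> i. if i = 1 then w $ 1 else w $ 2)"
      by (simp add: vec_eq_iff)
    then show "L (u + w) = L u + L w"
      by (simp add: L_def matrix_vector_right_distrib scaleR_add_left)
    have "(\<chi> i::2. if i = 1 then (r *\<^sub>R u) $ 1 else (r *\<^sub>R u) $ 2) = r *\<^sub>R (\<chi> i. if i = 1 then u $ 1 else u $ 2)"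
      by (simp add: vec_eq_iff)
    then show "L (r *\<^sub>R u) = r *\<^sub>R L u"
      by (simp add: L_def matrix_vector_mult_scaleR scaleR_add_right)
  qed
  have "inj L"
    unfolding linear_injective_0[OF lin]
  proof (intro allI impI)
    fix u assume u: "L u = 0"
    let ?v = "\<chi> i::2. if i = 1 then u $ 1 else u $ 2"
    have "bil ?G (\<nu> x) (L u) = u $ 3 * bil ?G (\<nu> x) (\<nu> x) + bil ?G (\<nu> x) (J x *v ?v)"
      unfolding L_def by (simp only: bil_add_right bil_scale_right)
    then have u3: "u $ 3 = 0"
      unfolding u unit[OF U(2)] orth[OF U(2)] by (simp add: bil_def)
    with u have "J x *v ?v = J x *v 0" by (simp add: L_def)
    then have "?v = 0" by (rule injD[OF inj])
    then have "u $ 1 = 0" "u $ 2 = 0" by (auto simp: vec_eq_iff forall_2)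
    with u3 show "u = 0" by (simp add: vec_eq_iff forall_3)
  qed
  from linear_injective_imp_surjective[OF lin this] obtain u where u: "N = L u" by (metis surjD)
  have "bil ?G N (L u) = 0"
    unfolding L_def by (simp only: bil_add_right bil_scale_right N1 N2)
  then have "bil ?G N N = 0" unfolding u[symmetric] .
  then have "N = 0" using pos[of N] by fastforce
  then show ?thesis by (simp add: N_def)
qed

text \<open>By multilinearity it suffices to take coordinate vectors for \<open>v\<close> and \<open>w\<close>, where this is the
  formula for the components of \<open>L\<^sub>V T\<close>.\<close>

lemma lie_tensor2_contract:
  fixes T :: "('a, 'n::finite) tensor2" and V :: "('a, 'n) vfield"
  assumes lie: "lie_tensor2 V T c p = 0"
    and T: "(T c \<circ> cinv c has_derivative T') (at (cmap c p))"
    and V: "(V c \<circ> cinv c has_derivative V') (at (cmap c p))"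
  shows "bil (T' (V c p)) v w + bil (T c p) (V' v) w + bil (T c p) v (V' w) = 0"
proof -
  let ?\<Phi> = "\<lambda>v w. bil (T' (V c p)) v w + bil (T c p) (V' v) w + bil (T c p) v (V' w)"
  note linV = has_derivative_linear[OF V] and linT = has_derivative_linear[OF T]
  have pdT: "pd c k (\<lambda>q. T c q $ i $ j) p = T' (axis k 1) $ i $ j" for i j k
    by (rule pd_eq) (use bounded_linear.has_derivative[OF bounded_linear_vec_nth
      bounded_linear.has_derivative[OF bounded_linear_vec_nth T]] in \<open>simp add: o_def\<close>)
  have pdV: "pd c i (\<lambda>q. V c q $ k) p = V' (axis i 1) $ k" for i k
    by (rule pd_eq) (use bounded_linear.has_derivative[OF bounded_linear_vec_nth V] in \<open>simp add: o_def\<close>)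
  have ax: "bil A (axis i 1) w = (\<Sum>j\<in>UNIV. A $ i $ j * w $ j)" "bil A w (axis i 1) = (\<Sum>j\<in>UNIV. A $ j $ i * w $ j)"
    for A :: "real ^ 'n ^ 'n" and i w
    unfolding bil_def inner_axis' matrix_vector_mult_basis
    by (simp_all add: matrix_vector_mult_def inner_vec_def column_def mult.commute)
  have basis: "?\<Phi> (axis i 1) (axis j 1) = 0" for i j
  proof -
    have "T' (V c p) $ i $ j = (\<Sum>k\<in>UNIV. V c p $ k * T' (axis k 1) $ i $ j)"
      using linear_eq_sum_axis[OF linT, of "V c p"] by simp
    then have "?\<Phi> (axis i 1) (axis j 1) = lie_tensor2 V T c p $ i $ j"
      unfolding ax
      by (simp add: lie_tensor2_def pdT pdV sum.distrib axis_def if_distrib[of "\<lambda>x. _ * x"] cong: if_cong)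
    then show ?thesis using lie by simp
  qed
  have l1: "linear (\<lambda>v. ?\<Phi> v w)" for w
    by (rule linearI) (simp_all add: bil_add_left bil_add_right bil_scale_left bil_scale_right
        linear_add[OF linV] linear_scale[OF linV] algebra_simps)
  have l2: "linear (\<lambda>w. ?\<Phi> v w)" for v
    by (rule linearI) (simp_all add: bil_add_left bil_add_right bil_scale_left bil_scale_right
        linear_add[OF linV] linear_scale[OF linV] algebra_simps)
  have "?\<Phi> (axis i 1) w = 0" for i
    using linear_eq_sum_axis[OF l2[of "axis i 1"], of w] by (simp add: basis)
  then show ?thesis
    using linear_eq_sum_axis[OF l1[of w], of v] by simp
qed

text \<open>Tracing the Killing equation: \<open>dij\<close> stands for the derivative of the metric component \<open>hij\<close>
  along the field and \<open>xij\<close> for the derivatives of the components of the field.\<close>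

lemma divergence_free_algebra:
  fixes h11 :: real
  assumes "d11 + 2 * (h11 * x11 + h12 * x21) = 0" "d22 + 2 * (h12 * x12 + h22 * x22) = 0"
    "d12 + (h12 * x11 + h22 * x21) + (h11 * x12 + h12 * x22) = 0"
    and "h11 * h22 - h12 * h12 > 0"
  shows "x11 + x22 + (h22 * d11 + h11 * d22 - 2 * h12 * d12) / (2 * (h11 * h22 - h12 * h12)) = 0"
proof -
  have d: "d11 = - 2 * (h11 * x11 + h12 * x21)" "d22 = - 2 * (h12 * x12 + h22 * x22)"
    "d12 = - (h12 * x11 + h22 * x21) - (h11 * x12 + h12 * x22)" using assms by auto
  have "h22 * d11 + h11 * d22 - 2 * h12 * d12 = - (x11 + x22) * (2 * (h11 * h22 - h12 * h12))"
    unfolding d by (simp add: algebra_simps)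
  then show ?thesis using assms(4) by simp
qed

context closed_riemannian_surface
begin

lemma bil_ginv:
  assumes c: "c \<in> \<B>" "p \<in> cdom c"
  shows "bil (h c p) (ginv h c p *v \<omega>) v = \<omega> \<bullet> v" "h c p *v (ginv h c p *v \<omega>) = \<omega>"
proof -
  have "h c p ** ginv h c p = mat 1"
    unfolding ginv_def matrix_inv_2[OF less_imp_neq[OF det_h_pos[OF c], symmetric]]
    using det_h_pos[OF c]
    by (simp add: vec_eq_iff forall_2 matrix_matrix_mult_def sum_2 mat_def field_simps, simp add: det_2 field_simps)
  then show *: "h c p *v (ginv h c p *v \<omega>) = \<omega>" by (simp add: matrix_vector_mul_assoc)
  show "bil (h c p) (ginv h c p *v \<omega>) v = \<omega> \<bullet> v"
    by (subst bil_commute[OF h_sym[OF c]]) (simp add: bil_def * inner_commute)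
qed

lemma h_nondegenerate:
  assumes c: "c \<in> \<B>" "p \<in> cdom c" and eq: "\<And>v. bil (h c p) a v = bil (h c p) b v"
  shows "a = b"
proof -
  have "bil (h c p) (a - b) (a - b) = 0" using eq[of "a - b"] by (simp add: bil_diff_left)
  then show ?thesis using h_pos[OF c, of "a - b"] by fastforce
qed

lemma bil_trans:
  assumes "c \<in> \<B>" "d \<in> \<B>" "p \<in> cdom c" "p \<in> cdom d"
  shows "bil (h c p) v w = bil (h d p) (jac c d p *v v) (jac c d p *v w)"
  unfolding h_trans[OF assms] by (rule bil_pullback)

text \<open>Raising an index. The transformation law of the vector field follows from that of the covector
  field because \<open>h\<close> is nondegenerate.\<close>

lemma Ck_vfield_ginv:
  assumes Ck: "\<And>c i. c \<in> \<B> \<Longrightarrow> Ck_on k (cmap c ` cdom c) (\<lambda>x. \<omega> c (cinv c x) $ i)"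
    and trans: "\<And>c d p v. c \<in> \<B> \<Longrightarrow> d \<in> \<B> \<Longrightarrow> p \<in> cdom c \<Longrightarrow> p \<in> cdom d \<Longrightarrow> \<omega> c p \<bullet> v = \<omega> d p \<bullet> (jac c d p *v v)"
  shows "Ck_vfield k \<B> (\<lambda>c p. ginv h c p *v \<omega> c p)"
proof (rule Ck_vfieldI)
  fix c assume c: "c \<in> \<B>"
  note op = image_open[OF c]
  have hc: "Ck_on k (cmap c ` cdom c) (\<lambda>x. h c (cinv c x) $ i $ j)" for i j
    using h_Ck_entry[OF c] by (simp only: o_def)
  have dc: "Ck_on k (cmap c ` cdom c) (\<lambda>x. det (h c (cinv c x)))"
    using det_h_Ck[OF c] by (simp only: o_def)
  have dnz: "det (h c (cinv c x)) \<noteq> 0" if "x \<in> cmap c ` cdom c" for x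
    using det_h_pos[OF c cinv_in[OF chart_S[OF c] that]] by simp
  have neg: "Ck_on k (cmap c ` cdom c) (\<lambda>x. - h c (cinv c x) $ i $ j)" for i j
    using Ck_on_diff[OF op Ck_on_const[of k _ 0] hc[of i j]] by simp
  have 1: "Ck_on k (cmap c ` cdom c) (\<lambda>x. h c (cinv c x) $ 2 $ 2 / det (h c (cinv c x)) * \<omega> c (cinv c x) $ 1
      + - h c (cinv c x) $ 1 $ 2 / det (h c (cinv c x)) * \<omega> c (cinv c x) $ 2)"
    by (intro Ck_on_add Ck_on_mult Ck_on_divide hc dc neg Ck[OF c] op dnz)
  have 2: "Ck_on k (cmap c ` cdom c) (\<lambda>x. - h c (cinv c x) $ 1 $ 2 / det (h c (cinv c x)) * \<omega> c (cinv c x) $ 1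
      + h c (cinv c x) $ 1 $ 1 / det (h c (cinv c x)) * \<omega> c (cinv c x) $ 2)"
    by (intro Ck_on_add Ck_on_mult Ck_on_divide hc dc neg Ck[OF c] op dnz)
  have "Ck_on k (cmap c ` cdom c) (\<lambda>x. (ginv h c (cinv c x) *v \<omega> c (cinv c x)) $ i)" for i
  proof -
    have "i = 1 \<or> i = 2" by (rule exhaust_2)
    then show ?thesis
    proof
      assume i: "i = 1"
      show ?thesis
        by (rule Ck_on_cong[OF op _ 1])
          (simp add: i matrix_vector_mult_def sum_2 ginv_h[OF c cinv_in[OF chart_S[OF c]]])
    next
      assume i: "i = 2"
      show ?thesis
        by (rule Ck_on_cong[OF op _ 2])
          (simp add: i matrix_vector_mult_def sum_2 ginv_h[OF c cinv_in[OF chart_S[OF c]]])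
    qed
  qed
  then show "Ck_on k (cmap c ` cdom c) ((\<lambda>p. ginv h c p *v \<omega> c p) \<circ> cinv c)"
    unfolding o_def Ck_on_vec_iff[OF op] by blast
next
  fix c d p assume c: "c \<in> \<B>" "d \<in> \<B>" "p \<in> cdom c" "p \<in> cdom d"
  show "ginv h d p *v \<omega> d p = jac c d p *v (ginv h c p *v \<omega> c p)"
  proof (rule h_nondegenerate[OF c(2,4)])
    fix v
    \<comment> \<open>Test vectors are pulled back to the chart \<open>c\<close>.\<close>
    have v: "v = jac c d p *v (jac d c p *v v)"
      using jac_inverse[OF c(2,1,4,3)] by (simp add: matrix_vector_mul_assoc)
    have "bil (h d p) (jac c d p *v (ginv h c p *v \<omega> c p)) v = bil (h c p) (ginv h c p *v \<omega> c p) (jac d c p *v v)"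
      by (subst v) (rule bil_trans[OF c, symmetric])
    also have "\<dots> = \<omega> d p \<bullet> (jac c d p *v (jac d c p *v v))"
      unfolding bil_ginv(1)[OF c(1,3)] by (rule trans[OF c])
    also have "\<dots> = bil (h d p) (ginv h d p *v \<omega> d p) v"
      unfolding bil_ginv(1)[OF c(2,4)] v[symmetric] ..
    finally show "bil (h d p) (ginv h d p *v \<omega> d p) v = bil (h d p) (jac c d p *v (ginv h c p *v \<omega> c p)) v" by simp
  qed
qed

lemma bil_grad: "c \<in> \<B> \<Longrightarrow> p \<in> cdom c \<Longrightarrow> bil (h c p) (grad h f c p) v = (\<Sum>i\<in>UNIV. v $ i * pd c i f p)"
  unfolding grad_def bil_ginv(1) by (simp add: inner_vec_def mult.commute)

lemma Ck_vfield_grad: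
  assumes f: "Ck_fun (Suc k) \<B> f"
  shows "Ck_vfield k \<B> (grad h f)"
proof -
  have "Ck_vfield k \<B> (\<lambda>c p. ginv h c p *v (\<chi> i. pd c i f p))"
  proof (rule Ck_vfield_ginv)
    fix c i assume c: "c \<in> \<B>"
    show "Ck_on k (cmap c ` cdom c) (\<lambda>x. (\<chi> i. pd c i f (cinv c x)) $ i)"
      using Ck_on_pd[OF chart_S[OF c] image_open[OF c] order_refl, of k f i] f c
      unfolding Ck_fun_def by (simp add: o_def del: Ck_on.simps)
  next
    fix c d p and v :: "real ^ 2" assume c: "c \<in> \<B>" "d \<in> \<B>" "p \<in> cdom c" "p \<in> cdom d"
    have "pd c i f p = (\<Sum>k\<in>UNIV. jac c d p $ k $ i * pd d k f p)" for i
      by (rule pd_chain[OF c Ck_fun_chart_diff[OF f c(2,4)]])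
    then show "(\<chi> i. pd c i f p) \<bullet> v = (\<chi> i. pd d i f p) \<bullet> (jac c d p *v v)"
      by (simp add: inner_vec_def matrix_vector_mult_def sum_2 algebra_simps)
  qed
  then show ?thesis by (simp add: grad_def[abs_def])
qed

lemma bil_Ck:
  assumes V: "Ck_vfield k \<B> V" and W: "Ck_vfield k \<B> W"
  shows "Ck_fun k \<B> (\<lambda>p. bil (h (chart_at \<B> p) p) (V (chart_at \<B> p) p) (W (chart_at \<B> p) p))"
    and "c \<in> \<B> \<Longrightarrow> p \<in> cdom c \<Longrightarrow>
      bil (h (chart_at \<B> p) p) (V (chart_at \<B> p) p) (W (chart_at \<B> p) p) = bil (h c p) (V c p) (W c p)"
proof -
  show eq: "bil (h (chart_at \<B> p) p) (V (chart_at \<B> p) p) (W (chart_at \<B> p) p) = bil (h c p) (V c p) (W c p)"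
    if c: "c \<in> \<B>" "p \<in> cdom c" for c p
  proof -
    have "p \<in> S" using c dom_sub by blast
    note d = chart_atE[OF atlas this]
    show ?thesis
      unfolding bil_trans[OF c(1) d(1) c(2) d(2)]
      using Ck_vfield_trans[OF V c(1) d(1) c(2) d(2)] Ck_vfield_trans[OF W c(1) d(1) c(2) d(2)] by simp
  qed
  show "Ck_fun k \<B> (\<lambda>p. bil (h (chart_at \<B> p) p) (V (chart_at \<B> p) p) (W (chart_at \<B> p) p))"
    unfolding Ck_fun_def
  proof
    fix c assume c: "c \<in> \<B>"
    note op = image_open[OF c]
    have hc: "Ck_on k (cmap c ` cdom c) (\<lambda>x. h c (cinv c x) $ i $ j)" for i j
      using h_Ck_entry[OF c] by (simp only: o_def)
    have Vc: "Ck_on k (cmap c ` cdom c) (\<lambda>x. V c (cinv c x) $ i)" for i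
      using Ck_vfield_Ck_on[OF V c] unfolding Ck_on_vec_iff[OF op] o_def by blast
    have Wc: "Ck_on k (cmap c ` cdom c) (\<lambda>x. W c (cinv c x) $ i)" for i
      using Ck_vfield_Ck_on[OF W c] unfolding Ck_on_vec_iff[OF op] o_def by blast
    have "Ck_on k (cmap c ` cdom c) (\<lambda>x. bil (h c (cinv c x)) (V c (cinv c x)) (W c (cinv c x)))"
      unfolding bil_expand by (intro Ck_on_sum Ck_on_mult op hc Vc Wc)
    then show "Ck_on k (cmap c ` cdom c)
        ((\<lambda>p. bil (h (chart_at \<B> p) p) (V (chart_at \<B> p) p) (W (chart_at \<B> p) p)) \<circ> cinv c)"
      by (rule Ck_on_cong[OF op, rotated]) (simp add: eq[OF c cinv_in[OF chart_S[OF c]]])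
  qed
qed

end

section \<open>Closed surfaces in a Riemannian three-manifold\<close>

text \<open>The curve \<open>x\<close> has no derivative to begin with. But the injective differential \<open>L\<close> bounds the
  increments of \<open>x\<close> by those of \<open>y = F \<circ> x\<close>, so they are of order \<open>t - t0\<close>, and the error in
  \<open>y t - y t0 = L (x t - x t0) + \<dots>\<close> is of lower order. Apply to this a projection \<open>R\<close> that
  annihilates the range of \<open>L\<close>.\<close>

lemma velocity_in_range_of_immersion:
  fixes F :: "'b::euclidean_space \<Rightarrow> 'c::euclidean_space" and x :: "real \<Rightarrow> 'b"
  assumes F: "(F has_derivative L) (at (x t0))" and inj: "inj L" and x: "isCont x t0"
    and y: "(y has_vector_derivative y') (at t0)"
    and W: "open W" "t0 \<in> W" "\<And>t. t \<in> W \<Longrightarrow> y t = F (x t)"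
  shows "y' \<in> range L"
proof -
  have linL: "linear L" by (rule has_derivative_linear[OF F])
  obtain G where G: "linear G" "G \<circ> L = id" using linear_injective_left_inverse[OF linL inj] by blast
  then have GL: "G (L v) = v" for v by (metis comp_apply id_apply)
  define R where "R v = v - L (G v)" for v
  have linR: "linear R"
    unfolding R_def by (intro linear_compose_sub linear_ident linear_compose[OF G(1) linL, unfolded o_def])
  have RL: "R (L v) = 0" for v by (simp add: R_def GL)
  obtain B where B: "B > 0" "\<And>v. norm (G v) \<le> B * norm v" using linear_bounded_pos[OF G(1)] by blast
  obtain D where D: "D > 0" "\<And>v. norm (R v) \<le> D * norm v" using linear_bounded_pos[OF linR] by blast
  define Q where "Q z = F z - F (x t0) - L (z - x t0)" for z
  \<comment> \<open>The bound on \<open>e\<close> lets the term \<open>B * norm (Q (x t))\<close> be absorbed by \<open>norm (x t - x t0)\<close>.\<close>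
  have est: "norm (R y') \<le> e * (D * (2 * B * (norm y' + 1)) + D)" if e: "0 < e" "e \<le> 1 / (2 * B)" "e \<le> 1" for e
  proof -
    obtain d where d: "d > 0" "\<And>z. norm (z - x t0) < d \<Longrightarrow> norm (Q z) \<le> e * norm (z - x t0)"
      using F e(1) unfolding has_derivative_at_alt Q_def by blast
    have "\<forall>\<^sub>F t in at t0. dist (x t) (x t0) < d" using x d(1) by (auto simp: isCont_def tendsto_iff)
    moreover have "\<forall>\<^sub>F t in at t0. t \<in> W" using W(1,2) by (auto simp: eventually_at_topological)
    moreover obtain d' where d': "d' > 0" "\<And>t. norm (t - t0) < d' \<Longrightarrow>
        norm (y t - y t0 - (t - t0) *\<^sub>R y') \<le> e * norm (t - t0)"
      using y e(1) unfolding has_vector_derivative_def has_derivative_at_alt by blast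
    then have "\<forall>\<^sub>F t in at t0. norm (t - t0) < d'"
      by (auto simp: eventually_at dist_norm intro!: exI[of _ d'])
    moreover have "\<forall>\<^sub>F t in at t0. t \<noteq> t0" by (simp add: eventually_at_filter)
    ultimately have "\<forall>\<^sub>F t in at t0. dist (x t) (x t0) < d \<and> t \<in> W \<and> norm (t - t0) < d' \<and> t \<noteq> t0"
      by eventually_elim simp
    then obtain t where t: "norm (x t - x t0) < d" "t \<in> W" "norm (t - t0) < d'" "t \<noteq> t0"
      using eventually_happens[of _ "at t0"] by (auto simp: dist_norm)
    have dy: "y t - y t0 = L (x t - x t0) + Q (x t)" using W(2,3) t(2) by (simp add: Q_def)
    have Qx: "norm (Q (x t)) \<le> e * norm (x t - x t0)" by (rule d(2)[OF t(1)])
    have "x t - x t0 = G (y t - y t0) - G (Q (x t))"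
      unfolding dy linear_add[OF G(1)] GL by simp
    then have "norm (x t - x t0) \<le> norm (G (y t - y t0)) + norm (G (Q (x t)))"
      by (metis norm_triangle_ineq4)
    also have "\<dots> \<le> B * norm (y t - y t0) + B * (e * norm (x t - x t0))"
      using B(2)[of "y t - y t0"] order_trans[OF B(2)[of "Q (x t)"] mult_left_mono[OF Qx]] B(1) by (intro add_mono) auto
    also have "\<dots> \<le> B * norm (y t - y t0) + norm (x t - x t0) / 2"
      using mult_right_mono[OF e(2), of "B * norm (x t - x t0)"] B(1) by (simp add: field_simps)
    finally have xy: "norm (x t - x t0) \<le> 2 * B * norm (y t - y t0)" by simp
    have ye: "norm (y t - y t0 - (t - t0) *\<^sub>R y') \<le> e * norm (t - t0)" by (rule d'(2)[OF t(3)])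
    have "norm (y t - y t0) \<le> norm ((t - t0) *\<^sub>R y') + norm (y t - y t0 - (t - t0) *\<^sub>R y')"
      by (metis add_diff_cancel_left' diff_add_cancel norm_triangle_ineq add.commute)
    also have "\<dots> \<le> norm (t - t0) * norm y' + 1 * norm (t - t0)"
      using order_trans[OF ye mult_right_mono[OF e(3) norm_ge_zero]] by simp
    finally have yt: "norm (y t - y t0) \<le> (norm y' + 1) * norm (t - t0)" by (simp add: algebra_simps)
    have "(t - t0) *\<^sub>R R y' = R (Q (x t)) - R (y t - y t0 - (t - t0) *\<^sub>R y')"
      by (simp add: dy linear_diff[OF linR] linear_add[OF linR] linear_scale[OF linR] RL)
    then have "norm (t - t0) * norm (R y') \<le> norm (R (Q (x t))) + norm (R (y t - y t0 - (t - t0) *\<^sub>R y'))"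
      by (metis norm_scaleR norm_triangle_ineq4 real_norm_def)
    also have "\<dots> \<le> D * (e * (2 * B * ((norm y' + 1) * norm (t - t0)))) + D * (e * norm (t - t0))"
    proof (rule add_mono)
      have "norm (R (Q (x t))) \<le> D * norm (Q (x t))" by (rule D(2))
      also have "\<dots> \<le> D * (e * norm (x t - x t0))" using Qx D(1) by (intro mult_left_mono) auto
      also have "\<dots> \<le> D * (e * (2 * B * norm (y t - y t0)))" using xy D(1) e(1) by (intro mult_left_mono) auto
      also have "\<dots> \<le> D * (e * (2 * B * ((norm y' + 1) * norm (t - t0))))"
        using yt D(1) e(1) B(1) by (intro mult_left_mono) auto
      finally show "norm (R (Q (x t))) \<le> D * (e * (2 * B * ((norm y' + 1) * norm (t - t0))))" .
      show "norm (R (y t - y t0 - (t - t0) *\<^sub>R y')) \<le> D * (e * norm (t - t0))"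
        using order_trans[OF D(2) mult_left_mono[OF ye]] D(1) by auto
    qed
    also have "\<dots> = norm (t - t0) * (e * (D * (2 * B * (norm y' + 1)) + D))" by (simp add: algebra_simps)
    finally show ?thesis using t(4) by (simp add: mult_le_cancel_left_pos)
  qed
  have "R y' = 0"
  proof (rule ccontr)
    assume "R y' \<noteq> 0"
    then have n: "norm (R y') > 0" by simp
    define C where "C = D * (2 * B * (norm y' + 1)) + D"
    have C: "C > 0" using D(1) B(1) by (auto simp: C_def intro!: add_nonneg_pos mult_nonneg_nonneg add_nonneg_nonneg)
    define e where "e = min (min (1 / (2 * B)) 1) (norm (R y') / (2 * C))"
    have e: "0 < e" "e \<le> 1 / (2 * B)" "e \<le> 1" "e \<le> norm (R y') / (2 * C)"
      using n C B(1) by (auto simp: e_def)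
    have "norm (R y') \<le> e * C" using est[OF e(1-3)] by (simp add: C_def)
    also have "\<dots> \<le> norm (R y') / (2 * C) * C" using e(4) C by (intro mult_right_mono) auto
    also have "\<dots> = norm (R y') / 2" using C by simp
    finally show False using n by simp
  qed
  then have "y' = L (G y')" by (simp add: R_def)
  then show ?thesis by (rule range_eqI)
qed

locale closed_surface_in_manifold =
  fixes M S :: "'a::{second_countable_topology, t2_space} set"
    and \<A> :: "('a, 3) chart set" and \<B> :: "('a, 2) chart set" and g :: "('a, 3) tensor2"
  assumes M_manifold: "smooth_atlas M \<A>" and g: "riemannian_metric \<A> g"
    and surface: "closed_surface M \<A> S \<B>"
begin

lemma S_atlas: "smooth_atlas S \<B>"
  using surface unfolding closed_surface_def smooth_manifold_def by blast

sublocale incl: smooth_inclusion S \<B> M \<A>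
  using surface S_atlas M_manifold unfolding closed_surface_def
  by unfold_locales blast+

lemma jac_inj: "c \<in> \<B> \<Longrightarrow> C \<in> \<A> \<Longrightarrow> p \<in> cdom c \<Longrightarrow> p \<in> cdom C \<Longrightarrow> inj ((*v) (jac c C p))"
  using surface unfolding closed_surface_def by blast

lemma in_S: "c \<in> \<B> \<Longrightarrow> p \<in> cdom c \<Longrightarrow> p \<in> S"
  using chart_dom_subset[OF incl.chart_S] by blast

lemma ambient_chart: "p \<in> S \<Longrightarrow> \<exists>C\<in>\<A>. p \<in> cdom C"
  using chart_atE[OF M_manifold] incl.S_sub_M by blast

lemma tensor_trans: "smooth_sym_tensor2 \<A> T \<Longrightarrow> C \<in> \<A> \<Longrightarrow> D \<in> \<A> \<Longrightarrow> p \<in> cdom C \<Longrightarrow> p \<in> cdom D \<Longrightarrow>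
    T C p = transpose (jac C D p) ** T D p ** jac C D p"
  unfolding smooth_sym_tensor2_def by blast

lemma tensor_sym: "smooth_sym_tensor2 \<A> T \<Longrightarrow> C \<in> \<A> \<Longrightarrow> p \<in> cdom C \<Longrightarrow> transpose (T C p) = T C p"
  unfolding smooth_sym_tensor2_def by blast

lemma pullback2_eq:
  assumes T: "smooth_sym_tensor2 \<A> T" and c: "c \<in> \<B>" "p \<in> cdom c" and C: "C \<in> \<A>" "p \<in> cdom C"
  shows "pullback2 \<A> T c p = transpose (jac c C p) ** T C p ** jac c C p"
proof -
  let ?D = "chart_at \<A> p"
  have "p \<in> M" using in_S[OF c] incl.S_sub_M by blast
  note D = chart_atE[OF M_manifold this]
  have J: "jac c ?D p = jac C ?D p ** jac c C p"
    by (rule incl.jac_comp_target[OF c(1) C(1) D(1) c(2) C(2) D(2)])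
  show ?thesis
    unfolding pullback2_def Let_def J tensor_trans[OF T C(1) D(1) C(2) D(2)]
    by (simp add: matrix_transpose_mul matrix_mul_assoc)
qed

lemma bil_pullback2:
  assumes T: "smooth_sym_tensor2 \<A> T" and c: "c \<in> \<B>" "p \<in> cdom c" and C: "C \<in> \<A>" "p \<in> cdom C"
  shows "bil (pullback2 \<A> T c p) v w = bil (T C p) (jac c C p *v v) (jac c C p *v w)"
  unfolding pullback2_eq[OF assms] by (rule bil_pullback)

lemma tensor_along_Ck:
  assumes T: "smooth_sym_tensor2 \<A> T" and c: "c \<in> \<B>" "C \<in> \<A>"
  shows "Ck_on k (cmap c ` (cdom C \<inter> cdom c)) (\<lambda>x. T C (cinv c x) $ i $ j)"
proof -
  have "smooth_in_chart C (cdom C) (T C)" using T c(2) unfolding smooth_sym_tensor2_def by blast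
  then have "Ck_on k (cmap C ` cdom C) (T C \<circ> cinv C)" by (simp add: smooth_in_chart_def smooth_on_def)
  from incl.Ck_on_pullback[OF c this]
  show ?thesis using incl.overlap_open[OF c] by (simp add: Ck_on_vec_iff o_def)
qed

lemma smooth_sym_tensor2_pullback2:
  assumes T: "smooth_sym_tensor2 \<A> T"
  shows "smooth_sym_tensor2 \<B> (pullback2 \<A> T)"
  unfolding smooth_sym_tensor2_def
proof (intro conjI ballI)
  fix c assume c: "c \<in> \<B>"
  show "smooth_in_chart c (cdom c) (pullback2 \<A> T c)"
    unfolding smooth_in_chart_def smooth_on_def Int_absorb
  proof (rule allI, rule Ck_on_local)
    fix k x assume "x \<in> cmap c ` cdom c"
    then obtain p where p: "p \<in> cdom c" "x = cmap c p" by blast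
    obtain C where C: "C \<in> \<A>" "p \<in> cdom C" using ambient_chart[OF in_S[OF c p(1)]] by blast
    let ?W = "cmap c ` (cdom C \<inter> cdom c)"
    note op = incl.overlap_open[OF c C(1)]
    have "Ck_on k ?W (\<lambda>x. (transpose (jac c C (cinv c x)) ** T C (cinv c x) ** jac c C (cinv c x)) $ a $ b)" for a b
      unfolding matrix_matrix_mult_def transpose_def vec_lambda_beta
      by (intro Ck_on_sum Ck_on_mult op incl.jac_Ck_entry[OF c C(1)] tensor_along_Ck[OF T c C(1)])
    then have "Ck_on k ?W (\<lambda>x. transpose (jac c C (cinv c x)) ** T C (cinv c x) ** jac c C (cinv c x))"
      unfolding Ck_on_vec_iff[OF op] by blast
    then have "Ck_on k ?W (pullback2 \<A> T c \<circ> cinv c)"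
    proof (rule Ck_on_cong[OF op, rotated])
      fix y assume "y \<in> ?W"
      then have "cinv c y \<in> cdom c" "cinv c y \<in> cdom C" using cinv_cmap[OF incl.chart_S[OF c]] by auto
      then show "transpose (jac c C (cinv c y)) ** T C (cinv c y) ** jac c C (cinv c y) = (pullback2 \<A> T c \<circ> cinv c) y"
        using pullback2_eq[OF T c _ C(1)] by simp
    qed
    moreover have "x \<in> ?W" using p C(2) by blast
    ultimately show "\<exists>V. open V \<and> x \<in> V \<and> Ck_on k V (pullback2 \<A> T c \<circ> cinv c)" using op by blast
  qed
next
  fix c p assume c: "c \<in> \<B>" "p \<in> cdom c"
  obtain C where C: "C \<in> \<A>" "p \<in> cdom C" using ambient_chart[OF in_S[OF c]] by blast
  show "transpose (pullback2 \<A> T c p) = pullback2 \<A> T c p"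
    unfolding pullback2_eq[OF T c C] by (simp add: matrix_transpose_mul matrix_mul_assoc tensor_sym[OF T C])
next
  fix c d p assume c: "c \<in> \<B>" "d \<in> \<B>" and p: "p \<in> cdom c \<inter> cdom d"
  then have p: "p \<in> cdom c" "p \<in> cdom d" by auto
  obtain C where C: "C \<in> \<A>" "p \<in> cdom C" using ambient_chart[OF in_S[OF c(1) p(1)]] by blast
  have J: "jac c C p = jac d C p ** jac c d p" by (rule incl.jac_comp_source[OF c C(1) p C(2)])
  show "pullback2 \<A> T c p = transpose (jac c d p) ** pullback2 \<A> T d p ** jac c d p"
    unfolding pullback2_eq[OF T c(1) p(1) C] pullback2_eq[OF T c(2) p(2) C] J
    by (simp add: matrix_transpose_mul matrix_mul_assoc)
qed

lemma g_tensor: "smooth_sym_tensor2 \<A> g"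
  using g unfolding riemannian_metric_def by blast

lemma g_pos: "C \<in> \<A> \<Longrightarrow> p \<in> cdom C \<Longrightarrow> v \<noteq> 0 \<Longrightarrow> bil (g C p) v v > 0"
  using g unfolding riemannian_metric_def by blast

lemma riemannian_metric_pullback2: "riemannian_metric \<B> (pullback2 \<A> g)"
  unfolding riemannian_metric_def
proof (intro conjI ballI allI impI smooth_sym_tensor2_pullback2[OF g_tensor])
  fix c p and v :: "real ^ 2" assume c: "c \<in> \<B>" "p \<in> cdom c" and v: "v \<noteq> 0"
  obtain C where C: "C \<in> \<A>" "p \<in> cdom C" using ambient_chart[OF in_S[OF c]] by blast
  have "jac c C p *v v \<noteq> jac c C p *v 0" using v injD[OF jac_inj[OF c(1) C(1) c(2) C(2)]] by blast
  then show "bil (pullback2 \<A> g c p) v v > 0"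
    unfolding bil_pullback2[OF g_tensor c C] using g_pos[OF C] by simp
qed

sublocale surf: closed_riemannian_surface S \<B> "pullback2 \<A> g"
  using S_atlas surface riemannian_metric_pullback2 unfolding closed_surface_def
  by unfold_locales blast+

lemma vfield_along_trans:
  "smooth_vfield_along \<B> \<A> S V \<Longrightarrow> C \<in> \<A> \<Longrightarrow> D \<in> \<A> \<Longrightarrow> p \<in> S \<Longrightarrow> p \<in> cdom C \<Longrightarrow> p \<in> cdom D \<Longrightarrow> V D p = jac C D p *v V C p"
  unfolding smooth_vfield_along_def by blast

lemma vfield_along_Ck:
  assumes "smooth_vfield_along \<B> \<A> S V" "c \<in> \<B>" "C \<in> \<A>"
  shows "Ck_on k (cmap c ` (cdom C \<inter> cdom c)) (\<lambda>x. V C (cinv c x))"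
  using assms unfolding smooth_vfield_along_def smooth_in_chart_def smooth_on_def o_def by blast

lemma vfield_along_restrict:
  assumes V: "smooth_vfield M \<A> V"
  shows "smooth_vfield_along \<B> \<A> S V"
proof -
  have "smooth_in_chart c (cdom C) (V C)" if c: "c \<in> \<B>" "C \<in> \<A>" for c C
  proof -
    have "smooth_in_chart C (cdom C) (V C)"
      using V c(2) unfolding smooth_vfield_def smooth_vfield_along_def by blast
    then have "Ck_on k (cmap C ` cdom C) (V C \<circ> cinv C)" for k
      by (simp add: smooth_in_chart_def smooth_on_def)
    from incl.Ck_on_pullback[OF c this] show ?thesis by (simp add: smooth_in_chart_def smooth_on_def)
  qed
  moreover have "V D p = jac C D p *v V C p" if "C \<in> \<A>" "D \<in> \<A>" "p \<in> S \<inter> cdom C \<inter> cdom D" for C D p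
    using V that incl.S_sub_M unfolding smooth_vfield_def smooth_vfield_along_def by blast
  ultimately show ?thesis unfolding smooth_vfield_along_def by blast
qed

lemma tangent_covector:
  assumes T: "smooth_sym_tensor2 \<A> T" and V: "smooth_vfield_along \<B> \<A> S V"
    and c: "c \<in> \<B>" "p \<in> cdom c" and C: "C \<in> \<A>" "p \<in> cdom C"
  shows "(\<chi> a. bil (T (chart_at \<A> p) p) (V (chart_at \<A> p) p) (column a (jac c (chart_at \<A> p) p))) \<bullet> v =
    bil (T C p) (V C p) (jac c C p *v v)"
proof -
  let ?D = "chart_at \<A> p"
  have pS: "p \<in> S" by (rule in_S[OF c])
  then have "p \<in> M" using incl.S_sub_M by blast
  note D = chart_atE[OF M_manifold this]
  have lin: "linear (\<lambda>v. bil A w (B *v v))" for A w and B :: "real ^ 2 ^ 3"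
    by (rule linearI) (simp_all add: bil_add_right bil_scale_right matrix_vector_right_distrib matrix_vector_mult_scaleR)
  have "(\<chi> a. bil (T ?D p) (V ?D p) (column a (jac c ?D p))) \<bullet> v = bil (T ?D p) (V ?D p) (jac c ?D p *v v)"
    using linear_eq_sum_axis[OF lin, of "T ?D p" "V ?D p" "jac c ?D p" v]
    by (simp add: inner_vec_def matrix_vector_mult_basis mult.commute)
  also have "\<dots> = bil (T ?D p) (jac C ?D p *v V C p) (jac C ?D p *v (jac c C p *v v))"
    unfolding incl.jac_comp_target[OF c(1) C(1) D(1) c(2) C(2) D(2)] vfield_along_trans[OF V C(1) D(1) pS C(2) D(2)]
      matrix_vector_mul_assoc ..
  also have "\<dots> = bil (T C p) (V C p) (jac c C p *v v)"
    unfolding tensor_trans[OF T C(1) D(1) C(2) D(2)] by (rule bil_pullback[symmetric])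
  finally show ?thesis .
qed

lemma bil_tangent_dual:
  assumes T: "smooth_sym_tensor2 \<A> T" and V: "smooth_vfield_along \<B> \<A> S V"
    and c: "c \<in> \<B>" "p \<in> cdom c" and C: "C \<in> \<A>" "p \<in> cdom C"
  shows "bil (pullback2 \<A> g c p) (tangent_dual \<A> g T V c p) v = bil (T C p) (V C p) (jac c C p *v v)"
  unfolding tangent_dual_def Let_def surf.bil_ginv(1)[OF c] by (rule tangent_covector[OF assms])

lemma Ck_vfield_tangent_dual:
  assumes T: "smooth_sym_tensor2 \<A> T" and V: "smooth_vfield_along \<B> \<A> S V"
  shows "Ck_vfield k \<B> (tangent_dual \<A> g T V)"
proof -
  define \<omega> where "\<omega> c p = (\<chi> a. bil (T (chart_at \<A> p) p) (V (chart_at \<A> p) p) (column a (jac c (chart_at \<A> p) p)))"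
    for c :: "('a, 2) chart" and p
  have \<omega>: "\<omega> c p \<bullet> v = bil (T C p) (V C p) (jac c C p *v v)"
    if "c \<in> \<B>" "p \<in> cdom c" "C \<in> \<A>" "p \<in> cdom C" for c p C v
    unfolding \<omega>_def by (rule tangent_covector[OF T V that])
  have "Ck_vfield k \<B> (\<lambda>c p. ginv (pullback2 \<A> g) c p *v \<omega> c p)"
  proof (rule surf.Ck_vfield_ginv)
    fix c i assume c: "c \<in> \<B>"
    show "Ck_on k (cmap c ` cdom c) (\<lambda>x. \<omega> c (cinv c x) $ i)"
    proof (rule Ck_on_local)
      fix x assume "x \<in> cmap c ` cdom c"
      then obtain p where p: "p \<in> cdom c" "x = cmap c p" by blast
      obtain C where C: "C \<in> \<A>" "p \<in> cdom C" using ambient_chart[OF in_S[OF c p(1)]] by blast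
      let ?W = "cmap c ` (cdom C \<inter> cdom c)"
      note op = incl.overlap_open[OF c C(1)]
      have Vi: "Ck_on k ?W (\<lambda>x. V C (cinv c x) $ j)" for j
        using vfield_along_Ck[OF V c C(1), of k] by (simp add: Ck_on_vec_iff[OF op])
      have "Ck_on k ?W (\<lambda>x. \<Sum>a\<in>UNIV. \<Sum>b\<in>UNIV. V C (cinv c x) $ a * T C (cinv c x) $ a $ b * jac c C (cinv c x) $ b $ i)"
        by (intro Ck_on_sum Ck_on_mult op incl.jac_Ck_entry[OF c C(1)] tensor_along_Ck[OF T c C(1)] Vi)
      then have "Ck_on k ?W (\<lambda>x. \<omega> c (cinv c x) $ i)"
      proof (rule Ck_on_cong[OF op, rotated])
        fix y assume "y \<in> ?W"
        then have "cinv c y \<in> cdom c" "cinv c y \<in> cdom C" using cinv_cmap[OF incl.chart_S[OF c]] by auto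
        from \<omega>[OF c this(1) C(1) this(2), of "axis i 1"]
        show "(\<Sum>a\<in>UNIV. \<Sum>b\<in>UNIV. V C (cinv c y) $ a * T C (cinv c y) $ a $ b * jac c C (cinv c y) $ b $ i) = \<omega> c (cinv c y) $ i"
          by (simp add: inner_axis bil_expand matrix_vector_mult_basis column_def)
      qed
      moreover have "x \<in> ?W" using p C(2) by blast
      ultimately show "\<exists>V. open V \<and> x \<in> V \<and> Ck_on k V (\<lambda>x. \<omega> c (cinv c x) $ i)" using op by blast
    qed
  next
    fix c d p and v :: "real ^ 2" assume c: "c \<in> \<B>" "d \<in> \<B>" and p: "p \<in> cdom c" "p \<in> cdom d"
    obtain C where C: "C \<in> \<A>" "p \<in> cdom C" using ambient_chart[OF in_S[OF c(1) p(1)]] by blast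
    show "\<omega> c p \<bullet> v = \<omega> d p \<bullet> (jac c d p *v v)"
      unfolding \<omega>[OF c(1) p(1) C] \<omega>[OF c(2) p(2) C] incl.jac_comp_source[OF c C(1) p C(2)]
        matrix_vector_mul_assoc ..
  qed
  then show ?thesis by (simp add: tangent_dual_def[abs_def] Let_def \<omega>_def)
qed

text \<open>Invariance provides, through every point of \<open>S\<close>, an integral curve that stays in \<open>S\<close>. In the
  charts of \<open>S\<close> it is a priori only a continuous curve.\<close>

lemma invariant_set_tangent:
  assumes inv: "invariant_set M \<A> V S" and c: "c \<in> \<B>" "p \<in> cdom c" and C: "C \<in> \<A>" "p \<in> cdom C"
  shows "\<exists>u. jac c C p *v u = V C p"
proof -
  have pS: "p \<in> S" by (rule in_S[OF c])
  \<comment> \<open>At time \<open>1\<close> rather than \<open>0\<close>: the point \<open>p\<close> is the image of a point of \<open>S\<close>, whose orbit lies in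
    \<open>S\<close>.\<close>
  then have "p \<in> flow_image M \<A> V 1 S" using inv unfolding invariant_set_def by blast
  then obtain \<gamma> I where \<gamma>: "integral_curve M \<A> V I \<gamma>" "0 \<in> I" "1 \<in> I" "\<gamma> 0 \<in> S" "\<gamma> 1 = p"
    unfolding flow_image_def by blast
  have I: "open I" "continuous_on I \<gamma>" using \<gamma>(1) unfolding integral_curve_def by blast+
  have \<gamma>S: "\<gamma> t \<in> S" if "t \<in> I" for t
  proof -
    have "\<gamma> t \<in> flow_image M \<A> V t S" unfolding flow_image_def using \<gamma> that by blast
    then show ?thesis using inv unfolding invariant_set_def by blast
  qed
  obtain T where T: "open T" "cdom c = S \<inter> T"
    using incl.chart_S[OF c(1)] unfolding is_chart_def openin_open by blast
  obtain T' where T': "open T'" "cdom C = M \<inter> T'"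
    using incl.chart_M[OF C(1)] unfolding is_chart_def openin_open by blast
  define W where "W = I \<inter> \<gamma> -` (T \<inter> T')"
  have W: "open W" unfolding W_def using I T(1) T'(1) by (intro continuous_open_preimage) auto
  have W1: "1 \<in> W" using \<gamma> c(2) C(2) T T' by (auto simp: W_def)
  have \<gamma>W: "\<gamma> t \<in> cdom c" "\<gamma> t \<in> cdom C" if "t \<in> W" for t
    using that \<gamma>S incl.S_sub_M T T' by (auto simp: W_def)
  have cont: "continuous_on (cdom c) (cmap c)"
    using incl.chart_S[OF c(1)] unfolding is_chart_def homeomorphism_def by blast
  have "continuous_on W (\<lambda>t. cmap c (\<gamma> t))"
    using \<gamma>W(1) by (intro continuous_on_compose2[OF cont] continuous_on_subset[OF I(2)]) (auto simp: W_def)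
  then have x: "isCont (\<lambda>t. cmap c (\<gamma> t)) 1" using W W1 by (simp add: continuous_on_eq_continuous_at)
  have y: "((\<lambda>t. cmap C (\<gamma> t)) has_vector_derivative V C p) (at 1)"
    using \<gamma>(1,3,5) C unfolding integral_curve_def o_def by blast
  have F: "(cmap C \<circ> cinv c has_derivative (*v) (jac c C p)) (at (cmap c (\<gamma> 1)))"
    unfolding \<gamma>(5) by (rule incl.jac_deriv[OF c(1) C(1) c(2) C(2)])
  have "V C p \<in> range ((*v) (jac c C p))"
    by (rule velocity_in_range_of_immersion[OF F jac_inj[OF c(1) C(1) c(2) C(2)] x y W W1])
      (simp add: cinv_cmap[OF incl.chart_S[OF c(1)]] \<gamma>W(1))
  then show ?thesis by (auto simp: image_iff eq_commute)
qed

end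

section \<open>Killing fields tangent to a surface\<close>

locale killing_surface = closed_surface_in_manifold +
  fixes \<nu> \<eta> :: "('a, 3) vfield"
  assumes normal: "unit_normal \<A> g S \<B> \<nu>"
    and killing: "killing_field M \<A> g \<eta>" and invariant: "invariant_set M \<A> \<eta> S"
begin

abbreviation h :: "('a, 2) tensor2" where "h \<equiv> pullback2 \<A> g"

abbreviation \<xi> :: "('a, 2) vfield" where "\<xi> \<equiv> tangent_part \<A> g \<eta>"

lemma \<eta>_smooth: "smooth_vfield M \<A> \<eta>"
  using killing unfolding killing_field_def by blast

lemma \<eta>_along: "smooth_vfield_along \<B> \<A> S \<eta>"
  by (rule vfield_along_restrict[OF \<eta>_smooth])

lemma \<nu>_along: "smooth_vfield_along \<B> \<A> S \<nu>"
  using normal unfolding unit_normal_def by blast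

lemma \<xi>_Ck: "Ck_vfield k \<B> \<xi>"
  unfolding tangent_part_def by (rule Ck_vfield_tangent_dual[OF g_tensor \<eta>_along])

lemma \<xi>_related:
  assumes c: "c \<in> \<B>" "p \<in> cdom c" and C: "C \<in> \<A>" "p \<in> cdom C"
  shows "jac c C p *v \<xi> c p = \<eta> C p"
proof -
  obtain u where u: "jac c C p *v u = \<eta> C p" using invariant_set_tangent[OF invariant c C] by blast
  have "\<xi> c p = u"
  proof (rule surf.h_nondegenerate[OF c])
    fix v
    show "bil (h c p) (\<xi> c p) v = bil (h c p) u v"
      using bil_tangent_dual[OF g_tensor \<eta>_along c C, of v] bil_pullback2[OF g_tensor c C, of u v] u
      by (simp only: tangent_part_def)
  qed
  then show ?thesis using u by simp
qed

lemma vanishes_at_iff: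
  assumes c: "c \<in> \<B>" "p \<in> cdom c"
  shows "vanishes_at \<A> \<eta> p \<longleftrightarrow> \<xi> c p = 0"
proof
  assume "vanishes_at \<A> \<eta> p"
  moreover obtain C where C: "C \<in> \<A>" "p \<in> cdom C" using ambient_chart[OF in_S[OF c]] by blast
  ultimately have "jac c C p *v \<xi> c p = jac c C p *v 0"
    using \<xi>_related[OF c C] by (simp add: vanishes_at_def)
  then show "\<xi> c p = 0" by (rule injD[OF jac_inj[OF c(1) C(1) c(2) C(2)]])
next
  assume "\<xi> c p = 0"
  then show "vanishes_at \<A> \<eta> p" unfolding vanishes_at_def using \<xi>_related[OF c] by fastforce
qed

text \<open>The data of the locale \<open>related_fields\<close> at a point of \<open>S\<close>, for a chart \<open>c\<close> of \<open>S\<close> and an ambient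
  chart \<open>C\<close>.\<close>

abbreviation dJ :: "('a, 2) chart \<Rightarrow> ('a, 3) chart \<Rightarrow> 'a \<Rightarrow> real ^ 2 \<Rightarrow> real ^ 2 ^ 3" where
  "dJ c C p \<equiv> frechet_derivative (\<lambda>z. jac c C (cinv c z)) (at (cmap c p))"

abbreviation d\<xi> :: "('a, 2) chart \<Rightarrow> 'a \<Rightarrow> real ^ 2 \<Rightarrow> real ^ 2" where
  "d\<xi> c p \<equiv> frechet_derivative (\<xi> c \<circ> cinv c) (at (cmap c p))"

abbreviation d\<eta> :: "('a, 3) chart \<Rightarrow> 'a \<Rightarrow> real ^ 3 \<Rightarrow> real ^ 3" where
  "d\<eta> C p \<equiv> frechet_derivative (\<eta> C \<circ> cinv C) (at (cmap C p))"

abbreviation dT :: "('a, 3) tensor2 \<Rightarrow> ('a, 3) chart \<Rightarrow> 'a \<Rightarrow> real ^ 3 \<Rightarrow> real ^ 3 ^ 3" where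
  "dT T C p \<equiv> frechet_derivative (T C \<circ> cinv C) (at (cmap C p))"

lemma related_fields_at:
  assumes c: "c \<in> \<B>" "p \<in> cdom c" and C: "C \<in> \<A>" "p \<in> cdom C"
  shows "related_fields (cmap c ` (cdom C \<inter> cdom c)) (cmap c p) (cmap C \<circ> cinv c)
    (\<lambda>z. jac c C (cinv c z)) (dJ c C p)
    (\<xi> c \<circ> cinv c) (d\<xi> c p)
    (\<eta> C \<circ> cinv C) (d\<eta> C p)"
proof
  let ?W = "cmap c ` (cdom C \<inter> cdom c)"
  let ?J = "\<lambda>z. jac c C (cinv c z)" and ?J' = "dJ c C p"
  note op = incl.overlap_open[OF c(1) C(1)] and ch = incl.chart_S[OF c(1)]
  have cp: "cinv c (cmap c p) = p" "cinv C (cmap C p) = p"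
    using cinv_cmap[OF ch c(2)] cinv_cmap[OF incl.chart_M[OF C(1)] C(2)] .
  show "open ?W" by (rule op)
  show pW: "cmap c p \<in> ?W" using c C by blast
  show "(cmap C \<circ> cinv c has_derivative (*v) (jac c C (cinv c (cmap c p)))) (at (cmap c p))"
    unfolding cp by (rule incl.jac_deriv[OF c(1) C(1) c(2) C(2)])
  have "Ck_on (Suc 0) ?W ?J"
    unfolding Ck_on_vec_iff[OF op] using incl.jac_Ck_entry[OF c(1) C(1)] by blast
  from Ck_on_has_derivative[OF this pW] show J': "(?J has_derivative ?J') (at (cmap c p))" .
  have "Ck_on (Suc 0) (cmap c ` cdom c) (\<xi> c \<circ> cinv c)" by (rule surf.Ck_vfield_Ck_on[OF \<xi>_Ck c(1)])
  then show "(\<xi> c \<circ> cinv c has_derivative d\<xi> c p) (at (cmap c p))"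
    by (rule Ck_on_has_derivative) (use c in blast)
  have "smooth_in_chart C (cdom C) (\<eta> C)"
    using \<eta>_smooth C(1) unfolding smooth_vfield_def smooth_vfield_along_def by blast
  then have "Ck_on (Suc 0) (cmap C ` cdom C) (\<eta> C \<circ> cinv C)"
    by (simp add: smooth_in_chart_def smooth_on_def del: Ck_on.simps)
  then show "(\<eta> C \<circ> cinv C has_derivative d\<eta> C p)
      (at ((cmap C \<circ> cinv c) (cmap c p)))"
    unfolding o_apply cp(1) by (rule Ck_on_has_derivative) (use C in blast)
  show "jac c C (cinv c z) *v (\<xi> c \<circ> cinv c) z = (\<eta> C \<circ> cinv C) ((cmap C \<circ> cinv c) z)" if zW: "z \<in> ?W" for z
  proof -
    obtain q where q: "q \<in> cdom C" "q \<in> cdom c" "z = cmap c q" using zW by blast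
    show ?thesis
      using \<xi>_related[OF c(1) q(2) C(1) q(1)] cinv_cmap[OF ch q(2)] cinv_cmap[OF incl.chart_M[OF C(1)] q(1)] q(3)
      by simp
  qed
  show "?J' v *v w = ?J' w *v v" for v w
  proof -
    have entry: "?J' (axis j 1) $ k $ i = pd c j (pd c i (\<lambda>q. cmap C q $ k)) p" for i j k
    proof -
      have "pd c j (\<lambda>q. jac c C q $ k $ i) p = ?J' (axis j 1) $ k $ i"
        by (rule pd_eq) (use bounded_linear.has_derivative[OF bounded_linear_vec_nth
          bounded_linear.has_derivative[OF bounded_linear_vec_nth J']] in \<open>simp add: o_def\<close>)
      then show ?thesis by (simp add: jac_def)
    qed
    have sym: "?J' (axis j 1) $ k $ i = ?J' (axis i 1) $ k $ j" for i j k
    proof -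
      have "Ck_on 2 ?W ((\<lambda>q. cmap C q $ k) \<circ> cinv c)"
        using Ck_on_bounded_linear_comp[OF bounded_linear_vec_nth op incl.inclusion_Ck[OF c(1) C(1)]] by (simp add: o_def)
      from pd_commute[OF ch op _ _ this, of p j i] c C show ?thesis unfolding entry by blast
    qed
    have lin: "?J' v = v $ 1 *\<^sub>R ?J' (axis 1 1) + v $ 2 *\<^sub>R ?J' (axis 2 1)" for v
      using linear_eq_sum_axis[OF has_derivative_linear[OF J'], of v] by (simp add: sum_2)
    have "(?J' v *v w) $ k = (?J' w *v v) $ k" for k
      unfolding lin[of v] lin[of w] using sym[of 1 k 2]
      by (simp add: matrix_vector_mult_def sum_2 algebra_simps)
    then show ?thesis by (simp add: vec_eq_iff)
  qed
qed

lemma related_fields_tensor_at: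
  assumes T: "smooth_sym_tensor2 \<A> T" "invariant_tensor2 \<A> \<eta> T"
    and c: "c \<in> \<B>" "p \<in> cdom c" and C: "C \<in> \<A>" "p \<in> cdom C"
  shows "related_fields_tensor (cmap c ` (cdom C \<inter> cdom c)) (cmap c p) (cmap C \<circ> cinv c)
    (\<lambda>z. jac c C (cinv c z)) (dJ c C p)
    (\<xi> c \<circ> cinv c) (d\<xi> c p)
    (\<eta> C \<circ> cinv C) (d\<eta> C p)
    (T C \<circ> cinv C) (dT T C p)"
proof -
  note R = related_fields_at[OF c C]
  have cp: "cinv c (cmap c p) = p" "cinv C (cmap C p) = p"
    using cinv_cmap[OF incl.chart_S[OF c(1)] c(2)] cinv_cmap[OF incl.chart_M[OF C(1)] C(2)] .
  have at: "(cmap C \<circ> cinv c) (cmap c p) = cmap C p" "(\<eta> C \<circ> cinv C) (cmap C p) = \<eta> C p"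
    "(T C \<circ> cinv C) (cmap C p) = T C p" by (simp_all add: cp)
  have "smooth_in_chart C (cdom C) (T C)" using T(1) C(1) unfolding smooth_sym_tensor2_def by blast
  then have "Ck_on (Suc 0) (cmap C ` cdom C) (T C \<circ> cinv C)"
    by (simp add: smooth_in_chart_def smooth_on_def del: Ck_on.simps)
  then have T': "(T C \<circ> cinv C has_derivative dT T C p) (at (cmap C p))"
    by (rule Ck_on_has_derivative) (use C in blast)
  have \<eta>': "(\<eta> C \<circ> cinv C has_derivative d\<eta> C p) (at (cmap C p))"
    using related_fields.\<eta>[OF R] unfolding at .
  have lie: "lie_tensor2 \<eta> T C p = 0" using T(2) C unfolding invariant_tensor2_def by blast
  show ?thesis
  proof (rule related_fields_tensor.intro[OF R related_fields_tensor_axioms.intro])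
    show "(T C \<circ> cinv C has_derivative dT T C p)
        (at ((cmap C \<circ> cinv c) (cmap c p)))" unfolding at by (rule T')
  next
    fix v w
    show "bil (dT T C p ((\<eta> C \<circ> cinv C) ((cmap C \<circ> cinv c) (cmap c p)))) v w
      + bil ((T C \<circ> cinv C) ((cmap C \<circ> cinv c) (cmap c p))) (d\<eta> C p v) w
      + bil ((T C \<circ> cinv C) ((cmap C \<circ> cinv c) (cmap c p))) v (d\<eta> C p w) = 0"
      unfolding at by (rule lie_tensor2_contract[OF lie T' \<eta>'])
  qed
qed

lemma vfield_along_deriv:
  assumes "smooth_vfield_along \<B> \<A> S V" and c: "c \<in> \<B>" "p \<in> cdom c" and C: "C \<in> \<A>" "p \<in> cdom C"
  shows "((\<lambda>z. V C (cinv c z)) has_derivative frechet_derivative (\<lambda>z. V C (cinv c z)) (at (cmap c p))) (at (cmap c p))"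
  by (rule Ck_on_has_derivative[OF vfield_along_Ck[OF assms(1) c(1) C(1), of "Suc 0"]]) (use c C in blast)

text \<open>The vanishing of the Lie bracket of \<open>\<eta>\<close> and \<open>V\<close>. It makes sense for fields \<open>V\<close> defined only
  along \<open>S\<close>, because \<open>V\<close> is differentiated only in the tangential direction \<open>\<xi>\<close>.\<close>

definition commutes_with_\<eta> :: "('a, 3) vfield \<Rightarrow> bool" where
  "commutes_with_\<eta> V \<longleftrightarrow> (\<forall>c\<in>\<B>. \<forall>C\<in>\<A>. \<forall>p\<in>cdom c \<inter> cdom C.
     frechet_derivative (\<lambda>z. V C (cinv c z)) (at (cmap c p)) (\<xi> c p) =
     d\<eta> C p (V C p))"

lemma \<eta>_commutes: "commutes_with_\<eta> \<eta>"
  unfolding commutes_with_\<eta>_def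
proof (intro ballI)
  fix c C p assume c: "c \<in> \<B>" and C: "C \<in> \<A>" and p: "p \<in> cdom c \<inter> cdom C"
  then have p: "p \<in> cdom c" "p \<in> cdom C" by auto
  note R = related_fields_at[OF c p(1) C p(2)]
  have "((\<lambda>z. \<eta> C (cinv c z)) has_derivative
      (\<lambda>v. d\<eta> C p (jac c C (cinv c (cmap c p)) *v v))) (at (cmap c p))"
    by (rule has_derivative_cong_open[OF related_fields.\<eta>_along[OF R] related_fields.U[OF R]])
      (auto simp: cinv_cmap[OF incl.chart_S[OF c]] cinv_cmap[OF incl.chart_M[OF C]])
  then have "frechet_derivative (\<lambda>z. \<eta> C (cinv c z)) (at (cmap c p)) =
      (\<lambda>v. d\<eta> C p (jac c C p *v v))"
    unfolding cinv_cmap[OF incl.chart_S[OF c] p(1)] by (rule frechet_derivative_at[symmetric])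
  then show "frechet_derivative (\<lambda>z. \<eta> C (cinv c z)) (at (cmap c p)) (\<xi> c p) =
      d\<eta> C p (\<eta> C p)"
    using \<xi>_related[OF c p(1) C p(2)] by simp
qed

lemma \<nu>_unit: "C \<in> \<A> \<Longrightarrow> p \<in> S \<Longrightarrow> p \<in> cdom C \<Longrightarrow> bil (g C p) (\<nu> C p) (\<nu> C p) = 1"
  using normal unfolding unit_normal_def by blast

lemma \<nu>_orthogonal:
  assumes c: "c \<in> \<B>" "p \<in> cdom c" and C: "C \<in> \<A>" "p \<in> cdom C"
  shows "bil (g C p) (\<nu> C p) (jac c C p *v v) = 0"
proof -
  have "bil (g C p) (\<nu> C p) (column a (jac c C p)) = 0" for a
    using normal c C in_S[OF c] unfolding unit_normal_def by blast
  moreover have "linear (\<lambda>v. bil (g C p) (\<nu> C p) (jac c C p *v v))"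
    by (rule linearI) (simp_all add: bil_add_right bil_scale_right matrix_vector_right_distrib matrix_vector_mult_scaleR)
  note linear_eq_sum_axis[OF this, of v]
  ultimately show ?thesis by (simp add: matrix_vector_mult_basis)
qed

lemma \<nu>_commutes: "commutes_with_\<eta> \<nu>"
  unfolding commutes_with_\<eta>_def
proof (intro ballI)
  fix c C p assume c: "c \<in> \<B>" and C: "C \<in> \<A>" and p: "p \<in> cdom c \<inter> cdom C"
  then have p: "p \<in> cdom c" "p \<in> cdom C" by auto
  have inv_g: "invariant_tensor2 \<A> \<eta> g" using killing unfolding killing_field_def by blast
  note R = related_fields_tensor_at[OF g_tensor inv_g c p(1) C p(2)]
  note cp = cinv_cmap[OF incl.chart_S[OF c] p(1)] cinv_cmap[OF incl.chart_M[OF C] p(2)]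
  have gz: "(g C \<circ> cinv C) ((cmap C \<circ> cinv c) z) = g C (cinv c z)" "cinv c z \<in> cdom c" "cinv c z \<in> cdom C"
    if "z \<in> cmap c ` (cdom C \<inter> cdom c)" for z
    using that by (auto simp: cinv_cmap[OF incl.chart_S[OF c]] cinv_cmap[OF incl.chart_M[OF C]])
  have gx: "(g C \<circ> cinv C) ((cmap C \<circ> cinv c) (cmap c p)) = g C p" by (simp add: cp)
  have "frechet_derivative (\<lambda>z. \<nu> C (cinv c z)) (at (cmap c p)) ((\<xi> c \<circ> cinv c) (cmap c p)) =
      d\<eta> C p (\<nu> C (cinv c (cmap c p)))"
  proof (rule related_fields_tensor.unit_normal_transported[OF R vfield_along_deriv[OF \<nu>_along c p(1) C p(2)]], unfold gx)
    show "transpose (g C p) = g C p" by (rule tensor_sym[OF g_tensor C p(2)])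
    show "bil (g C p) v v > 0" if "v \<noteq> 0" for v by (rule g_pos[OF C p(2) that])
    show "inj ((*v) (jac c C (cinv c (cmap c p))))" unfolding cp by (rule jac_inj[OF c C p])
    show "bil ((g C \<circ> cinv C) ((cmap C \<circ> cinv c) z)) (\<nu> C (cinv c z)) (\<nu> C (cinv c z)) = 1"
      if "z \<in> cmap c ` (cdom C \<inter> cdom c)" for z
      unfolding gz(1)[OF that] by (rule \<nu>_unit[OF C in_S[OF c gz(2)[OF that]] gz(3)[OF that]])
    show "bil ((g C \<circ> cinv C) ((cmap C \<circ> cinv c) z)) (\<nu> C (cinv c z)) (jac c C (cinv c z) *v v) = 0"
      if "z \<in> cmap c ` (cdom C \<inter> cdom c)" for z v
      unfolding gz(1)[OF that] by (rule \<nu>_orthogonal[OF c gz(2)[OF that] C gz(3)[OF that]])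
  qed
  then show "frechet_derivative (\<lambda>z. \<nu> C (cinv c z)) (at (cmap c p)) (\<xi> c p) =
      d\<eta> C p (\<nu> C p)" by (simp only: o_apply cp)
qed

lemma lie_fun_eq:
  assumes "(f \<circ> cinv c has_derivative f') (at (cmap c p))"
  shows "lie_fun V f c p = f' (V c p)"
  unfolding lie_fun_def pd_eq[OF assms]
  using linear_eq_sum_axis[OF has_derivative_linear[OF assms], of "V c p"] by simp

lemma lie_fun_invariant_bil:
  assumes T: "smooth_sym_tensor2 \<A> T" "invariant_tensor2 \<A> \<eta> T"
    and V: "smooth_vfield_along \<B> \<A> S V" "commutes_with_\<eta> V"
    and W: "smooth_vfield_along \<B> \<A> S W" "commutes_with_\<eta> W"
    and f: "Ck_fun 1 \<B> f"
    and eq: "\<And>c C q. c \<in> \<B> \<Longrightarrow> C \<in> \<A> \<Longrightarrow> q \<in> cdom c \<Longrightarrow> q \<in> cdom C \<Longrightarrow> f q = bil (T C q) (V C q) (W C q)"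
    and c: "c \<in> \<B>" "p \<in> cdom c"
  shows "lie_fun \<xi> f c p = 0"
proof -
  obtain C where C: "C \<in> \<A>" "p \<in> cdom C" using ambient_chart[OF in_S[OF c]] by blast
  note R = related_fields_tensor_at[OF T c C]
  note cp = cinv_cmap[OF incl.chart_S[OF c(1)] c(2)]
  let ?f' = "frechet_derivative (f \<circ> cinv c) (at (cmap c p))"
  have f': "(f \<circ> cinv c has_derivative ?f') (at (cmap c p))"
    using Ck_fun_chart_diff[OF f[unfolded One_nat_def] c] frechet_derivative_works by blast
  have "((\<lambda>z. bil ((T C \<circ> cinv C) ((cmap C \<circ> cinv c) z)) (V C (cinv c z)) (W C (cinv c z))) has_derivative ?f') (at (cmap c p))"
    by (rule has_derivative_cong_open[OF f' related_fields.U[OF related_fields_tensor.axioms(1)[OF R]]])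
      (auto simp: cinv_cmap[OF incl.chart_S[OF c(1)]] cinv_cmap[OF incl.chart_M[OF C(1)]] eq[OF c(1) C(1)])
  moreover have "frechet_derivative (\<lambda>z. V C (cinv c z)) (at (cmap c p)) ((\<xi> c \<circ> cinv c) (cmap c p)) =
      d\<eta> C p (V C (cinv c (cmap c p)))"
    using V(2) c C unfolding commutes_with_\<eta>_def by (simp add: cp)
  moreover have "frechet_derivative (\<lambda>z. W C (cinv c z)) (at (cmap c p)) ((\<xi> c \<circ> cinv c) (cmap c p)) =
      d\<eta> C p (W C (cinv c (cmap c p)))"
    using W(2) c C unfolding commutes_with_\<eta>_def by (simp add: cp)
  ultimately have "?f' ((\<xi> c \<circ> cinv c) (cmap c p)) = 0"
    by (intro related_fields_tensor.transported_bil[OF R vfield_along_deriv[OF V(1) c C] vfield_along_deriv[OF W(1) c C]])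
  then show ?thesis unfolding lie_fun_eq[OF f'] by (simp only: o_apply cp)
qed

text \<open>The restriction of a Killing field is a Killing field of the induced metric, and therefore
  divergence free.\<close>

lemma div_\<xi>:
  assumes c: "c \<in> \<B>" "p \<in> cdom c"
  shows "div_vfield h \<xi> c p = 0"
proof -
  obtain C where C: "C \<in> \<A>" "p \<in> cdom C" using ambient_chart[OF in_S[OF c]] by blast
  have inv_g: "invariant_tensor2 \<A> \<eta> g" using killing unfolding killing_field_def by blast
  note R = related_fields_tensor_at[OF g_tensor inv_g c C]
  note cp = cinv_cmap[OF incl.chart_S[OF c(1)] c(2)]
  let ?h' = "frechet_derivative (h c \<circ> cinv c) (at (cmap c p))"
  let ?\<xi>' = "d\<xi> c p"
  have "Ck_on (Suc 0) (cmap c ` cdom c) (h c \<circ> cinv c)"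
    using surf.h_Ck_entry[OF c(1)] unfolding Ck_on_vec_iff[OF surf.image_open[OF c(1)]] o_def by blast
  then have h': "(h c \<circ> cinv c has_derivative ?h') (at (cmap c p))"
    by (rule Ck_on_has_derivative) (use c in blast)
  have lie: "bil (?h' (\<xi> c p)) v w + bil (h c p) (?\<xi>' v) w + bil (h c p) v (?\<xi>' w) = 0" for v w
  proof -
    have "bil (?h' ((\<xi> c \<circ> cinv c) (cmap c p))) v w + bil ((h c \<circ> cinv c) (cmap c p)) (?\<xi>' v) w
        + bil ((h c \<circ> cinv c) (cmap c p)) v (?\<xi>' w) = 0"
    proof (rule related_fields_tensor.lie_pullback[OF R h'])
      fix z v w assume "z \<in> cmap c ` (cdom C \<inter> cdom c)"
      then obtain q where q: "q \<in> cdom C" "q \<in> cdom c" "z = cmap c q" by blast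
      show "bil ((h c \<circ> cinv c) z) v w = bil ((g C \<circ> cinv C) ((cmap C \<circ> cinv c) z))
          (jac c C (cinv c z) *v v) (jac c C (cinv c z) *v w)"
        using bil_pullback2[OF g_tensor c(1) q(2) C(1) q(1)]
        by (simp add: q(3) cinv_cmap[OF incl.chart_S[OF c(1)] q(2)] cinv_cmap[OF incl.chart_M[OF C(1)] q(1)])
    qed
    then show ?thesis by (simp only: o_apply cp)
  qed
  have d: "?h' (\<xi> c p) $ i $ j = (\<Sum>k\<in>UNIV. \<xi> c p $ k * pd c k (\<lambda>q. h c q $ i $ j) p)" for i j
  proof -
    have "((\<lambda>q. h c q $ i $ j) \<circ> cinv c has_derivative (\<lambda>v. ?h' v $ i $ j)) (at (cmap c p))"
      using bounded_linear.has_derivative[OF bounded_linear_vec_nth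
          bounded_linear.has_derivative[OF bounded_linear_vec_nth h']] by (simp add: o_def)
    from lie_fun_eq[OF this, of \<xi>] show ?thesis by (simp add: lie_fun_def)
  qed
  have x: "pd c i (\<lambda>q. \<xi> c q $ k) p = ?\<xi>' (axis i 1) $ k" for i k
    by (rule pd_eq) (use bounded_linear.has_derivative[OF bounded_linear_vec_nth related_fields.\<xi>[OF related_fields_tensor.axioms(1)[OF R]]] in \<open>simp add: o_def\<close>)
  have ax: "bil A (axis i 1) w = (\<Sum>j\<in>UNIV. A $ i $ j * w $ j)" "bil A w (axis i 1) = (\<Sum>j\<in>UNIV. A $ j $ i * w $ j)"
    for A :: "real ^ 2 ^ 2" and i w
    unfolding bil_def inner_axis' matrix_vector_mult_basis
    by (simp_all add: matrix_vector_mult_def inner_vec_def column_def mult.commute)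
  let ?d = "\<lambda>i j. ?h' (\<xi> c p) $ i $ j"
  note h21 = surf.h_21[OF c]
  have e: "?d i j + (\<Sum>k\<in>UNIV. h c p $ k $ j * ?\<xi>' (axis i 1) $ k) + (\<Sum>k\<in>UNIV. h c p $ i $ k * ?\<xi>' (axis j 1) $ k) = 0" for i j
    using lie[of "axis i 1" "axis j 1"] unfolding ax by (simp add: axis_def if_distrib[of "\<lambda>x. _ * x"] cong: if_cong)
  have "pd c 1 (\<lambda>q. \<xi> c q $ 1) p + pd c 2 (\<lambda>q. \<xi> c q $ 2) p
      + (h c p $ 2 $ 2 * ?d 1 1 + h c p $ 1 $ 1 * ?d 2 2 - 2 * h c p $ 1 $ 2 * ?d 1 2)
        / (2 * (h c p $ 1 $ 1 * h c p $ 2 $ 2 - h c p $ 1 $ 2 * h c p $ 1 $ 2)) = 0"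
  proof (rule divergence_free_algebra)
    show "?d 1 1 + 2 * (h c p $ 1 $ 1 * pd c 1 (\<lambda>q. \<xi> c q $ 1) p + h c p $ 1 $ 2 * ?\<xi>' (axis 1 1) $ 2) = 0"
      using e[of 1 1] by (simp add: x sum_2 h21)
    show "?d 2 2 + 2 * (h c p $ 1 $ 2 * ?\<xi>' (axis 2 1) $ 1 + h c p $ 2 $ 2 * pd c 2 (\<lambda>q. \<xi> c q $ 2) p) = 0"
      using e[of 2 2] by (simp add: x sum_2 h21)
    show "?d 1 2 + (h c p $ 1 $ 2 * pd c 1 (\<lambda>q. \<xi> c q $ 1) p + h c p $ 2 $ 2 * ?\<xi>' (axis 1 1) $ 2)
        + (h c p $ 1 $ 1 * ?\<xi>' (axis 2 1) $ 1 + h c p $ 1 $ 2 * pd c 2 (\<lambda>q. \<xi> c q $ 2) p) = 0"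
      using e[of 1 2] by (simp add: x sum_2 h21)
    show "0 < h c p $ 1 $ 1 * h c p $ 2 $ 2 - h c p $ 1 $ 2 * h c p $ 1 $ 2"
      using surf.det_h_pos[OF c] by (simp add: det_2 h21)
  qed
  moreover have "(\<Sum>j\<in>UNIV. \<xi> c p $ j * pd c j (\<lambda>q. det (h c q)) p) =
      h c p $ 2 $ 2 * ?d 1 1 + h c p $ 1 $ 1 * ?d 2 2 - 2 * h c p $ 1 $ 2 * ?d 1 2"
    unfolding d surf.pd_det_h[OF c] by (simp add: sum_2 algebra_simps)
  moreover have "det (h c p) = h c p $ 1 $ 1 * h c p $ 2 $ 2 - h c p $ 1 $ 2 * h c p $ 1 $ 2"
    by (simp add: det_2 h21)
  ultimately show ?thesis
    unfolding surf.div_vfield_eq[OF c] by (simp add: sum_2)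
qed

end

section \<open>The integral inequality\<close>

context closed_riemannian_surface
begin

abbreviation ip :: "('a, 2) vfield \<Rightarrow> ('a, 2) vfield \<Rightarrow> 'a \<Rightarrow> real" where
  "ip V W p \<equiv> bil (h (chart_at \<B> p) p) (V (chart_at \<B> p) p) (W (chart_at \<B> p) p)"

lemma Ck_fun_mono: "Ck_fun k \<B> f \<Longrightarrow> j \<le> k \<Longrightarrow> Ck_fun j \<B> f"
  unfolding Ck_fun_def using Ck_on_mono by blast

lemma lie_fun_mult:
  assumes c: "c \<in> \<B>" "p \<in> cdom c" and f: "Ck_fun 1 \<B> f" and u: "Ck_fun 1 \<B> u"
  shows "lie_fun V (\<lambda>q. f q * u q) c p = lie_fun V f c p * u p + f p * lie_fun V u c p"
proof -
  have "pd c i (\<lambda>q. f q * u q) p = pd c i f p * u p + f p * pd c i u p" for i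
    using Ck_fun_chart_diff[OF f[unfolded One_nat_def] c] Ck_fun_chart_diff[OF u[unfolded One_nat_def] c]
    by (rule pd_mult[OF chart_S[OF c(1)] c(2)])
  then show ?thesis by (simp add: lie_fun_def sum_2 algebra_simps)
qed

lemma lie_fun_cong:
  assumes c: "c \<in> \<B>" "p \<in> cdom c" and eq: "\<And>q. q \<in> S \<Longrightarrow> f q = u q"
  shows "lie_fun V f c p = lie_fun V u c p"
proof -
  have "pd c i f p = pd c i u p" for i
    by (rule pd_cong_dom[OF chart_S[OF c(1)] c(2)]) (use eq dom_sub[OF c(1)] in blast)
  then show ?thesis by (simp add: lie_fun_def)
qed

lemma lie_fun_add_const:
  assumes c: "c \<in> \<B>" "p \<in> cdom c" and f: "Ck_fun 1 \<B> f"
  shows "lie_fun V (\<lambda>q. f q + a) c p = lie_fun V f c p"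
proof -
  have "pd c i (\<lambda>q. f q + a) p = pd c i f p" for i
    using pd_add[OF Ck_fun_chart_diff[OF f[unfolded One_nat_def] c], of "\<lambda>_. a" i] by (simp add: pd_const o_def)
  then show ?thesis by (simp add: lie_fun_def)
qed

lemma grad_bil: "c \<in> \<B> \<Longrightarrow> p \<in> cdom c \<Longrightarrow> bil (h c p) (grad h f c p) (V c p) = lie_fun V f c p"
  by (simp add: bil_grad lie_fun_def)

lemma bil_sym: "c \<in> \<B> \<Longrightarrow> p \<in> cdom c \<Longrightarrow> bil (h c p) v w = bil (h c p) w v"
  by (rule bil_commute[OF h_sym])

text \<open>The logarithmic substitution: dividing the equation \<open>L \<phi> = \<mu> \<phi>\<close> by \<open>\<phi>\<close> and completing the
  square turns it into a Riccati type identity for the divergence of \<open>X - \<nabla> (ln \<phi>)\<close>.\<close>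

lemma riccati_identity:
  assumes \<phi>: "Ck_fun 2 \<B> \<phi>" "\<And>q. q \<in> S \<Longrightarrow> \<phi> q > 0" and X: "Ck_vfield 1 \<B> X"
    and c: "c \<in> \<B>" "p \<in> cdom c"
    and eigen: "- laplacian h \<phi> c p + 2 * bil (h c p) (X c p) (grad h \<phi> c p)
       + (Q - normsq_vec h X c p + div_vfield h X c p) * \<phi> p = \<mu> * \<phi> p"
    and Y_def: "Y = (\<lambda>c q. X c q + (-1) *\<^sub>R grad h (\<lambda>q. ln (\<phi> q)) c q)"
  shows "Q = \<mu> - div_vfield h Y c p + bil (h c p) (Y c p) (Y c p)"
proof -
  let ?u = "\<lambda>q. ln (\<phi> q)"
  have pS: "p \<in> S" using dom_sub c by blast
  have u2: "Ck_fun 2 \<B> ?u" by (rule Ck_fun_ln[OF \<phi>])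
  have gu: "Ck_vfield 1 \<B> (grad h ?u)" by (rule Ck_vfield_grad) (use u2 in \<open>simp add: numeral_2_eq_2\<close>)
  have \<phi>1: "Ck_fun 1 \<B> \<phi>" by (rule Ck_fun_mono[OF \<phi>(1)]) simp
  have pdu: "pd c i \<phi> q = \<phi> q * pd c i ?u q" if "q \<in> cdom c" for i q
  proof -
    have "q \<in> S" using that dom_sub[OF c(1)] by blast
    then show ?thesis
      using pd_ln[OF chart_S[OF c(1)] that Ck_fun_chart_diff[OF \<phi>1[unfolded One_nat_def] c(1) that] \<phi>(2), of i] \<phi>(2)[of q]
      by simp
  qed
  have g\<phi>: "grad h \<phi> c q = \<phi> q *\<^sub>R grad h ?u c q" if "q \<in> cdom c" for q
  proof -
    have "(\<chi> i. pd c i \<phi> q) = \<phi> q *\<^sub>R (\<chi> i. pd c i ?u q)" using pdu[OF that] by (simp add: vec_eq_iff)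
    then show ?thesis by (simp add: grad_def matrix_vector_mult_scaleR)
  qed
  have lie: "lie_fun (grad h ?u) \<phi> c p = \<phi> p * lie_fun (grad h ?u) ?u c p"
    unfolding lie_fun_def pdu[OF c(2)] by (simp add: sum_distrib_left mult_ac)
  have "laplacian h \<phi> c p = div_vfield h (\<lambda>c q. \<phi> q *\<^sub>R grad h ?u c q) c p"
    unfolding laplacian_def by (rule div_vfield_cong[OF c]) (rule g\<phi>)
  also have "\<dots> = \<phi> p * div_vfield h (grad h ?u) c p + \<phi> p * bil (h c p) (grad h ?u c p) (grad h ?u c p)"
    unfolding div_vfield_scale[OF c \<phi>1 gu] lie grad_bil[OF c] ..
  finally have lap: "laplacian h \<phi> c p = \<phi> p * (div_vfield h (grad h ?u) c p + bil (h c p) (grad h ?u c p) (grad h ?u c p))"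
    by (simp add: algebra_simps)
  have "\<phi> p * (- (div_vfield h (grad h ?u) c p + bil (h c p) (grad h ?u c p) (grad h ?u c p))
       + 2 * bil (h c p) (X c p) (grad h ?u c p) + (Q - bil (h c p) (X c p) (X c p) + div_vfield h X c p)) = \<phi> p * \<mu>"
    using eigen unfolding lap g\<phi>[OF c(2)] bil_scale_right normsq_vec_def by (simp add: algebra_simps)
  then have Q: "- (div_vfield h (grad h ?u) c p + bil (h c p) (grad h ?u c p) (grad h ?u c p))
       + 2 * bil (h c p) (X c p) (grad h ?u c p) + (Q - bil (h c p) (X c p) (X c p) + div_vfield h X c p) = \<mu>"
    using \<phi>(2)[OF pS] by simp
  have "Ck_vfield 1 \<B> (\<lambda>c q. (-1) *\<^sub>R grad h ?u c q)" by (rule Ck_vfield_scale[OF Ck_fun_const gu])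
  from div_vfield_add[OF c X this] have "div_vfield h Y c p = div_vfield h X c p - div_vfield h (grad h ?u) c p"
    unfolding Y_def using div_vfield_scale[OF c Ck_fun_const gu, of "-1"] by (simp add: lie_fun_def pd_const)
  moreover have "bil (h c p) (Y c p) (Y c p) = bil (h c p) (X c p) (X c p) - 2 * bil (h c p) (X c p) (grad h ?u c p)
      + bil (h c p) (grad h ?u c p) (grad h ?u c p)"
    unfolding Y_def using bil_sym[OF c, of "grad h ?u c p" "X c p"]
    by (simp add: bil_diff_left bil_diff_right)
  ultimately show ?thesis using Q by simp
qed

text \<open>The left-hand side is the part of \<open>|\<nabla>f + f Y|\<^sup>2\<close> along \<open>\<xi>\<close>, up to divergences: besides
  \<open>div (f\<^sup>2 Y)\<close> this is \<open>div (2 w u \<xi>) = 2 w \<xi>(u)\<close> with the invariant weight \<open>w\<close>. The parameter \<open>\<epsilon>\<close>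
  keeps \<open>w\<close> differentiable at the zeros of \<open>\<xi>\<close>.\<close>

lemma integral_inequality_regularized:
  assumes \<mu>: "\<mu> \<ge> 0" and \<phi>: "Ck_fun 2 \<B> \<phi>" "\<And>q. q \<in> S \<Longrightarrow> \<phi> q > 0" and X: "Ck_vfield 1 \<B> X"
    and eigen: "\<And>p. p \<in> S \<Longrightarrow> - laplacian h \<phi> (chart_at \<B> p) p + 2 * ip X (grad h \<phi>) p
       + (Q p - normsq_vec h X (chart_at \<B> p) p + div_vfield h X (chart_at \<B> p) p) * \<phi> p = \<mu> * \<phi> p"
    and \<xi>: "Ck_vfield 1 \<B> \<xi>" and div_\<xi>: "\<And>c p. c \<in> \<B> \<Longrightarrow> p \<in> cdom c \<Longrightarrow> div_vfield h \<xi> c p = 0"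
    and lie_x: "\<And>c p. c \<in> \<B> \<Longrightarrow> p \<in> cdom c \<Longrightarrow> lie_fun \<xi> (ip X \<xi>) c p = 0"
    and lie_e: "\<And>c p. c \<in> \<B> \<Longrightarrow> p \<in> cdom c \<Longrightarrow> lie_fun \<xi> (ip \<xi> \<xi>) c p = 0"
    and f: "Ck_fun 2 \<B> f" and lie_f: "\<And>c p. c \<in> \<B> \<Longrightarrow> p \<in> cdom c \<Longrightarrow> lie_fun \<xi> f c p = 0"
    and \<epsilon>: "\<epsilon> > 0"
  shows "(LINT p|dA. (f p)\<^sup>2 * (ip X \<xi> p)\<^sup>2 / (ip \<xi> \<xi> p + \<epsilon>)) \<le>
    (LINT p|dA. normsq_vec h (grad h f) (chart_at \<B> p) p + Q p * (f p)\<^sup>2)"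
proof -
  let ?u = "\<lambda>q. ln (\<phi> q)"
  define Y where "Y = (\<lambda>c q. X c q + (-1) *\<^sub>R grad h ?u c q)"
  define w where "w q = (f q * f q) * ip X \<xi> q / (ip \<xi> \<xi> q + \<epsilon>)" for q
  have u2: "Ck_fun 2 \<B> ?u" by (rule Ck_fun_ln[OF \<phi>])
  have gu: "Ck_vfield 1 \<B> (grad h ?u)" by (rule Ck_vfield_grad) (use u2 in \<open>simp add: numeral_2_eq_2\<close>)
  have gf: "Ck_vfield 1 \<B> (grad h f)" by (rule Ck_vfield_grad) (use f in \<open>simp add: numeral_2_eq_2\<close>)
  have u1: "Ck_fun 1 \<B> ?u" and f1: "Ck_fun 1 \<B> f" by (rule Ck_fun_mono[OF u2] Ck_fun_mono[OF f], simp)+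
  have Y1: "Ck_vfield 1 \<B> Y" unfolding Y_def by (intro Ck_vfield_add X Ck_vfield_scale[OF Ck_fun_const gu])
  have x1: "Ck_fun 1 \<B> (ip X \<xi>)" and e1: "Ck_fun 1 \<B> (ip \<xi> \<xi>)" by (intro bil_Ck(1) X \<xi>)+
  have e\<epsilon>: "ip \<xi> \<xi> q + \<epsilon> > 0" if "q \<in> S" for q
    using h_nonneg[OF chart_atE[OF atlas that], of "\<xi> (chart_at \<B> q) q"] \<epsilon> by linarith
  have e\<epsilon>1: "Ck_fun 1 \<B> (\<lambda>q. ip \<xi> \<xi> q + \<epsilon>)" by (intro Ck_fun_add e1 Ck_fun_const)
  have ff1: "Ck_fun 1 \<B> (\<lambda>q. f q * f q)" by (intro Ck_fun_mult f1)
  have ffx1: "Ck_fun 1 \<B> (\<lambda>q. (f q * f q) * ip X \<xi> q)" by (intro Ck_fun_mult ff1 x1)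
  have w1: "Ck_fun 1 \<B> w"
    unfolding w_def[abs_def] using e\<epsilon> by (intro Ck_fun_divide ffx1 e\<epsilon>1) fastforce
  have lie_w: "lie_fun \<xi> w c p = 0" if c: "c \<in> \<B>" "p \<in> cdom c" for c p
  proof -
    have pS: "p \<in> S" using c dom_sub by blast
    \<comment> \<open>Differentiating the product avoids a quotient rule.\<close>
    have "lie_fun \<xi> w c p * (ip \<xi> \<xi> p + \<epsilon>) = lie_fun \<xi> (\<lambda>q. w q * (ip \<xi> \<xi> q + \<epsilon>)) c p"
      unfolding lie_fun_mult[OF c w1 e\<epsilon>1] lie_fun_add_const[OF c e1] lie_e[OF c] by simp
    also have "\<dots> = lie_fun \<xi> (\<lambda>q. (f q * f q) * ip X \<xi> q) c p"
    proof (rule lie_fun_cong[OF c])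
      fix q assume "q \<in> S"
      from e\<epsilon>[OF this] show "w q * (ip \<xi> \<xi> q + \<epsilon>) = (f q * f q) * ip X \<xi> q" unfolding w_def by simp
    qed
    also have "\<dots> = 0"
      unfolding lie_fun_mult[OF c ff1 x1] lie_fun_mult[OF c f1 f1] lie_x[OF c] lie_f[OF c] by simp
    finally show ?thesis using e\<epsilon>[OF pS] by simp
  qed
  define \<psi> where "\<psi> q = (2 * w q) * ?u q" for q
  define Z1 where "Z1 = (\<lambda>c q. (f q * f q) *\<^sub>R Y c q)"
  define Z2 where "Z2 = (\<lambda>c q. \<psi> q *\<^sub>R \<xi> c q)"
  have w2: "Ck_fun 1 \<B> (\<lambda>q. 2 * w q)" by (rule Ck_fun_mult[OF Ck_fun_const w1])
  have \<psi>1: "Ck_fun 1 \<B> \<psi>" unfolding \<psi>_def[abs_def] by (rule Ck_fun_mult[OF w2 u1])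
  have Z1: "Ck_vfield 1 \<B> Z1" unfolding Z1_def by (rule Ck_vfield_scale[OF ff1 Y1])
  have Z2: "Ck_vfield 1 \<B> Z2" unfolding Z2_def by (rule Ck_vfield_scale[OF \<psi>1 \<xi>])
  define G where "G p = normsq_vec h (grad h f) (chart_at \<B> p) p + Q p * (f p)\<^sup>2" for p
  define R where "R p = (f p)\<^sup>2 * (ip X \<xi> p)\<^sup>2 / (ip \<xi> \<xi> p + \<epsilon>)" for p
  have G_eq: "G p = ip (grad h f) (grad h f) p + \<mu> * (f p * f p) - (f p * f p) * divg Y p + (f p * f p) * ip Y Y p"
    and ineq: "R p \<le> G p + divg Z1 p + divg Z2 p" if p: "p \<in> S" for p
  proof -
    define c where "c = chart_at \<B> p"
    have c: "c \<in> \<B>" "p \<in> cdom c" using chart_atE[OF atlas p] by (simp_all add: c_def)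
    let ?H = "bil (h c p)"
    have Q: "Q p = \<mu> - div_vfield h Y c p + ?H (Y c p) (Y c p)"
      by (rule riccati_identity[OF \<phi> X c _ Y_def], assumption) (rule eigen[OF p, folded c_def])
    show G_eq: "G p = ip (grad h f) (grad h f) p + \<mu> * (f p * f p) - (f p * f p) * divg Y p + (f p * f p) * ip Y Y p"
      unfolding G_def Q divg_def c_def[symmetric] normsq_vec_def by (simp add: power2_eq_square algebra_simps)
    have d1: "divg Z1 p = (f p * f p) * divg Y p + 2 * f p * ?H (grad h f c p) (Y c p)"
      unfolding divg_def c_def[symmetric] Z1_def div_vfield_scale[OF c ff1 Y1] lie_fun_mult[OF c f1 f1] grad_bil[OF c]
      by simp
    have d2: "divg Z2 p = 2 * w p * lie_fun \<xi> ?u c p"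
      unfolding divg_def c_def[symmetric] Z2_def div_vfield_scale[OF c \<psi>1 \<xi>] div_\<xi>[OF c]
      unfolding \<psi>_def[abs_def] lie_fun_mult[OF c w2 u1]
      using lie_fun_mult[OF c Ck_fun_const w1, of \<xi> 2] lie_w[OF c] by (simp add: lie_fun_def pd_const)
    let ?v = "grad h f c p + f p *\<^sub>R Y c p"
    define x where "x = ip X \<xi> p"
    define e where "e = ip \<xi> \<xi> p"
    define l where "l = lie_fun \<xi> ?u c p"
    have Hv: "?H ?v (\<xi> c p) = f p * (x - l)"
    proof -
      have "?H (grad h f c p) (\<xi> c p) = 0" "?H (grad h ?u c p) (\<xi> c p) = l"
        unfolding grad_bil[OF c] l_def by (simp_all add: lie_f[OF c])
      then show ?thesis unfolding Y_def x_def c_def[symmetric] by (simp add: bil_add_left bil_scale_left bil_diff_left)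
    qed
    have "(?H ?v (\<xi> c p))\<^sup>2 \<le> ?H ?v ?v * ?H (\<xi> c p) (\<xi> c p)"
      by (rule bil_Cauchy_Schwarz[OF h_sym[OF c] h_pos[OF c]])
    also have "\<dots> \<le> ?H ?v ?v * (e + \<epsilon>)"
      using h_nonneg[OF c] \<epsilon> unfolding e_def c_def[symmetric] by (intro mult_left_mono) auto
    finally have v: "(f p * (x - l))\<^sup>2 / (e + \<epsilon>) \<le> ?H ?v ?v"
      using e\<epsilon>[OF p] unfolding Hv e_def by (simp add: pos_divide_le_eq)
    have vv: "?H ?v ?v = ?H (grad h f c p) (grad h f c p) + 2 * f p * ?H (grad h f c p) (Y c p) + (f p * f p) * ?H (Y c p) (Y c p)"
      using bil_sym[OF c, of "Y c p" "grad h f c p"]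
      by (simp add: bil_add_left bil_add_right bil_scale_left bil_scale_right algebra_simps)
    have "(f p)\<^sup>2 * x\<^sup>2 - 2 * ((f p * f p) * x) * l \<le> (f p * (x - l))\<^sup>2"
    proof -
      have "(f p * (x - l))\<^sup>2 - ((f p)\<^sup>2 * x\<^sup>2 - 2 * ((f p * f p) * x) * l) = (f p * l)\<^sup>2"
        by (simp add: power2_eq_square algebra_simps)
      then show ?thesis using zero_le_power2[of "f p * l"] by linarith
    qed
    then have "((f p)\<^sup>2 * x\<^sup>2 - 2 * ((f p * f p) * x) * l) / (e + \<epsilon>) \<le> (f p * (x - l))\<^sup>2 / (e + \<epsilon>)"
      using e\<epsilon>[OF p] unfolding e_def by (intro divide_right_mono) auto
    moreover have "((f p)\<^sup>2 * x\<^sup>2 - 2 * ((f p * f p) * x) * l) / (e + \<epsilon>) = R p - 2 * w p * l"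
      unfolding R_def w_def x_def e_def by (simp add: diff_divide_distrib)
    ultimately have Rv: "R p - 2 * w p * l \<le> ?H ?v ?v" using v by linarith
    have \<mu>ff: "0 \<le> \<mu> * (f p * f p)" using \<mu> by simp
    have ips: "ip (grad h f) (grad h f) p = ?H (grad h f c p) (grad h f c p)" "ip Y Y p = ?H (Y c p) (Y c p)"
      by (simp_all only: c_def)
    from \<mu>ff Rv show "R p \<le> G p + divg Z1 p + divg Z2 p"
      unfolding G_eq d1 d2 vv l_def[symmetric] ips by linarith
  qed
  have ip_cont: "continuous_on S (ip V W)" if "Ck_vfield 1 \<B> V" "Ck_vfield 1 \<B> W" for V W
    by (rule Ck_fun_continuous_on[OF bil_Ck(1)[OF that]])
  have f_cont: "continuous_on S f" by (rule Ck_fun_continuous_on[OF f])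
  have "continuous_on S (\<lambda>p. ip (grad h f) (grad h f) p + \<mu> * (f p * f p) - (f p * f p) * divg Y p + (f p * f p) * ip Y Y p)"
    by (intro continuous_intros ip_cont gf Y1 f_cont divg_continuous)
  then have "continuous_on S G"
    by (rule continuous_on_cong[THEN iffD2, rotated 2]) (simp_all add: G_eq)
  then have intG: "integrable dA G" by (rule integrable_continuous_S)
  have "continuous_on S R"
    unfolding R_def[abs_def] using e\<epsilon>
    by (intro continuous_intros ip_cont X \<xi> f_cont) fastforce
  then have intR: "integrable dA R" by (rule integrable_continuous_S)
  have intZ: "integrable dA (divg Z1)" "integrable dA (divg Z2)"
    by (intro integrable_continuous_S divg_continuous Z1 Z2)+
  have "(LINT p|dA. R p) \<le> (LINT p|dA. G p + divg Z1 p + divg Z2 p)"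
    using intR intG intZ ineq by (intro integral_mono) (auto simp: space_dA)
  also have "\<dots> = (LINT p|dA. G p)"
    using intG intZ divergence_theorem[OF Z1] divergence_theorem[OF Z2] by simp
  finally show ?thesis unfolding R_def G_def .
qed

text \<open>The integrands are dominated by \<open>f\<^sup>2 |X|\<^sup>2\<close>, uniformly in \<open>\<epsilon>\<close>. At a zero of \<open>\<xi>\<close> they vanish, and
  so does the limit because \<open>0 / 0 = 0\<close>.\<close>

lemma integral_inequality:
  assumes X: "Ck_vfield 1 \<B> X" and \<xi>: "Ck_vfield 1 \<B> \<xi>" and f: "continuous_on S f"
    and bound: "\<And>\<epsilon>. \<epsilon> > 0 \<Longrightarrow> (LINT p|dA. (f p)\<^sup>2 * (ip X \<xi> p)\<^sup>2 / (ip \<xi> \<xi> p + \<epsilon>)) \<le> C"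
  shows "(LINT p|dA. (f p)\<^sup>2 * (ip X \<xi> p)\<^sup>2 / ip \<xi> \<xi> p) \<le> C"
proof -
  define R where "R n p = (f p)\<^sup>2 * (ip X \<xi> p)\<^sup>2 / (ip \<xi> \<xi> p + inverse (real (Suc n)))" for n p
  have ip_cont: "continuous_on S (ip V W)" if "Ck_vfield 1 \<B> V" "Ck_vfield 1 \<B> W" for V W
    by (rule Ck_fun_continuous_on[OF bil_Ck(1)[OF that]])
  have e: "ip \<xi> \<xi> p \<ge> 0" if "p \<in> S" for p using h_nonneg[OF chart_atE[OF atlas that]] .
  have CS: "(ip X \<xi> p)\<^sup>2 \<le> ip X X p * ip \<xi> \<xi> p" if "p \<in> S" for p
    using chart_atE[OF atlas that] by (intro bil_Cauchy_Schwarz h_sym h_pos)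
  have "(\<lambda>n. LINT p|dA. R n p) \<longlonglongrightarrow> (LINT p|dA. (f p)\<^sup>2 * (ip X \<xi> p)\<^sup>2 / ip \<xi> \<xi> p)"
  proof (rule integral_dominated_convergence[where w = "\<lambda>p. (f p)\<^sup>2 * ip X X p"])
    show "R n \<in> borel_measurable dA" for n
      unfolding R_def[abs_def] using e
      by (intro borel_measurable_continuous_S continuous_intros ip_cont X \<xi> f) (smt (verit) inverse_positive_iff_positive of_nat_0_less_iff zero_less_Suc)
    show "(\<lambda>p. (f p)\<^sup>2 * (ip X \<xi> p)\<^sup>2 / ip \<xi> \<xi> p) \<in> borel_measurable dA"
      by (intro borel_measurable_divide borel_measurable_continuous_S continuous_intros ip_cont X \<xi> f)
    show "integrable dA (\<lambda>p. (f p)\<^sup>2 * ip X X p)"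
      by (intro integrable_continuous_S continuous_intros ip_cont X f)
    show "AE p in dA. (\<lambda>n. R n p) \<longlonglongrightarrow> (f p)\<^sup>2 * (ip X \<xi> p)\<^sup>2 / ip \<xi> \<xi> p"
    proof (rule AE_I2)
      fix p assume "p \<in> space dA"
      then have p: "p \<in> S" by (simp add: space_dA)
      show "(\<lambda>n. R n p) \<longlonglongrightarrow> (f p)\<^sup>2 * (ip X \<xi> p)\<^sup>2 / ip \<xi> \<xi> p"
      proof (cases "ip \<xi> \<xi> p = 0")
        case True
        then have "ip X \<xi> p = 0" using CS[OF p] by simp
        then show ?thesis by (simp add: R_def)
      next
        case False
        have "(\<lambda>n. ip \<xi> \<xi> p + inverse (real (Suc n))) \<longlonglongrightarrow> ip \<xi> \<xi> p + 0"
          by (intro tendsto_add tendsto_const LIMSEQ_inverse_real_of_nat)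
        then show ?thesis unfolding R_def using False by (intro tendsto_divide tendsto_const) simp_all
      qed
    qed
    show "AE p in dA. norm (R n p) \<le> (f p)\<^sup>2 * ip X X p" for n
    proof (rule AE_I2)
      fix p assume "p \<in> space dA"
      then have p: "p \<in> S" by (simp add: space_dA)
      let ?e = "ip \<xi> \<xi> p + inverse (real (Suc n))"
      have pos: "?e > 0" using e[OF p] by (intro add_nonneg_pos) auto
      have XX: "ip X X p \<ge> 0" using h_nonneg[OF chart_atE[OF atlas p]] .
      have "(ip X \<xi> p)\<^sup>2 \<le> ip X X p * ?e"
        using CS[OF p] XX by (simp add: distrib_left add_increasing2)
      then have "(ip X \<xi> p)\<^sup>2 / ?e \<le> ip X X p" using pos by (simp only: pos_divide_le_eq)
      then have "(f p)\<^sup>2 * ((ip X \<xi> p)\<^sup>2 / ?e) \<le> (f p)\<^sup>2 * ip X X p" by (intro mult_left_mono) auto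
      moreover have "norm (R n p) = (f p)\<^sup>2 * ((ip X \<xi> p)\<^sup>2 / ?e)"
        using pos by (simp add: R_def abs_mult)
      ultimately show "norm (R n p) \<le> (f p)\<^sup>2 * ip X X p" by simp
    qed
  qed
  moreover have "(LINT p|dA. R n p) \<le> C" for n unfolding R_def by (rule bound) simp
  ultimately show ?thesis by (intro LIMSEQ_le_const2) auto
qed

end

theorem proposition3:
  fixes M S :: "'a::{second_countable_topology, t2_space} set"
    and \<A> :: "('a, 3) chart set" and \<B> :: "('a, 2) chart set"
    and g K :: "('a, 3) tensor2" and \<eta> \<nu> :: "('a, 3) vfield" and f :: "'a \<Rightarrow> real"
  assumes "initial_data_set M \<A> g K"
    and "killing_field M \<A> g \<eta>" and "\<exists>p\<in>M. \<not> vanishes_at \<A> \<eta> p"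
    and "invariant_tensor2 \<A> \<eta> K"
    and "stable_mots M \<A> g K S \<B> \<nu>"
    and "invariant_set M \<A> \<eta> S"
    and "smooth_fun \<B> f" and "invariant_fun \<B> (tangent_part \<A> g \<eta>) f"
  shows "let h = pullback2 \<A> g; dA = riemannian_measure S \<B> h;
             X\<eta> = proj_vec h (tangent_part \<A> g \<eta>) (vec_X \<A> g K \<nu>)
         in (LINT p:{p\<in>S. \<not> vanishes_at \<A> \<eta> p}|dA.
               normsq_vec h X\<eta> (chart_at \<B> p) p * (f p)\<^sup>2)
          \<le> (LINT p|dA. normsq_vec h (grad h f) (chart_at \<B> p) p
                         + mots_Q \<A> g K \<nu> (chart_at \<B> p) p * (f p)\<^sup>2)"
proof -
  have data: "smooth_atlas M \<A>" "riemannian_metric \<A> g" and K: "smooth_sym_tensor2 \<A> K"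
    using assms(1) unfolding initial_data_set_def smooth_manifold_def by blast+
  have mots: "closed_surface M \<A> S \<B>" "unit_normal \<A> g S \<B> \<nu>"
    using assms(5) unfolding stable_mots_def mots_def by blast+
  interpret killing_surface M S \<A> \<B> g \<nu> \<eta>
    by unfold_locales (use data mots assms(2,6) in blast)+
  define X where "X = vec_X \<A> g K \<nu>"
  have X1: "Ck_vfield 1 \<B> X" unfolding X_def vec_X_def by (rule Ck_vfield_tangent_dual[OF K \<nu>_along])
  obtain \<mu> where \<mu>: "\<mu> \<ge> 0" "principal_eigenvalue S \<B> (stability_operator \<A> g K \<B> \<nu>) \<mu>"
    using assms(5) unfolding stable_mots_def by blast
  then obtain \<phi> :: "'a \<Rightarrow> real" where \<phi>: "smooth_fun \<B> \<phi>" "\<forall>p\<in>S. \<phi> p > 0"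
    "(\<lambda>p. complex_of_real (\<phi> p)) \<in> eigenspace S \<B> (stability_operator \<A> g K \<B> \<nu>) (of_real \<mu>)"
    unfolding principal_eigenvalue_def by blast
  have L: "stability_operator \<A> g K \<B> \<nu> \<phi> p = \<mu> * \<phi> p" if "p \<in> S" for p
  proof -
    have "complexify (stability_operator \<A> g K \<B> \<nu>) (\<lambda>p. complex_of_real (\<phi> p)) p =
        complex_of_real \<mu> * complex_of_real (\<phi> p)"
      using \<phi>(3) that unfolding eigenspace_def by blast
    from arg_cong[OF this, of Re] show ?thesis by (simp add: complexify_def)
  qed
  have inv_g: "invariant_tensor2 \<A> \<eta> g" using assms(2) unfolding killing_field_def by blast
  have lie_e: "lie_fun \<xi> (surf.ip \<xi> \<xi>) c p = 0" if c: "c \<in> \<B>" "p \<in> cdom c" for c p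
  proof (rule lie_fun_invariant_bil[OF g_tensor inv_g \<eta>_along \<eta>_commutes \<eta>_along \<eta>_commutes surf.bil_Ck(1)[OF \<xi>_Ck \<xi>_Ck] _ c])
    fix d C q assume q: "d \<in> \<B>" "C \<in> \<A>" "q \<in> cdom d" "q \<in> cdom C"
    show "surf.ip \<xi> \<xi> q = bil (g C q) (\<eta> C q) (\<eta> C q)"
      unfolding surf.bil_Ck(2)[OF \<xi>_Ck[of 1] \<xi>_Ck[of 1] q(1,3)] bil_pullback2[OF g_tensor q(1,3,2,4)] \<xi>_related[OF q(1,3,2,4)] ..
  qed
  have lie_x: "lie_fun \<xi> (surf.ip X \<xi>) c p = 0" if c: "c \<in> \<B>" "p \<in> cdom c" for c p
  proof (rule lie_fun_invariant_bil[OF K assms(4) \<nu>_along \<nu>_commutes \<eta>_along \<eta>_commutes surf.bil_Ck(1)[OF X1 \<xi>_Ck] _ c])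
    fix d C q assume q: "d \<in> \<B>" "C \<in> \<A>" "q \<in> cdom d" "q \<in> cdom C"
    show "surf.ip X \<xi> q = bil (K C q) (\<nu> C q) (\<eta> C q)"
      unfolding surf.bil_Ck(2)[OF X1 \<xi>_Ck[of 1] q(1,3)] unfolding X_def vec_X_def
        bil_tangent_dual[OF K \<nu>_along q(1,3,2,4)] \<xi>_related[OF q(1,3,2,4)] ..
  qed
  let ?Q = "\<lambda>p. mots_Q \<A> g K \<nu> (chart_at \<B> p) p"
  have f: "Ck_fun k \<B> f" for k by (rule smooth_fun_imp_Ck_fun[OF assms(7)])
  have lie_f: "lie_fun \<xi> f c p = 0" if "c \<in> \<B>" "p \<in> cdom c" for c p
    using assms(8) that unfolding invariant_fun_def by blast
  have \<phi>2: "Ck_fun 2 \<B> \<phi>" by (rule smooth_fun_imp_Ck_fun[OF \<phi>(1)])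
  have eigen: "- laplacian h \<phi> (chart_at \<B> p) p + 2 * surf.ip X (grad h \<phi>) p
       + (?Q p - normsq_vec h X (chart_at \<B> p) p + div_vfield h X (chart_at \<B> p) p) * \<phi> p = \<mu> * \<phi> p"
    if "p \<in> S" for p
    using L[OF that] unfolding stability_operator_def Let_def X_def .
  have reg: "(LINT p|surf.dA. (f p)\<^sup>2 * (surf.ip X \<xi> p)\<^sup>2 / (surf.ip \<xi> \<xi> p + \<epsilon>)) \<le>
      (LINT p|surf.dA. normsq_vec h (grad h f) (chart_at \<B> p) p + ?Q p * (f p)\<^sup>2)" if "\<epsilon> > 0" for \<epsilon>
    by (rule surf.integral_inequality_regularized[OF \<mu>(1) \<phi>2 _ X1 eigen \<xi>_Ck div_\<xi> lie_x lie_e f lie_f that])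
      (use \<phi>(2) in blast)+
  have lim: "(LINT p|surf.dA. (f p)\<^sup>2 * (surf.ip X \<xi> p)\<^sup>2 / surf.ip \<xi> \<xi> p) \<le>
      (LINT p|surf.dA. normsq_vec h (grad h f) (chart_at \<B> p) p + ?Q p * (f p)\<^sup>2)"
    by (rule surf.integral_inequality[OF X1 \<xi>_Ck surf.Ck_fun_continuous_on[OF f[of 1]] reg])
  have "(LINT p:{p\<in>S. \<not> vanishes_at \<A> \<eta> p}|surf.dA. normsq_vec h (proj_vec h \<xi> X) (chart_at \<B> p) p * (f p)\<^sup>2) =
      (LINT p|surf.dA. (f p)\<^sup>2 * (surf.ip X \<xi> p)\<^sup>2 / surf.ip \<xi> \<xi> p)"
    unfolding set_lebesgue_integral_def
  proof (rule Bochner_Integration.integral_cong[OF refl])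
    fix p assume "p \<in> space surf.dA"
    then have p: "p \<in> S" by (simp add: surf.space_dA)
    define c where "c = chart_at \<B> p"
    have c: "c \<in> \<B>" "p \<in> cdom c" using chart_atE[OF S_atlas p] by (simp_all add: c_def)
    show "indicator {p \<in> S. \<not> vanishes_at \<A> \<eta> p} p *\<^sub>R (normsq_vec h (proj_vec h \<xi> X) (chart_at \<B> p) p * (f p)\<^sup>2) =
      (f p)\<^sup>2 * (surf.ip X \<xi> p)\<^sup>2 / surf.ip \<xi> \<xi> p"
    proof (cases "\<xi> c p = 0")
      case True
      then show ?thesis using vanishes_at_iff[OF c] unfolding c_def[symmetric] by (simp add: bil_def)
    next
      case False
      then have "\<not> vanishes_at \<A> \<eta> p" and "bil (h c p) (\<xi> c p) (\<xi> c p) > 0"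
        using vanishes_at_iff[OF c] surf.h_pos[OF c] by blast+
      then show ?thesis
        using p unfolding c_def[symmetric] normsq_vec_def proj_vec_def bil_scale_left bil_scale_right
        by (simp add: power2_eq_square)
    qed
  qed
  with lim show ?thesis unfolding Let_def X_def surf.dA_def by simp
qed

end
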